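(* Let $t_3 > 0$ and define $t_{0,crit} = \frac{1}{8 t_3^2}$. Let $t_0 \in (0, t_{0,crit})$. Then, if $n$ is sufficiently large, there exists a monic polynomial $P_{n,n}$ of degree $n$ with $$\langle P_{n,n}, z^j\rangle = 0, \qquad j=0,1,\ldots,n-1,$$ where $\langle\cdot,\cdot\rangle$ is the ($n$-dependent) Hermitian form defined in the context. In addition, the zeros of $P_{n,n}$ accumulate as $n\to\infty$ on the set $$ \Sigma_1 = \{ z \in \mathbb C \mid z^3 \in [0,(x^* )^3]\} = \bigcup_{j=0}^2 [0,\omega^j x^*], \qquad \omega = e^{2\pi i/3}, \qquad x^* = \frac{3}{4t_3}\left(1-\sqrt{1-8t_0t_3^2}\right)^{2/3}; $$ that is, for every open set $U \supset \Sigma_1$, all zeros of such $P_{n,n}$ lie in $U$ for all sufficiently large $n$.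
   Context: Fix $t_0,t_3>0$ and a positive integer $n$. Let $\Gamma_0,\Gamma_1,\Gamma_2$ be simple smooth curves in $\mathbb C$, where $\Gamma_j$ starts at infinity in the direction $\arg z=\theta_j$ and ends at infinity in the direction $\arg z=\theta_{j+1}$, with $\theta_j=-\frac{\pi}{3}+\frac{2\pi j}{3}$. $\overline{\Gamma}_k$ is the image of $\Gamma_k$ under complex conjugation, with orientation carried over by conjugation. For a polynomial $g$, $\overline g$ is the polynomial with conjugated coefficients. The Hermitian form on complex polynomials is $$ \langle f,g\rangle = \frac{1}{2\pi i}\sum_{j=0}^2\sum_{k=0}^2 \epsilon_{j,k}\int_{\Gamma_j}dz\int_{\overline{\Gamma}_k}dw\; f(z)\,\overline g(w)\, e^{-\frac{n}{t_0}\left(wz-\frac{t_3}{3}(w^3+z^3)\right)}, \qquad (\epsilon_{j,k})_{j,k=0}^2=\begin{pmatrix}0&-1&1\\1&0&-1\\-1&1&0\end{pmatrix}. $$ It need not be positive definite. *)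

theory Defs
  imports "HOL-Complex_Analysis.Complex_Analysis"
begin

definition goes_to_infinity_in_direction ::
    "(real \<Rightarrow> complex) \<Rightarrow> real filter \<Rightarrow> real \<Rightarrow> bool" where
  "goes_to_infinity_in_direction \<gamma> F \<theta> \<longleftrightarrow>
     filterlim \<gamma> at_infinity F \<and> ((\<lambda>t. sgn (\<gamma> t)) \<longlongrightarrow> cis \<theta>) F"

text \<open>Unbounded curves are parametrized over the whole real line. As usual for contour
  integration, ``smooth'' means continuously differentiable with nonvanishing derivative.\<close>

definition simple_smooth_curve :: "(real \<Rightarrow> complex) \<Rightarrow> bool" where
  "simple_smooth_curve \<gamma> \<longleftrightarrow>
     inj \<gamma> \<and> \<gamma> C1_differentiable_on UNIV \<and> (\<forall>t. vector_derivative \<gamma> (at t) \<noteq> 0)"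

definition theta :: "nat \<Rightarrow> real" where
  "theta j = - pi / 3 + 2 * pi * real j / 3"

definition admissible_contours :: "(nat \<Rightarrow> real \<Rightarrow> complex) \<Rightarrow> bool" where
  "admissible_contours \<Gamma> \<longleftrightarrow>
     (\<forall>j<3. simple_smooth_curve (\<Gamma> j) \<and>
            goes_to_infinity_in_direction (\<Gamma> j) at_bot (theta j) \<and>
            goes_to_infinity_in_direction (\<Gamma> j) at_top (theta (Suc j)))"

text \<open>The Henstock--Kurzweil integral over the real line is the limit of the integrals over
  \<open>{a..b}\<close> as \<open>a\<close> and \<open>b\<close> tend to the two infinities independently. Hence this is the improper
  contour integral, with no demand of absolute convergence, which may fail for contours
  oscillating strongly near infinity. Below, the integrands are entire and decay in sectors around
  the end directions of the contours, so all integrals converge.\<close>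

definition line_contour_integral :: "(real \<Rightarrow> complex) \<Rightarrow> (complex \<Rightarrow> complex) \<Rightarrow> complex" where
  "line_contour_integral \<gamma> f = integral UNIV (\<lambda>t. f (\<gamma> t) * vector_derivative \<gamma> (at t))"

definition eps :: "nat \<Rightarrow> nat \<Rightarrow> complex" where
  "eps j k = [[0, -1, 1], [1, 0, -1], [-1, 1, 0]] ! j ! k"

definition herm_form ::
    "(nat \<Rightarrow> real \<Rightarrow> complex) \<Rightarrow> real \<Rightarrow> real \<Rightarrow> nat \<Rightarrow> complex poly \<Rightarrow> complex poly \<Rightarrow> complex" where
  "herm_form \<Gamma> t0 t3 n f g =
     1 / (2 * of_real pi * \<i>) *
     (\<Sum>j<3. \<Sum>k<3. eps j k *
        line_contour_integral (\<Gamma> j) (\<lambda>z.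
          line_contour_integral (\<lambda>t. cnj (\<Gamma> k t)) (\<lambda>w.
            poly f z * poly (map_poly cnj g) w *
            exp (- (of_nat n / of_real t0) * (w * z - of_real t3 / 3 * (w ^ 3 + z ^ 3))))))"

definition is_monic_OP ::
    "(nat \<Rightarrow> real \<Rightarrow> complex) \<Rightarrow> real \<Rightarrow> real \<Rightarrow> nat \<Rightarrow> complex poly \<Rightarrow> bool" where
  "is_monic_OP \<Gamma> t0 t3 n P \<longleftrightarrow>
     degree P = n \<and> lead_coeff P = 1 \<and>
     (\<forall>j<n. herm_form \<Gamma> t0 t3 n P (monom 1 j) = 0)"

definition t0_crit :: "real \<Rightarrow> real" where
  "t0_crit t3 = 1 / (8 * t3\<^sup>2)"

definition x_star :: "real \<Rightarrow> real \<Rightarrow> real" where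
  "x_star t0 t3 = 3 / (4 * t3) * (1 - sqrt (1 - 8 * t0 * t3\<^sup>2)) powr (2 / 3)"

definition Sigma1 :: "real \<Rightarrow> real \<Rightarrow> complex set" where
  "Sigma1 t0 t3 = {z. z ^ 3 \<in> complex_of_real ` {0..(x_star t0 t3) ^ 3}}"

end

theory Submission
  imports Defs "HOL-Real_Asymp.Real_Asymp"
begin

text \<open>
  Deforming the contours to rays turns the Hermitian form into explicit series. They show that the form
  is invariant under the rotation by \<open>2 pi / 3\<close> and satisfies the string equation. Hence
  \<open>P_(k+1) = z P_k - a_k P_(k-2)\<close> with \<open>a_k = X_k X_(k-1) / t3^3\<close>, where
  \<open>X_k = t3^2 h_k / h_(k-1)\<close> for the squared norms \<open>h_k\<close>, and with \<open>T = n / (t0 t3^2)\<close> the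
  discrete Painleve I equation \<open>X_k (1 - X_(k-1) - X_(k+1)) = k / T\<close> holds.

  The initial ratio \<open>X_1\<close> solves a Riccati equation in \<open>T\<close>, and so do all \<open>X_k\<close>, driven by
  \<open>X_(k-1)\<close>. Along this flow \<open>X_k\<close> relaxes to the equilibrium \<open>f (k / T)\<close>,
  \<open>f x = (1 - sqrt (1 - 8 x)) / 4\<close>. A crude estimate starts this for large \<open>T / k\<close>, and the range extends down
  to every \<open>T / k > 8\<close>: raising the index multiplies the deviation by a factor \<open>l\<close>, but it then
  decays at a rate \<open>r\<close> for a time close to \<open>T / k\<close>, and \<open>ln l < r T / k\<close> reduces to an
  elementary inequality for the area hyperbolic tangent.

  So for large \<open>n\<close> all \<open>X_k\<close> with \<open>k \<le> n\<close> are positive and at most \<open>f (t0 t3^2) + o(1)\<close>, and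
  \<open>P_n\<close> exists and is unique. Bounding the arguments of the ratios \<open>P_(k+1) / P_k\<close>
  excludes zeros off the star, and bounding these ratios from below excludes zeros with
  \<open>z^3 > 27 / 4 max a_k\<close>, where the bound tends to the cube of \<open>x*\<close>.
\<close>

section \<open>Scalar differential inequalities\<close>

text \<open>The form need not be positive definite, so nonvanishing of the norms, and with it
  existence and uniqueness, has to be earned. The discrete equation alone cannot give it: linearised
  at the equilibrium it has the multipliers l > 1 and 1 / l, so iterating it in k at fixed T
  amplifies every error exponentially. The flow in T supplies the missing stability, and it is
  usable because it can be made triangular: the equation of \<open>X k\<close> involves only
  \<open>X (k - 1)\<close>, so induction on k is possible. Of the initial ratio only the Riccati
  equation and the bound X1 < 1 enter; the bound keeps it below the almost stationary, repelling
  value 1. The condition on t0 says T / n > 8, that is, the two roots of x (1 - 2 x) = k / T stay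
  real and distinct for k \<le> n. At 8 they merge, l tends to 1 and the damping rate to 0 together,
  so crude estimates cannot reach it; a strict inequality at every larger value, combined with an
  infimum argument, does.\<close>

lemma last_crossing:
  fixes u :: "real \<Rightarrow> real"
  assumes "a \<le> b" "continuous_on {a..b} u" "u a \<le> c" "c < u b"
  obtains s where "a \<le> s" "s < b" "u s = c" "\<And>t. s < t \<Longrightarrow> t \<le> b \<Longrightarrow> c < u t"
proof -
  define Z where "Z = {t \<in> {a..b}. u t \<le> c}"
  have "compact Z"
  proof -
    have "Z = {a..b} \<inter> ({a..b} \<inter> u -` {..c})" unfolding Z_def by auto
    moreover have "closed ({a..b} \<inter> u -` {..c})"
      using assms(2) by (intro continuous_closed_preimage) auto
    ultimately show ?thesis using compact_Int_closed[OF compact_Icc] by metis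
  qed
  moreover have "a \<in> Z" using assms unfolding Z_def by auto
  ultimately obtain s where s: "s \<in> Z" "\<And>t. t \<in> Z \<Longrightarrow> t \<le> s"
    using compact_attains_sup[of Z] by blast
  have sb: "s < b" using s(1) assms(4) unfolding Z_def by (cases "s = b") auto
  have gt: "c < u t" if "s < t" "t \<le> b" for t
  proof (rule ccontr)
    assume "\<not> c < u t"
    then have "t \<in> Z" using s(1) that unfolding Z_def by auto
    then show False using s(2)[of t] that by auto
  qed
  have "u s = c"
  proof (rule ccontr)
    assume "u s \<noteq> c"
    then have "u s < c" using s(1) unfolding Z_def by auto
    moreover have "continuous_on {s..b} u"
      using assms(2) by (rule continuous_on_subset) (use s(1) Z_def in auto)
    ultimately obtain t where "s \<le> t" "t \<le> b" "u t = c"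
      using IVT'[of u s c b] assms(4) sb by auto
    then show False using gt[of t] \<open>u s < c\<close> by (cases "s = t") auto
  qed
  then show ?thesis using that[of s] sb gt s(1) unfolding Z_def by auto
qed

text \<open>The differential inequality is known only between m and M. At level M the derivative is
  negative, so M is a barrier; after a visit below m, the mean value theorem from the last crossing
  forbids a return; otherwise \<open>(u t - q) * exp (r * (t - a))\<close> is nonincreasing. A
  target q < m makes level m reachable in finite time.\<close>

lemma band_decay:
  fixes u u' :: "real \<Rightarrow> real"
  assumes ab: "a \<le> b" and der: "\<And>t. a \<le> t \<Longrightarrow> t \<le> b \<Longrightarrow> (u has_real_derivative u' t) (at t)"
    and M: "u a \<le> M" and m: "m < M" and q: "q \<le> m" and r: "0 < r"
    and dec: "\<And>t. a \<le> t \<Longrightarrow> t \<le> b \<Longrightarrow> m < u t \<Longrightarrow> u t \<le> M \<Longrightarrow> u' t \<le> - r * (u t - q)"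
  shows "u b \<le> max m (q + exp (- r * (b - a)) * (u a - q))"
proof -
  have cont: "continuous_on {s..t} u" if "a \<le> s" "t \<le> b" for s t
    by (rule DERIV_continuous_on[of _ _ u'], rule has_field_derivative_at_within, rule der) (use that in auto)
  have uM: "u t \<le> M" if t: "a \<le> t" "t \<le> b" for t
  proof (rule ccontr)
    assume "\<not> u t \<le> M"
    then obtain s where s: "a \<le> s" "s < t" "u s = M" "\<And>x. s < x \<Longrightarrow> x \<le> t \<Longrightarrow> M < u x"
      using last_crossing[of a t u M] cont[of a t] M t by auto
    have "u' s \<le> - r * (M - q)" using dec[of s] s t m by auto
    also have "\<dots> < 0" using r m q by (simp add: mult_pos_pos)
    finally have "u' s < 0" .
    then obtain d where "d > 0" "\<And>h. 0 < h \<Longrightarrow> h < d \<Longrightarrow> u (s + h) < u s"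
      using DERIV_neg_dec_right[OF der[of s]] s t by auto
    moreover define h where "h = min (d / 2) (t - s)"
    ultimately have "0 < h" "u (s + h) < u s" using s(2) by auto
    moreover have "s + h \<le> t" unfolding h_def by (simp add: min_def)
    ultimately show False using s(3) s(4)[of "s + h"] by auto
  qed
  show ?thesis
  proof (cases "\<exists>t\<in>{a..b}. u t \<le> m")
    case True
    then obtain t0 where t0: "a \<le> t0" "t0 \<le> b" "u t0 \<le> m" by auto
    have "u b \<le> m"
    proof (rule ccontr)
      assume "\<not> u b \<le> m"
      then obtain s where s: "t0 \<le> s" "s < b" "u s = m" "\<And>x. s < x \<Longrightarrow> x \<le> b \<Longrightarrow> m < u x"
        using last_crossing[of t0 b u m] cont[of t0 b] t0 by auto
      obtain z where z: "s < z" "z < b" "u b - u s = (b - s) * u' z"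
        using MVT2[of s b u u'] der s(1,2) t0 by (meson dual_order.trans order_less_imp_le)
      have "u' z \<le> - r * (u z - q)" using dec[of z] z s t0 uM[of z] by auto
      also have "\<dots> \<le> 0" using r q s(4)[of z] z by (auto simp: mult_nonneg_nonneg)
      finally have "(b - s) * u' z \<le> 0" using s(2) by (intro mult_nonneg_nonpos) auto
      then have "u b \<le> u s" using z by auto
      then show False using s(3) \<open>\<not> u b \<le> m\<close> by auto
    qed
    then show ?thesis by auto
  next
    case False
    then have gt: "m < u t" if "a \<le> t" "t \<le> b" for t using that by force
    define w where "w t = (u t - q) * exp (r * (t - a))" for t
    have "w b \<le> w a"
    proof (rule DERIV_nonpos_imp_nonincreasing[OF ab])
      fix t assume t: "a \<le> t" "t \<le> b"
      have "(w has_real_derivative (u' t + r * (u t - q)) * exp (r * (t - a))) (at t)"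
        unfolding w_def using der[OF t]
        by (auto intro!: derivative_eq_intros simp: algebra_simps)
      moreover have "(u' t + r * (u t - q)) * exp (r * (t - a)) \<le> 0"
        using dec[OF t gt[OF t] uM[OF t]] by (intro mult_nonpos_nonneg) auto
      ultimately show "\<exists>y. (w has_real_derivative y) (at t) \<and> y \<le> 0" by blast
    qed
    then have "(u b - q) * exp (r * (b - a)) \<le> u a - q" by (simp add: w_def)
    then have "exp (- r * (b - a)) * ((u b - q) * exp (r * (b - a))) \<le> exp (- r * (b - a)) * (u a - q)"
      by (intro mult_left_mono) auto
    moreover have "exp (- r * (b - a)) * ((u b - q) * exp (r * (b - a))) = u b - q"
    proof -
      have "exp (- r * (b - a)) * exp (r * (b - a)) = 1" by (simp flip: exp_add)
      then show ?thesis by (metis mult.commute mult.left_commute mult.right_neutral)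
    qed
    ultimately have "u b - q \<le> exp (- r * (b - a)) * (u a - q)" by metis
    then show ?thesis by auto
  qed
qed

lemma positive_invariant:
  fixes u u' :: "real \<Rightarrow> real"
  assumes ab: "a \<le> b" and der: "\<And>t. a \<le> t \<Longrightarrow> t \<le> b \<Longrightarrow> (u has_real_derivative u' t) (at t)"
    and pos: "0 < u a" and up: "\<And>t. a \<le> t \<Longrightarrow> t \<le> b \<Longrightarrow> u t = 0 \<Longrightarrow> 0 < u' t"
  shows "0 < u b"
proof (rule ccontr)
  assume ub: "\<not> 0 < u b"
  have cu: "continuous_on {a..b} u"
    by (rule DERIV_continuous_on[of _ _ u']) (auto intro: der has_field_derivative_at_within)
  \<comment> \<open>Reflected in time, \<open>last_crossing\<close> yields the first zero of u,
    where a positive derivative is impossible.\<close>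
  have "continuous_on {a..b} (\<lambda>t. u (a + b - t))"
    by (rule continuous_on_compose2[OF cu]) (auto intro!: continuous_intros)
  then obtain s where s: "a \<le> s" "s < b" "u (a + b - s) = 0" "\<And>t. s < t \<Longrightarrow> t \<le> b \<Longrightarrow> 0 < u (a + b - t)"
    using last_crossing[of a b "\<lambda>t. u (a + b - t)" 0] ab ub pos by auto
  have "0 < u' (a + b - s)" using up[of "a + b - s"] s by auto
  then obtain d where d: "d > 0" "\<And>h. 0 < h \<Longrightarrow> h < d \<Longrightarrow> u (a + b - s - h) < u (a + b - s)"
    using DERIV_pos_inc_left[OF der[of "a + b - s"]] s by auto
  define h where "h = min (d / 2) (b - s)"
  have "0 < h" "h < d" "s + h \<le> b" using d s unfolding h_def by auto
  then show False using d(2)[of h] s(3) s(4)[of "s + h"] by (auto simp: algebra_simps)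
qed

text \<open>Reads off the first branch of the maximum in \<open>band_decay\<close> once enough time
  has passed for the exponential branch.\<close>

lemma le_max_elim: "(x::real) \<le> max a (q + b) \<Longrightarrow> b \<le> c \<Longrightarrow> q + c \<le> a \<Longrightarrow> x \<le> a"
  by linarith

section \<open>Flow of the discrete Painleve I equation\<close>

text \<open>In the application \<open>X k T\<close> is \<open>t3\<^sup>2\<close> times the ratio of the squared norms of the monic orthogonal
  polynomials of degrees \<open>k\<close> and \<open>k - 1\<close>, as a function of \<open>T = n / (t0 * t3\<^sup>2)\<close>.\<close>

locale dPI_flow =
  fixes X1 :: "real \<Rightarrow> real"
  assumes riccati: "T > 0 \<Longrightarrow>
      (X1 has_real_derivative ((1 - X1 T) * (1 / T - X1 T) - X1 T / T) / 3) (at T)"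
    and X1_less_1: "T > 0 \<Longrightarrow> X1 T < 1"
begin

fun X :: "nat \<Rightarrow> real \<Rightarrow> real" where
  "X 0 T = 0"
| "X (Suc 0) T = X1 T"
| "X (Suc (Suc k)) T = 1 - (real (Suc k) / T) / X (Suc k) T - X k T"

text \<open>The discrete equation eliminates \<open>X (k + 2)\<close> from the derivative of \<open>X (k + 1)\<close>, which makes the
  system of differential equations triangular.\<close>

definition V :: "nat \<Rightarrow> real \<Rightarrow> real" where
  "V k T = ((1 - X (Suc k) T) * (real (Suc k) / T - X (Suc k) T * (1 - 2 * X k T)) - X (Suc k) T / T) / 3"

text \<open>Differentiating the recurrence expresses the new derivative by those of the two
  preceding entries. The recurrence at the lower indices then reduces everything to three neighbours
  x, y, z, and the claim becomes a rational identity.\<close>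

lemma X_deriv:
  assumes "T > 0" "\<And>j. 1 \<le> j \<Longrightarrow> j \<le> k \<Longrightarrow> X j T \<noteq> 0"
  shows "(X (Suc k) has_real_derivative V k T) (at T)"
  using assms
proof (induction k rule: less_induct)
  case (less k)
  show ?case
  proof (cases k)
    case 0
    have "X (Suc 0) = X1" by (rule ext) simp
    then show ?thesis using riccati[OF less.prems(1)] 0 by (simp add: V_def)
  next
    case (Suc m)
    have d1: "(X (Suc m) has_real_derivative V m T) (at T)"
      using less.IH[of m] less.prems Suc by auto
    have nz: "X (Suc m) T \<noteq> 0" using less.prems(2)[of "Suc m"] Suc by auto
    define x y z \<kappa> i where "x = X (Suc m) T" and "y = X m T" and "z = X (Suc k) T"
      and "\<kappa> = real (Suc m) / T" and "i = 1 / T"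
    \<comment> \<open>The derivative of \<open>X m\<close> with \<open>X (m - 1)\<close> traded for
      x by the recurrence at index m. For m = 0 both sides vanish, since then \<kappa> = i.\<close>
    have d0: "(X m has_real_derivative ((1 - y) * (y * (1 - 2 * x) - (\<kappa> - i)) - y * i) / 3) (at T)"
    proof (cases m)
      case 0
      have "X 0 = (\<lambda>_. 0)" by (rule ext) simp
      then show ?thesis using 0 by (simp add: y_def \<kappa>_def i_def)
    next
      case (Suc l)
      have "(X m has_real_derivative V l T) (at T)"
        using less.IH[of l] less.prems \<open>k = Suc m\<close> Suc by auto
      moreover have y0: "y \<noteq> 0" using less.prems(2)[of m] Suc \<open>k = Suc m\<close> unfolding y_def by auto
      have "x = 1 - (real m / T) / y - X l T" using Suc unfolding x_def y_def by simp
      then have "real m / T = y * (1 - X l T - x)" using y0 by simp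
      then have "V l T = ((1 - y) * (y * (1 - 2 * x) - real m / T) - y * i) / 3"
      proof -
        assume c: "real m / T = y * (1 - X l T - x)"
        have "real m / T - y * (1 - 2 * X l T) = y * (1 - 2 * x) - real m / T"
          unfolding c by (simp add: algebra_simps)
        moreover have "V l T = ((1 - y) * (real m / T - y * (1 - 2 * X l T)) - y * i) / 3"
          using Suc unfolding V_def y_def i_def by simp
        ultimately show ?thesis by simp
      qed
      moreover have "real m / T = \<kappa> - i" unfolding \<kappa>_def i_def using less.prems(1) by (simp add: field_simps)
      ultimately show ?thesis by simp
    qed
    have eq: "X (Suc k) = (\<lambda>T. 1 - (real (Suc m) / T) / X (Suc m) T - X m T)"
      using Suc by (intro ext) simp
    have kz: "\<kappa> = x * (1 - y - z)"
    proof -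
      have "z = 1 - \<kappa> / x - y" using Suc unfolding x_def y_def z_def \<kappa>_def by simp
      then show ?thesis using nz unfolding x_def by simp
    qed
    \<comment> \<open>With \<kappa> eliminated the flow is a lattice equation in the neighbours y
      and z.\<close>
    have Vm: "V m T = x * ((1 - x) * (y - z) - i) / 3"
    proof -
      have "V m T = ((1 - x) * (\<kappa> - x * (1 - 2 * y)) - x * i) / 3"
        unfolding V_def x_def y_def \<kappa>_def i_def by simp
      then show ?thesis unfolding kz by (simp add: algebra_simps)
    qed
    have "(X (Suc k) has_real_derivative
        (\<kappa> * i * x + \<kappa> * V m T) / x\<^sup>2 - ((1 - y) * (y * (1 - 2 * x) - (\<kappa> - i)) - y * i) / 3) (at T)"
      unfolding eq using nz less.prems(1)
      by (auto intro!: derivative_eq_intros d0 d1 simp: x_def \<kappa>_def i_def field_simps power2_eq_square)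
    moreover have "(\<kappa> * i * x + \<kappa> * V m T) / x\<^sup>2 = (1 - y - z) * i + (1 - y - z) * ((1 - x) * (y - z) - i) / 3"
      unfolding Vm kz using nz by (simp add: x_def field_simps power2_eq_square)
    moreover have "V k T = ((1 - z) * (\<kappa> + i - z * (1 - 2 * x)) - z * i) / 3"
    proof -
      have kx: "X k T = x" using Suc unfolding x_def by simp
      have kk: "real (Suc k) / T = \<kappa> + i"
        unfolding \<kappa>_def i_def using Suc by (simp add: add_divide_distrib)
      show ?thesis unfolding V_def kx kk z_def[symmetric] by (simp add: i_def)
    qed
    moreover have "(1 - y - z) * i + (1 - y - z) * ((1 - x) * (y - z) - i) / 3
        - ((1 - y) * (y * (1 - 2 * x) - (\<kappa> - i)) - y * i) / 3 = ((1 - z) * (\<kappa> + i - z * (1 - 2 * x)) - z * i) / 3"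
      unfolding kz by (simp add: field_simps)
    ultimately show ?thesis by metis
  qed
qed

text \<open>In y = t * \<open>X (Suc K) t\<close> the flow reads 3 y' = (1 - x) (k - y (1 - 2
  \<open>X K\<close>)) + 2 x, which for small x pulls y towards about k. The bound 3 / 4 at the
  entry time a keeps 1 - x \<ge> 1 / 4, so the pull persists; the waiting time c0 / 2 is what
  \<open>e1\<close> and \<open>e2\<close> convert into the final bounds.\<close>

lemma entry_bounds:
  assumes c0: "0 \<le> c0" and a: "100 * real (Suc K) \<le> a" "a \<le> c0 * real (Suc K)" and t: "a + c0 / 2 \<le> t"
    and nz: "\<And>t j. a \<le> t \<Longrightarrow> 1 \<le> j \<Longrightarrow> j \<le> K \<Longrightarrow> X j t \<noteq> 0"
    and P: "\<And>t. a \<le> t \<Longrightarrow> 0 \<le> X K t \<and> X K t \<le> 1 / 50"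
    and up: "X (Suc K) a \<le> 3 / 4" and lo: "- A \<le> X (Suc K) a" and A: "0 \<le> A"
    and e1: "exp (- (1 / 40) * c0) * c0 \<le> 4" and e2: "exp (- (3 / 20) * c0) * (1 + A * c0) \<le> 1 / 2"
  shows "real (Suc K) / 2 \<le> t * X (Suc K) t \<and> t * X (Suc K) t \<le> 4 * real (Suc K)"
proof -
  define k where "k = real (Suc K)"
  define x y where "x = X (Suc K)" and "y s = s * X (Suc K) s" for s
  define y' where "y' s = x s + s * V K s" for s
  have k1: "k \<ge> 1" unfolding k_def by simp
  have ak: "100 * k \<le> a" using a(1) unfolding k_def .
  have at: "a \<le> t" using t c0 by linarith
  have s100: "100 \<le> s" "100 * k \<le> s" if "a \<le> s" for s using ak k1 that by linarith+
  have der: "(y has_real_derivative y' s) (at s)" if "a \<le> s" for s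
  proof -
    have "(X (Suc K) has_real_derivative V K s) (at s)"
      using X_deriv[of s K] nz[OF that] s100[OF that] by auto
    from DERIV_mult[OF DERIV_ident this] show ?thesis
      unfolding y_def[abs_def] y'_def x_def by (simp add: algebra_simps)
  qed
  have y': "3 * y' s = (1 - x s) * (k - y s * (1 - 2 * X K s)) + 2 * x s" if "a \<le> s" for s
  proof -
    have V: "3 * V K s = (1 - x s) * (k / s - x s * (1 - 2 * X K s)) - x s / s" unfolding V_def x_def k_def by simp
    have "3 * y' s = 3 * x s + s * (3 * V K s)" unfolding y'_def by simp
    also have "\<dots> = (1 - x s) * (k - y s * (1 - 2 * X K s)) + 2 * x s"
      unfolding V y_def x_def[symmetric] using s100(1)[OF that] by (simp add: field_simps)
    finally show ?thesis .
  qed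
  \<comment> \<open>The barrier M contains the initial value and lies above 4 k. Since s \<ge> a
    \<ge> 100 k, staying below it forces y s \<le> 3 / 4 * s, hence x s \<le> 3 / 4.\<close>
  have "y t \<le> max (4 * k) (0 + exp (- (1 / 20) * (t - a)) * (y a - 0))"
  proof (rule band_decay[where u' = y' and M = "max (5 * k) (3 / 4 * a)"])
    show "y a \<le> max (5 * k) (3 / 4 * a)"
      unfolding y_def using mult_left_mono[OF up, of a] s100[of a] by simp
    fix s assume s: "a \<le> s" "s \<le> t" "4 * k < y s" "y s \<le> max (5 * k) (3 / 4 * a)"
    have y34: "y s \<le> 3 / 4 * s" using s(1,4) s100(2)[OF s(1)] k1 by linarith
    have xs: "x s = y s / s" unfolding x_def y_def using s100[OF s(1)] by simp
    define Y G where "Y = k - y s * (1 - 2 * X K s)" and "G = (1 - x s) * Y"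
    have y0: "0 \<le> y s" using s(3) k1 by linarith
    have x34: "x s \<le> 3 / 4" unfolding xs using y34 s100[OF s(1)] by (simp add: pos_divide_le_eq)
    have "y s * (96 / 100) \<le> y s * (1 - 2 * X K s)" using P[OF s(1)] y0 by (intro mult_left_mono) auto
    then have Y: "Y \<le> - (71 / 100) * y s" using s(3) unfolding Y_def by linarith
    then have "G \<le> (1 / 4) * Y" unfolding G_def using x34 y0 by (intro mult_right_mono_neg) auto
    moreover have "x s \<le> y s / 100" unfolding xs using s100[OF s(1)] y0 by (intro divide_left_mono) auto
    moreover have "3 * y' s = G + 2 * x s" using y'[OF s(1)] unfolding G_def Y_def .
    ultimately show "y' s \<le> - (1 / 20) * (y s - 0)" using Y y0 by simp
  qed (use at k1 der in auto)
  moreover have "exp (- (1 / 20) * (t - a)) * (y a - 0) \<le> 4 * k"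
  proof -
    have "y a \<le> a * (3 / 4)" unfolding y_def using up s100[of a] by (intro mult_left_mono) auto
    then have "y a \<le> c0 * k" using a(2) s100(1)[of a] unfolding k_def[symmetric] by linarith
    then have "exp (- (1 / 20) * (t - a)) * (y a - 0) \<le> exp (- (1 / 20) * (t - a)) * (c0 * k)"
      by (intro mult_left_mono) auto
    also have "\<dots> \<le> exp (- (1 / 40) * c0) * (c0 * k)" using t c0 k1 by (intro mult_right_mono) auto
    also have "\<dots> \<le> 4 * k" using mult_right_mono[OF e1, of k] k1 by (simp add: mult_ac)
    finally show ?thesis .
  qed
  ultimately have U: "y t \<le> 4 * k" by (rule le_max_elim) simp
  \<comment> \<open>The lower bound is an upper bound for - y with target - k. Negative y must be
    allowed, as the sign at the entry time is unknown.\<close>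
  have "- y t \<le> max (- (k / 2)) (- k + exp (- (3 / 10) * (t - a)) * (- y a - (- k)))"
  proof (rule band_decay[where u = "\<lambda>s. - y s" and u' = "\<lambda>s. - y' s" and M = "max 0 (- y a)"])
    show "((\<lambda>s. - y s) has_real_derivative - y' s) (at s)" if "a \<le> s" for s
      by (rule DERIV_minus, rule der[OF that])
    fix s assume s: "a \<le> s" "s \<le> t" "- (k / 2) < - y s"
    have xs: "x s = y s / s" unfolding x_def y_def using s100[OF s(1)] by simp
    define Y where "Y = k - y s * (1 - 2 * X K s)"
    have e: "3 * y' s = (1 - x s) * Y + 2 * x s" using y'[OF s(1)] unfolding Y_def .
    have "(9 / 10) * (k - y s) \<le> 3 * y' s"
    proof (cases "0 \<le> y s")
      case True
      have "y s * (1 - 2 * X K s) \<le> y s * 1" using P[OF s(1)] True by (intro mult_left_mono) auto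
      then have Y: "k - y s \<le> Y" unfolding Y_def by simp
      have "y s \<le> 1 / 10 * s" using s(3) s100(2)[OF s(1)] k1 by linarith
      then have "x s \<le> 1 / 10" "0 \<le> x s" unfolding xs using s100[OF s(1)] True by (auto simp: pos_divide_le_eq)
      moreover have "(9 / 10) * (k - y s) \<le> (1 - x s) * Y"
        using \<open>x s \<le> 1 / 10\<close> Y s(3) k1 by (intro mult_mono) auto
      ultimately show ?thesis using e by linarith
    next
      case False
      have "y s * (1 - 2 * X K s) \<le> y s * (96 / 100)" using P[OF s(1)] False by (intro mult_left_mono_neg) auto
      then have Y: "k - (96 / 100) * y s \<le> Y" unfolding Y_def by simp
      have "y s / 100 \<le> x s" unfolding xs using s100[OF s(1)] False by (intro divide_left_mono_neg) auto
      moreover have "x s \<le> 0" unfolding xs using s100[OF s(1)] False by (intro divide_nonpos_pos) auto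
      ultimately have x: "x s \<le> 0" "y s / 100 \<le> x s" by simp_all
      have "1 * Y \<le> (1 - x s) * Y" using x Y False k1 by (intro mult_right_mono) auto
      then show ?thesis using e Y x False k1 by argo
    qed
    then show "- y' s \<le> - (3 / 10) * (- y s - (- k))" by simp
  qed (use at k1 in auto)
  moreover have "exp (- (3 / 10) * (t - a)) * (- y a - (- k)) \<le> k / 2"
  proof -
    have "- y a \<le> A * (c0 * k)"
    proof -
      have "a * - A \<le> y a" unfolding y_def using lo s100[of a] by (intro mult_left_mono) auto
      moreover have "A * a \<le> A * (c0 * k)" using a(2) A unfolding k_def by (intro mult_left_mono) auto
      ultimately show ?thesis by (simp add: mult.commute)
    qed
    then have "exp (- (3 / 10) * (t - a)) * (- y a - (- k)) \<le> exp (- (3 / 10) * (t - a)) * (k * (1 + A * c0))"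
      by (intro mult_left_mono) (auto simp: algebra_simps)
    also have "\<dots> \<le> exp (- (3 / 20) * c0) * (k * (1 + A * c0))"
      using t c0 k1 A by (intro mult_right_mono) auto
    also have "\<dots> \<le> k / 2" using mult_left_mono[OF e2, of k] k1 by (simp add: mult_ac)
    finally show ?thesis .
  qed
  ultimately have "- y t \<le> - (k / 2)" by (rule le_max_elim) simp
  then show ?thesis using U unfolding y_def k_def by simp
qed

text \<open>The value 1 repels: strictness at the single time 200 fixes a gap 1 - M, and the drift
  (1 - X1) (1 / T - X1) then has a definite rate while X1 exceeds 3 / 4.\<close>

lemma X1_upper: "\<exists>T1\<ge>200. \<forall>t\<ge>T1. X1 t \<le> 3 / 4"
proof -
  define M where "M = max (X1 200) (7 / 8)"
  have M: "M < 1" using X1_less_1[of 200] unfolding M_def by simp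
  define r where "r = (1 - M) / 3"
  have r: "r > 0" using M unfolding r_def by simp
  \<comment> \<open>The time ln 2 / r halves an excess over 1 / 4 that is below 1, and 1 / 4 + 1 / 2
    = 3 / 4.\<close>
  define T1 where "T1 = 200 + ln 2 / r"
  show ?thesis
  proof (intro exI conjI allI impI)
    show "T1 \<ge> 200" unfolding T1_def using r by simp
    fix t assume t: "t \<ge> T1"
    have t200: "200 \<le> t" using t \<open>T1 \<ge> 200\<close> by simp
    have "X1 t \<le> max (3 / 4) (1 / 4 + exp (- r * (t - 200)) * (X1 200 - 1 / 4))"
    proof (rule band_decay[where u' = "\<lambda>T. ((1 - X1 T) * (1 / T - X1 T) - X1 T / T) / 3" and M = M])
      fix s assume s: "200 \<le> s" "s \<le> t" "3 / 4 < X1 s" "X1 s \<le> M"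
      have "1 / s \<le> 1 / 4" using s(1) by (simp add: field_simps)
      then have "1 / s - X1 s \<le> 1 / 4 - X1 s" by simp
      then have "(1 - X1 s) * (1 / s - X1 s) \<le> (1 - X1 s) * (1 / 4 - X1 s)"
        using s M by (intro mult_left_mono) auto
      also have "\<dots> \<le> (1 - M) * (1 / 4 - X1 s)" using s by (intro mult_right_mono_neg) auto
      also have "\<dots> = 3 * (- r * (X1 s - 1 / 4))" unfolding r_def by (simp add: field_simps)
      finally have "(1 - X1 s) * (1 / s - X1 s) \<le> 3 * (- r * (X1 s - 1 / 4))" .
      moreover have "X1 s / s \<ge> 0" using s by simp
      moreover have "(p - w) / 3 \<le> q" if "p \<le> 3 * q" "0 \<le> w" for p q w :: real using that by simp
      ultimately show "((1 - X1 s) * (1 / s - X1 s) - X1 s / s) / 3 \<le> - r * (X1 s - 1 / 4)" by blast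
    qed (use t200 r riccati in \<open>auto simp: M_def\<close>)
    moreover have "exp (- r * (t - 200)) * (X1 200 - 1 / 4) \<le> 1 / 2"
    proof -
      have "ln 2 \<le> r * (t - 200)" using t r unfolding T1_def by (simp add: field_simps)
      then have "exp (- r * (t - 200)) \<le> exp (- ln 2)" by simp
      also have "\<dots> = 1 / 2" by (simp add: exp_minus)
      finally have e: "exp (- r * (t - 200)) \<le> 1 / 2" .
      have "exp (- r * (t - 200)) * (X1 200 - 1 / 4) \<le> exp (- r * (t - 200)) * 1"
        using X1_less_1[of 200] by (intro mult_left_mono) auto
      also have "\<dots> \<le> 1 / 2" using e by simp
      finally show ?thesis .
    qed
    ultimately show "X1 t \<le> 3 / 4" by (rule le_max_elim) simp
  qed
qed

text \<open>Induction on the index: the bounds at index n, evaluated at its own threshold c0 n,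
  confine \<open>X (n + 1)\<close> there through the recurrence, and \<open>entry_bounds\<close>
  uses the time up to c0 (n + 1) to improve this to the claim.\<close>

lemma crude_bounds: "\<exists>c0\<ge>200. \<forall>j\<ge>1. \<forall>t\<ge>c0 * real j. real j / 2 \<le> t * X j t \<and> t * X j t \<le> 4 * real j"
proof -
  obtain T1 where T1: "T1 \<ge> 200" "\<And>t. t \<ge> T1 \<Longrightarrow> X1 t \<le> 3 / 4" using X1_upper by blast
  \<comment> \<open>The entry 2 covers every induction step, the other one the start at T1. The
    later choice c0 \<ge> 2 T1 ensures T1 + c0 / 2 \<le> c0.\<close>
  define A where "A = max 2 (- X1 T1)"
  have A: "2 \<le> A" "- A \<le> X1 T1" unfolding A_def by auto
  have "\<forall>\<^sub>F c in at_top. exp (- (1 / 40) * c) * c \<le> (4::real)" by real_asymp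
  moreover have "\<forall>\<^sub>F c in at_top. exp (- (3 / 20) * c) * (1 + A * c) \<le> (1 / 2::real)"
    using A(1) by real_asymp
  moreover have "\<forall>\<^sub>F c in at_top. (c::real) \<ge> 2 * T1" by (rule eventually_ge_at_top)
  ultimately have "\<forall>\<^sub>F c in at_top. exp (- (1 / 40) * c) * c \<le> 4 \<and> exp (- (3 / 20) * c) * (1 + A * c) \<le> 1 / 2 \<and> c \<ge> 2 * T1"
    by eventually_elim auto
  then obtain c0 where c0: "exp (- (1 / 40) * c0) * c0 \<le> 4" "exp (- (3 / 20) * c0) * (1 + A * c0) \<le> 1 / 2" "c0 \<ge> 2 * T1"
    by (auto simp: eventually_at_top_linorder)
  have c200: "c0 \<ge> 200" using c0 T1 by simp
  have all: "\<forall>j. 1 \<le> j \<longrightarrow> j \<le> Suc K \<longrightarrow> (\<forall>t\<ge>c0 * real j. real j / 2 \<le> t * X j t \<and> t * X j t \<le> 4 * real j)" for K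
  proof (induction K)
    case 0
    have "\<forall>t\<ge>c0 * real (Suc 0). real (Suc 0) / 2 \<le> t * X (Suc 0) t \<and> t * X (Suc 0) t \<le> 4 * real (Suc 0)"
    proof (intro allI impI)
      fix t assume "t \<ge> c0 * real (Suc 0)"
      then show "real (Suc 0) / 2 \<le> t * X (Suc 0) t \<and> t * X (Suc 0) t \<le> 4 * real (Suc 0)"
        using c200 T1(1) T1(2)[of T1] A c0
        by (intro entry_bounds[OF _ _ _ _ _ _ _ _ _ c0(1,2), where a = T1]) auto
    qed
    then show ?case by (auto simp: le_Suc_eq)
  next
    case (Suc K)
    define n where "n = Suc K"
    have IH: "real j / 2 \<le> t * X j t" "t * X j t \<le> 4 * real j" if "1 \<le> j" "j \<le> n" "t \<ge> c0 * real j" for j t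
      using Suc that unfolding n_def by auto
    define a where "a = c0 * real n"
    have n1: "real n \<ge> 1" unfolding n_def by simp
    have ge: "t \<ge> c0 * real j" if "t \<ge> a" "j \<le> n" for t j
      using that c200 unfolding a_def by (smt (verit) mult_left_mono of_nat_mono)
    have apos: "a > 0" using c200 n1 unfolding a_def by simp
    have pos: "X j t > 0" if "t \<ge> a" "1 \<le> j" "j \<le> n" for t j
      using IH(1)[OF that(2,3) ge[OF that(1,3)]] that apos by (smt (verit) zero_less_mult_pos of_nat_1 of_nat_mono divide_pos_pos)
    have up: "X j t \<le> 4 * (real j / t)" if "t \<ge> a" "1 \<le> j" "j \<le> n" for t j
      using IH(2)[OF that(2,3) ge[OF that(1,3)]] that apos by (simp add: field_simps)
    have jt: "real j / t \<le> 1 / c0" if "t \<ge> a" "j \<le> n" for t j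
      using ge[OF that] c200 apos that by (simp add: field_simps)
    have c0i: "1 / c0 \<le> 1 / 200" using c200 by (simp add: field_simps)
    have P: "0 \<le> X j t \<and> X j t \<le> 1 / 50" if "t \<ge> a" "j \<le> n" for j t
    proof (cases "j = 0")
      case False
      then show ?thesis using pos[of t j] up[of t j] jt[of t j] that c0i by auto
    qed simp
    \<comment> \<open>The two-sided bound on t * \<open>X n\<close> is what makes this quotient
      bounded: below by 1 / 4, giving \<open>X (Suc n) a\<close> \<le> 3 / 4, and above by
      2.\<close>
    have q: "1 / 4 \<le> (real n / a) / X n a" "(real n / a) / X n a \<le> 2"
    proof -
      have "X n a > 0" "X n a \<le> 4 * (real n / a)" using pos[of a n] up[of a n] n1 by auto
      then show "1 / 4 \<le> (real n / a) / X n a" using apos by (simp add: field_simps)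
      have "real n / 2 \<le> a * X n a" using IH(1)[of n a] n1 a_def by auto
      then have "real n / a \<le> 2 * X n a" using apos by (simp add: field_simps)
      then show "(real n / a) / X n a \<le> 2" using \<open>X n a > 0\<close> by (rule pos_divide_le_eq[THEN iffD2, rotated])
    qed
    have rec: "X (Suc n) a = 1 - (real n / a) / X n a - X K a" unfolding n_def by simp
    have "\<forall>t\<ge>c0 * real (Suc n). real (Suc n) / 2 \<le> t * X (Suc n) t \<and> t * X (Suc n) t \<le> 4 * real (Suc n)"
    proof (intro allI impI)
      fix t assume t: "t \<ge> c0 * real (Suc n)"
      show "real (Suc n) / 2 \<le> t * X (Suc n) t \<and> t * X (Suc n) t \<le> 4 * real (Suc n)"
      proof (rule entry_bounds[OF _ _ _ _ _ _ _ _ _ c0(1,2), where a = a])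
        have "200 * real n \<le> a" using c200 unfolding a_def by (intro mult_right_mono) auto
        then show "100 * real (Suc n) \<le> a" using n1 by simp
        show "a \<le> c0 * real (Suc n)" using c200 unfolding a_def by simp
        show "a + c0 / 2 \<le> t" using t c200 unfolding a_def by (simp add: algebra_simps)
        show "X (Suc n) a \<le> 3 / 4" "- A \<le> X (Suc n) a"
          unfolding rec using q P[of a K] A(1) by (auto simp: n_def)
        show "\<And>t j. t \<ge> a \<Longrightarrow> 1 \<le> j \<Longrightarrow> j \<le> n \<Longrightarrow> X j t \<noteq> 0" using pos by force
        show "\<And>t. t \<ge> a \<Longrightarrow> 0 \<le> X n t \<and> X n t \<le> 1 / 50" using P by auto
      qed (use c200 t A in auto)
    qed
    then show ?case using Suc unfolding n_def by (auto simp: le_Suc_eq)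
  qed
  show ?thesis
  proof (intro exI conjI allI impI)
    show "c0 \<ge> 200" by (rule c200)
    fix j :: nat and t assume "1 \<le> j" "c0 * real j \<le> t"
    then show "real j / 2 \<le> t * X j t" "t * X j t \<le> 4 * real j" using all[of j] by auto
  qed
qed

end

section \<open>Deviation from the quasi-equilibrium\<close>

text \<open>The smaller root of x (1 - 2 x) = \<kappa>. It merges with the larger one at 1 / 4 for
  \<kappa> = 1 / 8, hence the factors 1 / (1 - 4 * fstar) in all error bounds.\<close>

definition fstar :: "real \<Rightarrow> real" where "fstar \<kappa> = (1 - sqrt (1 - 8 * \<kappa>)) / 4"

lemma fstar_0 [simp]: "fstar 0 = 0" by (simp add: fstar_def)

lemma fstar_eq: "\<kappa> \<le> 1 / 8 \<Longrightarrow> \<kappa> = fstar \<kappa> * (1 - 2 * fstar \<kappa>)"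
  unfolding fstar_def by (simp add: field_simps)

lemma fstar_mono: "\<kappa> \<le> \<kappa>' \<Longrightarrow> fstar \<kappa> \<le> fstar \<kappa>'"
  unfolding fstar_def by simp

lemma fstar_less: "\<kappa> < 1 / 8 \<Longrightarrow> fstar \<kappa> < 1 / 4"
  unfolding fstar_def by simp

lemma fstar_le: "\<kappa> \<le> 1 / 8 \<Longrightarrow> fstar \<kappa> \<le> 1 / 4"
  unfolding fstar_def by simp

lemma fstar_nonneg: "0 \<le> \<kappa> \<Longrightarrow> 0 \<le> fstar \<kappa>"
  using fstar_mono[of 0 \<kappa>] by simp

lemma fstar_bounds:
  assumes "0 \<le> \<kappa>" "\<kappa> \<le> 1 / 8"
  shows "\<kappa> \<le> fstar \<kappa>" "fstar \<kappa> \<le> 2 * \<kappa>"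
proof -
  define g where "g = fstar \<kappa>"
  have g: "0 \<le> g" "g \<le> 1 / 4" and k: "\<kappa> = g * (1 - 2 * g)"
    using fstar_nonneg fstar_le fstar_eq assms unfolding g_def by auto
  have "g * (1 - 2 * g) \<le> g * 1" "g * (1 / 2) \<le> g * (1 - 2 * g)"
    using g by (intro mult_left_mono; simp)+
  then have "\<kappa> \<le> g" "g \<le> 2 * \<kappa>" using k by linarith+
  then show "\<kappa> \<le> fstar \<kappa>" "fstar \<kappa> \<le> 2 * \<kappa>" unfolding g_def .
qed

lemma fstar_lipschitz:
  assumes "0 \<le> \<kappa>" "\<kappa> \<le> \<kappa>'" "\<kappa>' \<le> \<mu>" "\<mu> < 1 / 8"
  shows "fstar \<kappa>' - fstar \<kappa> \<le> (\<kappa>' - \<kappa>) / (1 - 4 * fstar \<mu>)"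
proof -
  define a b c where "a = fstar \<kappa>" and "b = fstar \<kappa>'" and "c = fstar \<mu>"
  have ab: "a \<le> b" "b \<le> c" "c < 1 / 4"
    unfolding a_def b_def c_def using fstar_mono fstar_less assms by auto
  have "\<kappa>' - \<kappa> = b * (1 - 2 * b) - a * (1 - 2 * a)"
    using fstar_eq[of \<kappa>] fstar_eq[of \<kappa>'] assms unfolding a_def b_def by simp
  also have "\<dots> = (b - a) * (1 - 2 * (a + b))" by (simp add: algebra_simps)
  also have "\<dots> \<ge> (b - a) * (1 - 4 * c)" using ab by (intro mult_left_mono) auto
  finally show ?thesis using ab unfolding a_def b_def c_def by (simp add: pos_le_divide_eq)
qed

lemma fstar_deriv:
  assumes "\<kappa> < 1 / 8" shows "(fstar has_real_derivative 1 / (1 - 4 * fstar \<kappa>)) (at \<kappa>)"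
proof -
  have "((\<lambda>\<kappa>. (1 - sqrt (1 - 8 * \<kappa>)) / 4) has_real_derivative 1 / (1 - 4 * fstar \<kappa>)) (at \<kappa>)"
    using assms by (auto intro!: derivative_eq_intros simp: fstar_def field_simps)
  then show ?thesis unfolding fstar_def[abs_def] .
qed

context dPI_flow begin

section \<open>Linearisation about the moving equilibrium\<close>

definition E :: "nat \<Rightarrow> real \<Rightarrow> real" where "E k T = X k T - fstar (real k / T)"

definition dE :: "nat \<Rightarrow> real \<Rightarrow> real" where
  "dE k T = V k T + (real (Suc k) / T\<^sup>2) / (1 - 4 * fstar (real (Suc k) / T))"

lemma E_0 [simp]: "E 0 T = 0" by (simp add: E_def)

lemma ratio_le: "c > 0 \<Longrightarrow> c * real k \<le> T \<Longrightarrow> T > 0 \<Longrightarrow> real k / T \<le> 1 / c"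
  by (simp add: field_simps)

lemma E_deriv:
  assumes T: "T > 0" "T > 8 * real (Suc k)" "\<And>j. 1 \<le> j \<Longrightarrow> j \<le> k \<Longrightarrow> X j T \<noteq> 0"
  shows "(E (Suc k) has_real_derivative dE k T) (at T)"
proof -
  have "real (Suc k) / T < 1 / 8" using T by (simp add: field_simps)
  then have "((\<lambda>T. fstar (real (Suc k) / T)) has_real_derivative
      1 / (1 - 4 * fstar (real (Suc k) / T)) * (- real (Suc k) / T\<^sup>2)) (at T)"
    using T(1) by (intro DERIV_chain2[OF fstar_deriv]) (auto intro!: derivative_eq_intros simp: power2_eq_square)
  from DERIV_diff[OF X_deriv[OF T(1), of k] this] show ?thesis
    using T unfolding E_def[abs_def] dE_def by (simp add: mult.commute del: of_nat_Suc)
qed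

text \<open>With \<kappa> = F (1 - 2 F) the drift splits exactly into relaxation of
  \<open>E (Suc k)\<close> and driving by \<open>E k\<close>. The rest is O(1 / T): the shift of the
  equilibrium between neighbouring indices costs at most 2 units of 1 / (\<delta> T), the term x / T
  one, and the motion of the equilibrium in time 3 / 8.\<close>

lemma dE_estimate:
  assumes c: "c > 8" and T: "T \<ge> c * real (Suc k)" and x: "0 \<le> X (Suc k) T" "X (Suc k) T \<le> 1"
  shows "\<bar>3 * dE k T - (1 - X (Suc k) T) * (- (1 - 2 * fstar (real (Suc k) / T)) * E (Suc k) T
            + 2 * X (Suc k) T * E k T)\<bar> \<le> 4 / (1 - 4 * fstar (1 / c)) / T"
proof -
  have "c * real (Suc k) > 0" using c by simp
  then have T0: "T > 0" using T by simp
  define x F F' i \<delta> where "x = X (Suc k) T" and "F = fstar (real (Suc k) / T)" and "F' = fstar (real k / T)"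
    and "i = 1 / T" and "\<delta> = 1 - 4 * fstar (1 / c)"
  have c8: "1 / c < 1 / 8" using c by (simp add: field_simps)
  have \<delta>: "\<delta> > 0" "\<delta> \<le> 1" unfolding \<delta>_def using fstar_less[OF c8] fstar_nonneg[of "1/c"] c by auto
  have r: "real (Suc k) / T \<le> 1 / c" using ratio_le[OF _ T T0] c by simp
  have r0: "real k / T \<le> real (Suc k) / T" using T0 by (simp add: divide_right_mono)
  have k: "real (Suc k) / T = F * (1 - 2 * F)" unfolding F_def using r c8 by (intro fstar_eq) linarith
  have FF: "0 \<le> F - F'" "F - F' \<le> i / \<delta>"
  proof -
    show "0 \<le> F - F'" unfolding F_def F'_def using fstar_mono[OF r0] by simp
    have "real (Suc k) / T - real k / T = i" unfolding i_def using T0 by (simp add: field_simps)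
    then show "F - F' \<le> i / \<delta>" using fstar_lipschitz[OF _ r0 r c8] T0 unfolding F_def F'_def \<delta>_def by simp
  qed
  have i0: "i > 0" unfolding i_def using T0 by simp
  have F1: "\<delta> \<le> 1 - 4 * F" unfolding \<delta>_def F_def using fstar_mono[OF r] by simp
  have xx: "0 \<le> x" "x \<le> 1" using x unfolding x_def by auto
  define G where "G = (real (Suc k) / T\<^sup>2) / (1 - 4 * F)"
  have "3 * dE k T = (1 - x) * (F * (1 - 2 * F) - x * (1 - 2 * X k T)) - x * i + 3 * G"
    unfolding dE_def V_def G_def x_def F_def[symmetric] unfolding k i_def by simp
  moreover have "F * (1 - 2 * F) - x * (1 - 2 * X k T)
      = (- (1 - 2 * F) * (x - F) + 2 * x * (X k T - F')) - 2 * x * (F - F')"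
    by (simp add: algebra_simps)
  ultimately have "3 * dE k T - (1 - x) * (- (1 - 2 * F) * (x - F) + 2 * x * (X k T - F'))
      = - ((1 - x) * (2 * x * (F - F'))) - x * i + 3 * G"
    by (simp add: algebra_simps)
  moreover have "\<bar>- ((1 - x) * (2 * x * (F - F'))) - x * i + 3 * G\<bar> \<le> 4 / \<delta> * i"
  proof -
    have aux: "\<bar>- A - B + 3 * G'\<bar> \<le> 4 * J"
      if "A \<le> 2 * J" "0 \<le> A" "0 \<le> B" "B \<le> i" "i \<le> J" "0 \<le> G'" "G' \<le> J / 8" for A B G' J
      using that by linarith
    have "(1 - x) * (2 * x * (F - F')) \<le> 1 * (2 * 1 * (i / \<delta>))"
      using xx FF by (intro mult_mono) auto
    moreover have "0 \<le> (1 - x) * (2 * x * (F - F'))" "0 \<le> x * i" using xx FF i0 by auto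
    moreover have "x * i \<le> 1 * i" using xx i0 by (intro mult_right_mono) auto
    moreover have "i \<le> i / \<delta>" using \<delta> i0 by (simp add: pos_le_divide_eq)
    moreover have "0 \<le> G" unfolding G_def using F1 \<delta> by simp
    moreover have "G \<le> i / \<delta> / 8"
    proof -
      have "real (Suc k) / T\<^sup>2 = (real (Suc k) / T) * i" unfolding i_def by (simp add: power2_eq_square)
      also have "\<dots> \<le> (1 / 8) * i" using i0 by (intro mult_right_mono order_trans[OF r]) (use c8 in linarith)+
      finally have "G \<le> ((1 / 8) * i) / \<delta>" unfolding G_def using F1 \<delta> i0 by (intro frac_le) auto
      then show ?thesis by simp
    qed
    ultimately have "\<bar>- ((1 - x) * (2 * x * (F - F'))) - x * i + 3 * G\<bar> \<le> 4 * (i / \<delta>)"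
      by (intro aux) auto
    then show ?thesis by simp
  qed
  ultimately show ?thesis unfolding E_def x_def F_def F'_def i_def \<delta>_def by simp
qed

text \<open>Subtracting the equilibria from the recurrence leaves an exact linear relation whose
  right side is a second difference of \<open>fstar\<close>. When X and fstar both equal f, the
  homogeneous part has characteristic roots l and 1 / l with l + 1 / l = (1 - 2 f) / f.\<close>

lemma E_rec:
  assumes c: "c > 8" and T: "T \<ge> c * real (Suc (Suc k))" and x: "X (Suc k) T > 0"
  shows "\<bar>E (Suc (Suc k)) T + E k T - (1 - 2 * fstar (real (Suc k) / T)) / X (Suc k) T * E (Suc k) T\<bar>
      \<le> 2 / (1 - 4 * fstar (1 / c)) / T"
proof -
  have "c * real (Suc (Suc k)) > 0" using c by simp
  then have T0: "T > 0" using T by simp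
  define x F F' F'' i \<delta> where "x = X (Suc k) T" and "F = fstar (real (Suc k) / T)" and "F' = fstar (real k / T)"
    and "F'' = fstar (real (Suc (Suc k)) / T)" and "i = 1 / T" and "\<delta> = 1 - 4 * fstar (1 / c)"
  have c8: "1 / c < 1 / 8" using c by (simp add: field_simps)
  have r: "real (Suc (Suc k)) / T \<le> 1 / c" using ratio_le[OF _ T T0] c by simp
  have r0: "real k / T \<le> real (Suc k) / T" "real (Suc k) / T \<le> real (Suc (Suc k)) / T"
    using T0 by (auto intro: divide_right_mono)
  have k: "real (Suc k) / T = F * (1 - 2 * F)" unfolding F_def using r r0 c8 by (intro fstar_eq) linarith
  have FF: "0 \<le> F - F'" "F - F' \<le> i / \<delta>" "0 \<le> F'' - F" "F'' - F \<le> i / \<delta>"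
  proof -
    show "0 \<le> F - F'" "0 \<le> F'' - F" unfolding F_def F'_def F''_def using fstar_mono r0 by auto
    have "real (Suc k) / T - real k / T = i" "real (Suc (Suc k)) / T - real (Suc k) / T = i"
      unfolding i_def using T0 by (auto simp: field_simps)
    then show "F - F' \<le> i / \<delta>" "F'' - F \<le> i / \<delta>"
      using fstar_lipschitz[OF _ r0(1) order_trans[OF r0(2) r] c8] fstar_lipschitz[OF _ r0(2) r c8] T0
      unfolding F_def F'_def F''_def \<delta>_def by auto
  qed
  have "X (Suc (Suc k)) T + X k T = 1 - F * (1 - 2 * F) / x" using k unfolding x_def by simp
  also have "\<dots> = 2 * F + (1 - 2 * F) / x * (x - F)" using x unfolding x_def by (simp add: field_simps)
  finally have "(X (Suc (Suc k)) T - F'') + (X k T - F') - (1 - 2 * F) / x * (x - F) = (F - F') - (F'' - F)"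
    by simp
  moreover have "\<bar>(F - F') - (F'' - F)\<bar> \<le> 2 / \<delta> * i" using FF by (simp add: abs_le_iff)
  ultimately show ?thesis unfolding E_def x_def F_def F'_def F''_def i_def \<delta>_def by simp
qed

text \<open>Positivity is carried along because the derivative of an entry is available only where
  all earlier entries are nonzero.\<close>

definition tracking :: "real \<Rightarrow> nat \<Rightarrow> real \<Rightarrow> bool" where
  "tracking \<eta> k T \<longleftrightarrow> (\<forall>j. 1 \<le> j \<longrightarrow> j \<le> k \<longrightarrow> 0 < X j T \<and> \<bar>E j T\<bar> \<le> \<eta>)"

text \<open>Only large k are constrained, but then all j \<le> k. Thus T is large whenever the
  property is invoked, and the O(1 / T) errors are below any fixed tolerance.\<close>

definition eventually_tracking :: "real \<Rightarrow> real \<Rightarrow> bool" where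
  "eventually_tracking \<eta> c \<longleftrightarrow> (\<exists>K. \<forall>k\<ge>K. \<forall>T\<ge>c * real k. tracking \<eta> k T)"

end

lemma mult_le_abs: "\<bar>p\<bar> \<le> r \<Longrightarrow> e * p \<le> \<bar>e\<bar> * (r::real)"
  using order_trans[OF abs_ge_self[of "e * p"]] mult_left_mono[of "\<bar>p\<bar>" r "\<bar>e\<bar>"] by (simp add: abs_mult)

context dPI_flow begin

section \<open>Relaxation inside a window of deviations\<close>

lemma tracking_mono: "tracking \<eta> k T \<Longrightarrow> \<eta> \<le> \<eta>' \<Longrightarrow> k' \<le> k \<Longrightarrow> tracking \<eta>' k' T"
  unfolding tracking_def by (blast intro: order_trans)

lemma eventually_tracking_mono:
  assumes "eventually_tracking \<eta> c" "\<eta> \<le> \<eta>'" "c \<le> c'" shows "eventually_tracking \<eta>' c'"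
proof -
  obtain K where K: "\<And>k T. k \<ge> K \<Longrightarrow> T \<ge> c * real k \<Longrightarrow> tracking \<eta> k T"
    using assms(1) unfolding eventually_tracking_def by blast
  show ?thesis unfolding eventually_tracking_def
  proof (intro exI allI impI)
    fix k T assume "K \<le> k" "c' * real k \<le> T"
    moreover have "c * real k \<le> c' * real k" using assms(3) by (intro mult_right_mono) auto
    ultimately show "tracking \<eta>' k T" using tracking_mono[OF K[of k T] assms(2)] by auto
  qed
qed

lemma trackingD: "tracking \<eta> k T \<Longrightarrow> j \<le> k \<Longrightarrow> 0 \<le> \<eta> \<Longrightarrow> \<bar>E j T\<bar> \<le> \<eta>"
  unfolding tracking_def by (cases "j = 0") auto

lemma tracking_pos: "tracking \<eta> k T \<Longrightarrow> 1 \<le> j \<Longrightarrow> j \<le> k \<Longrightarrow> 0 < X j T"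
  unfolding tracking_def by auto

text \<open>Working with the square of E treats both signs at once; the rate doubles
  accordingly.\<close>

lemma E_decay:
  assumes c: "8 < c" and a: "c * real (Suc k) \<le> a" "a \<le> b"
    and nz: "\<And>t j. a \<le> t \<Longrightarrow> 1 \<le> j \<Longrightarrow> j \<le> k \<Longrightarrow> X j t \<noteq> 0"
    and m: "0 \<le> m" "m < M" and Ea: "\<bar>E (Suc k) a\<bar> \<le> M" and r: "0 < r"
    and dec: "\<And>t. a \<le> t \<Longrightarrow> t \<le> b \<Longrightarrow> m < \<bar>E (Suc k) t\<bar> \<Longrightarrow> \<bar>E (Suc k) t\<bar> \<le> M \<Longrightarrow>
      E (Suc k) t * dE k t \<le> - r * (E (Suc k) t)\<^sup>2"
    and fin: "exp (- r * (b - a)) * \<bar>E (Suc k) a\<bar> \<le> m"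
  shows "\<bar>E (Suc k) b\<bar> \<le> m"
proof -
  have "(E (Suc k) b)\<^sup>2 \<le> max (m\<^sup>2) (0 + exp (- (2 * r) * (b - a)) * ((E (Suc k) a)\<^sup>2 - 0))"
  proof (rule band_decay[where u' = "\<lambda>t. 2 * (E (Suc k) t * dE k t)" and M = "M\<^sup>2"])
    show "((\<lambda>t. (E (Suc k) t)\<^sup>2) has_real_derivative 2 * (E (Suc k) t * dE k t)) (at t)" if "a \<le> t" for t
    proof -
      have "8 * real (Suc k) < c * real (Suc k)" using c by (intro mult_strict_right_mono) auto
      then have "8 * real (Suc k) < t" using that a by simp
      then have "0 < t" "8 * real (Suc k) < t" by auto
      then have d: "(E (Suc k) has_real_derivative dE k t) (at t)" using nz[OF that] by (intro E_deriv) auto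
      from DERIV_mult[OF d d] show ?thesis unfolding power2_eq_square by (simp add: algebra_simps)
    qed
    show "(E (Suc k) a)\<^sup>2 \<le> M\<^sup>2" using power_mono[OF Ea abs_ge_zero, of 2] by simp
    show "m\<^sup>2 < M\<^sup>2" using m by (intro power_strict_mono) auto
    fix t assume t: "a \<le> t" "t \<le> b" "m\<^sup>2 < (E (Suc k) t)\<^sup>2" "(E (Suc k) t)\<^sup>2 \<le> M\<^sup>2"
    have "m < \<bar>E (Suc k) t\<bar>" by (rule power2_less_imp_less) (use t(3) in simp_all)
    moreover have "\<bar>E (Suc k) t\<bar> \<le> M" by (rule power2_le_imp_le) (use t(4) m in simp_all)
    ultimately have "E (Suc k) t * dE k t \<le> - r * (E (Suc k) t)\<^sup>2" by (rule dec[OF t(1,2)])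
    moreover have "2 * y \<le> - (2 * r) * (z - 0)" if "y \<le> - r * z" for y z using that by argo
    ultimately show "2 * (E (Suc k) t * dE k t) \<le> - (2 * r) * ((E (Suc k) t)\<^sup>2 - 0)" by blast
  qed (use a r in simp_all)
  moreover have "exp (- (2 * r) * (b - a)) * ((E (Suc k) a)\<^sup>2 - 0) \<le> m\<^sup>2"
  proof -
    have "exp (- (2 * r) * (b - a)) = (exp (- r * (b - a)))\<^sup>2"
      using exp_double[of "- r * (b - a)"] by (simp only: mult_ac minus_mult_left[symmetric] minus_mult_right[symmetric])
    then have "exp (- (2 * r) * (b - a)) * ((E (Suc k) a)\<^sup>2 - 0) = (exp (- r * (b - a)) * \<bar>E (Suc k) a\<bar>)\<^sup>2"
      by (simp add: power_mult_distrib)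
    then show ?thesis using power_mono[OF fin, of 2] by simp
  qed
  ultimately have "\<bar>E (Suc k) b\<bar>\<^sup>2 \<le> m\<^sup>2" by simp
  then show ?thesis using m(1) by (rule power2_le_imp_le)
qed

lemma E_dE_le:
  assumes c: "c > 8" and T: "T \<ge> c * real (Suc k)" and x: "0 \<le> X (Suc k) T" "X (Suc k) T \<le> 1"
  shows "3 * (E (Suc k) T * dE k T) \<le> (1 - X (Suc k) T) * (- (1 - 2 * fstar (real (Suc k) / T)) * (E (Suc k) T)\<^sup>2
            + 2 * X (Suc k) T * (E (Suc k) T * E k T)) + \<bar>E (Suc k) T\<bar> * (4 / (1 - 4 * fstar (1 / c)) / T)"
proof -
  note mult_le_abs[OF dE_estimate[OF assms], of "E (Suc k) T"]
  moreover have "E (Suc k) T * (3 * dE k T - (1 - X (Suc k) T) * (- (1 - 2 * fstar (real (Suc k) / T)) * E (Suc k) T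
            + 2 * X (Suc k) T * E k T)) = 3 * (E (Suc k) T * dE k T) - (1 - X (Suc k) T) * (- (1 - 2 * fstar (real (Suc k) / T)) * (E (Suc k) T)\<^sup>2
            + 2 * X (Suc k) T * (E (Suc k) T * E k T))"
    by (simp add: algebra_simps power2_eq_square)
  ultimately show ?thesis by linarith
qed

text \<open>The margin s is relaxation 1 - 2 \<phi> minus driving 2 q p. Since x \<le> q \<le> 1 /
  4, the prefactor 1 - x keeps 3 / 4 of it, the O(1 / T) error takes 1 / 4, and the remaining half
  is divided by 3.\<close>

lemma E_dE_damping:
  assumes c: "c > 8" and T: "T \<ge> c * real (Suc k)" and \<phi>: "fstar (1 / c) \<le> \<phi>"
    and x: "0 < X (Suc k) T" and e: "\<phi> + \<bar>E (Suc k) T\<bar> \<le> q" "q \<le> 1 / 4"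
    and p: "\<bar>E k T\<bar> \<le> p * \<bar>E (Suc k) T\<bar>"
    and s: "s = 1 - 2 * \<phi> - 2 * q * p" "0 \<le> s"
    and C: "4 / (1 - 4 * fstar (1 / c)) / T \<le> s * \<bar>E (Suc k) T\<bar> / 4"
  shows "E (Suc k) T * dE k T \<le> - (s / 6) * (E (Suc k) T)\<^sup>2"
proof -
  define x e F where "x = X (Suc k) T" and "e = \<bar>E (Suc k) T\<bar>" and "F = fstar (real (Suc k) / T)"
  have "c * real (Suc k) > 0" using c by simp
  then have "T > 0" using T by simp
  then have F: "F \<le> \<phi>" unfolding F_def using fstar_mono[OF ratio_le[OF _ T]] \<phi> c by force
  have "x = F + E (Suc k) T" unfolding x_def F_def E_def by simp
  then have xq: "0 < x" "x \<le> q" using F e(1) x unfolding x_def by auto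
  have "E (Suc k) T * E k T \<le> e * (p * e)" unfolding e_def by (rule mult_le_abs[OF p])
  then have "2 * x * (E (Suc k) T * E k T) \<le> 2 * x * (e * (p * e))" using xq by (intro mult_left_mono) auto
  also have "\<dots> \<le> 2 * q * (e * (p * e))"
    using xq p unfolding e_def by (intro mult_right_mono mult_nonneg_nonneg[OF abs_ge_zero]) auto
  finally have "2 * x * (E (Suc k) T * E k T) \<le> 2 * q * p * e\<^sup>2" by (simp add: power2_eq_square mult_ac)
  moreover have "- (1 - 2 * F) * e\<^sup>2 \<le> - (1 - 2 * \<phi>) * e\<^sup>2" using F by (intro mult_right_mono) auto
  moreover define Y where "Y = - (1 - 2 * F) * e\<^sup>2 + 2 * x * (E (Suc k) T * E k T)"
  ultimately have Y: "Y \<le> - (s * e\<^sup>2)" unfolding s(1) by (simp add: algebra_simps)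
  moreover have "0 \<le> s * e\<^sup>2" using s(2) by simp
  ultimately have "(1 - x) * Y \<le> (3 / 4) * Y" using xq e(2) by (intro mult_right_mono_neg) auto
  then have 1: "(1 - x) * Y \<le> - (3 / 4) * (s * e\<^sup>2)" using Y by argo
  have "e * (4 / (1 - 4 * fstar (1 / c)) / T) \<le> e * (s * e / 4)" using C unfolding e_def by (intro mult_left_mono) auto
  then have 2: "e * (4 / (1 - 4 * fstar (1 / c)) / T) \<le> (1 / 4) * (s * e\<^sup>2)" by (simp add: power2_eq_square mult_ac)
  have "3 * (E (Suc k) T * dE k T) \<le> (1 - x) * Y + e * (4 / (1 - 4 * fstar (1 / c)) / T)"
    using E_dE_le[OF c T] xq e(2) unfolding Y_def x_def F_def e_def by simp
  then have "E (Suc k) T * dE k T \<le> - (s / 6) * e\<^sup>2" using 1 2 by argo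
  then show ?thesis unfolding e_def by simp
qed

text \<open>While the deviation at the current index exceeds \<gamma> * \<eta>, the preceding one is
  at most 1 / \<gamma> times as large. So damping wins as soon as \<gamma> exceeds the ratio of
  driving to relaxation, and the waiting time L is independent of the index; it fits between c k and
  c' k for large k.\<close>

lemma relax_step:
  assumes c: "c > 8" and \<eta>: "0 < \<eta>" "\<eta> \<le> \<eta>0" and \<phi>: "fstar (1 / c) \<le> \<phi>" "\<phi> + \<eta>0 < 1 / 4"
    and \<gamma>: "2 * (\<phi> + \<eta>0) / (1 - 2 * \<phi>) < \<gamma>" "\<gamma> < 1" and c': "c < c'" and H: "eventually_tracking \<eta> c"
  shows "eventually_tracking (\<gamma> * \<eta>) c'"
proof -
  have "0 \<le> fstar (1 / c)" using c by (intro fstar_nonneg) simp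
  then have \<phi>0: "0 \<le> \<phi>" using \<phi>(1) by linarith
  have "0 \<le> 2 * (\<phi> + \<eta>0)" "0 \<le> 1 - 2 * \<phi>" using \<phi>(2) \<phi>0 \<eta> by argo+
  then have "0 \<le> 2 * (\<phi> + \<eta>0) / (1 - 2 * \<phi>)" by (rule divide_nonneg_nonneg)
  then have \<gamma>0: "0 < \<gamma>" using \<gamma>(1) by linarith
  define q where "q = \<phi> + \<eta>0"
  define s where "s = 1 - 2 * \<phi> - 2 * q * (1 / \<gamma>)"
  have s: "s > 0"
  proof -
    have "2 * q < \<gamma> * (1 - 2 * \<phi>)" using \<gamma>(1) \<phi> \<eta> unfolding q_def by (simp add: pos_divide_less_eq)
    then show ?thesis unfolding s_def using \<gamma>0 by (simp add: field_simps)
  qed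
  define D where "D = 4 / (1 - 4 * fstar (1 / c))"
  have D: "D > 0" unfolding D_def using \<phi> \<eta> by simp
  define T0 where "T0 = 4 * D / (\<gamma> * \<eta> * s)"
  have T0: "T0 > 0" unfolding T0_def using D s \<gamma>0 \<eta> by simp
  define L where "L = - ln \<gamma> / (s / 6)"
  obtain K where K: "\<And>k T. k \<ge> K \<Longrightarrow> T \<ge> c * real k \<Longrightarrow> tracking \<eta> k T"
    using H unfolding eventually_tracking_def by blast
  \<comment> \<open>The first summand makes (c' - c) k at least L, which serves j near k; the second
    leaves room after c K, T0 and 1, which serves small j.\<close>
  define K1 where "K1 = nat \<lceil>L / (c' - c)\<rceil> + nat \<lceil>(c * real K + T0 + 1 + \<bar>L\<bar>) / c'\<rceil>"
  have "0 < X j T \<and> \<bar>E j T\<bar> \<le> \<gamma> * \<eta>" if k: "k \<ge> K1" and T: "T \<ge> c' * real k" and j: "1 \<le> j" "j \<le> k" for j k T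
  proof -
    \<comment> \<open>Decay for index j starts once tracking holds for both j and K and the O(1 / T)
      error is small enough.\<close>
    define a where "a = max (max (c * real j) (c * real K)) (max T0 1)"
    have a: "a \<ge> c * real j" "a \<ge> c * real K" "a \<ge> T0" "a \<ge> 1" unfolding a_def by simp_all
    have aI: "a + z \<le> y" if "c * real j + z \<le> y" "c * real K + z \<le> y" "T0 + z \<le> y" "1 + z \<le> y" for y z
      using that unfolding a_def by (simp add: max_def)
    have L: "a + L \<le> T" "a \<le> T"
    proof -
      have k1: "real k \<ge> L / (c' - c)" "real k \<ge> (c * real K + T0 + 1 + \<bar>L\<bar>) / c'"
        using k unfolding K1_def by linarith+
      have "L \<le> (c' - c) * real k" using k1(1) c' by (simp add: pos_divide_le_eq mult.commute)
      then have "c * real k + L \<le> T" using T by (simp add: algebra_simps)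
      moreover have "c * real j \<le> c * real k" using j c by simp
      ultimately have b1: "c * real j + L \<le> T" by simp
      have "c * real k \<le> c' * real k" using c' by (intro mult_right_mono) auto
      then have b1': "c * real j \<le> T" using T \<open>c * real j \<le> c * real k\<close> by simp
      have "c * real K + T0 + 1 + \<bar>L\<bar> \<le> c' * real k" using k1(2) c c' by (simp add: pos_divide_le_eq mult.commute)
      then have "c * real K + T0 + 1 + \<bar>L\<bar> \<le> T" using T by simp
      moreover have "c * real K \<ge> 0" using c by simp
      ultimately show "a + L \<le> T" "a \<le> T" using b1 b1' T0 aI[of L T] aI[of 0 T] by linarith+
    qed
    have g: "tracking \<eta> (max j K) t" if "t \<ge> a" for t
      using that a K[of "max j K" t] by (auto simp: max_def)
    obtain i where i: "j = Suc i" using j by (cases j) auto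
    have pos: "0 < X l t" if "t \<ge> a" "1 \<le> l" "l \<le> j" for t l
      using tracking_pos[OF g[OF that(1)], of l] that by auto
    have eb: "\<bar>E l t\<bar> \<le> \<eta>" if "t \<ge> a" "l \<le> j" for t l
      using trackingD[OF g[OF that(1)], of l] that \<eta> by auto
    have "\<bar>E (Suc i) T\<bar> \<le> \<gamma> * \<eta>"
    proof (rule E_decay[OF c _ L(2), where M = \<eta> and r = "s / 6"])
      show "c * real (Suc i) \<le> a" using a i by simp
      show "\<bar>E (Suc i) a\<bar> \<le> \<eta>" using eb[of a] i by simp
      show "\<gamma> * \<eta> < \<eta>" using \<gamma> \<eta> by simp
      show "X l t \<noteq> 0" if "a \<le> t" "1 \<le> l" "l \<le> i" for t l using pos[OF that(1,2)] that i by force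
      show "exp (- (s / 6) * (T - a)) * \<bar>E (Suc i) a\<bar> \<le> \<gamma> * \<eta>"
      proof -
        have "L * (s / 6) \<le> (T - a) * (s / 6)" using L s by (intro mult_right_mono) auto
        moreover have "L * (s / 6) = - ln \<gamma>" unfolding L_def using s by simp
        ultimately have "- (s / 6) * (T - a) \<le> ln \<gamma>" by (simp add: mult.commute)
        then have "exp (- (s / 6) * (T - a)) \<le> exp (ln \<gamma>)" by (simp only: exp_le_cancel_iff)
        then show ?thesis using \<gamma>0 eb[of a] i by (intro mult_mono) auto
      qed
      fix t assume t: "a \<le> t" "t \<le> T" "\<gamma> * \<eta> < \<bar>E (Suc i) t\<bar>" "\<bar>E (Suc i) t\<bar> \<le> \<eta>"
      show "E (Suc i) t * dE i t \<le> - (s / 6) * (E (Suc i) t)\<^sup>2"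
      proof (rule E_dE_damping[OF c _ \<phi>(1) _ _ _ _ s_def])
        show "c * real (Suc i) \<le> t" "0 < X (Suc i) t" using a t i pos[of t j] by auto
        show "\<phi> + \<bar>E (Suc i) t\<bar> \<le> q" "q \<le> 1 / 4" "0 \<le> s" using t(4) \<eta> \<phi> s unfolding q_def by auto
        have "\<eta> \<le> 1 / \<gamma> * \<bar>E (Suc i) t\<bar>" using t(3) \<gamma>0 by (simp add: field_simps)
        then show "\<bar>E i t\<bar> \<le> 1 / \<gamma> * \<bar>E (Suc i) t\<bar>" using eb[OF t(1), of i] i by simp
        have "D / t \<le> D / T0" using a t T0 D by (intro divide_left_mono) auto
        also have "D / T0 = s * (\<gamma> * \<eta>) / 4" unfolding T0_def using D s \<gamma>0 \<eta> by simp
        also have "\<dots> \<le> s * \<bar>E (Suc i) t\<bar> / 4" using t(3) s by simp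
        finally show "4 / (1 - 4 * fstar (1 / c)) / t \<le> s * \<bar>E (Suc i) t\<bar> / 4" unfolding D_def .
      qed
    qed (use \<gamma>0 \<eta> s in simp_all)
    then show ?thesis using pos[OF L(2) j(1)] i by simp
  qed
  then show ?thesis unfolding eventually_tracking_def tracking_def by blast
qed

text \<open>The condition \<phi> + \<eta>0 < 1 / 4 is precisely what leaves a contraction factor
  \<gamma> < 1 for \<open>relax_step\<close>, which is then iterated.\<close>

lemma relax:
  assumes c: "c > 8" and \<eta>0: "0 < \<eta>0" "fstar (1 / c) + \<eta>0 < 1 / 4" and H: "eventually_tracking \<eta>0 c"
    and \<eta>: "0 < \<eta>" and c': "c < c'"
  shows "eventually_tracking \<eta> c'"
proof -
  define \<phi> where "\<phi> = fstar (1 / c)"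
  have \<phi>0: "0 \<le> \<phi>" unfolding \<phi>_def using c by (intro fstar_nonneg) simp
  have \<phi>4: "\<phi> + \<eta>0 < 1 / 4" using \<eta>0 unfolding \<phi>_def by simp
  have "2 * (\<phi> + \<eta>0) < 1 * (1 - 2 * \<phi>)" using \<phi>4 \<eta>0 by simp
  then have "2 * (\<phi> + \<eta>0) / (1 - 2 * \<phi>) < 1" using \<phi>4 \<eta>0 by (simp add: pos_divide_less_eq)
  from dense[OF this] obtain \<gamma> where \<gamma>: "2 * (\<phi> + \<eta>0) / (1 - 2 * \<phi>) < \<gamma>" "\<gamma> < 1" by blast
  have "0 \<le> 2 * (\<phi> + \<eta>0)" "0 \<le> 1 - 2 * \<phi>" using \<phi>4 \<phi>0 \<eta>0 by argo+
  then have "0 \<le> 2 * (\<phi> + \<eta>0) / (1 - 2 * \<phi>)" by (rule divide_nonneg_nonneg)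
  then have \<gamma>0: "0 < \<gamma>" using \<gamma>(1) by linarith
  \<comment> \<open>Each contraction raises the constant by an arbitrarily small amount; quantifying
    over all d > c makes the statement stable under iteration.\<close>
  have it: "\<forall>d>c. eventually_tracking (\<gamma> ^ m * \<eta>0) d" for m
  proof (induction m)
    case 0
    then show ?case using eventually_tracking_mono[OF H] by auto
  next
    case (Suc m)
    show ?case
    proof (intro allI impI)
      fix d assume d: "c < d"
      then obtain b where b: "c < b" "b < d" using dense by blast
      have "fstar (1 / b) \<le> \<phi>" unfolding \<phi>_def using b c by (intro fstar_mono) (simp add: field_simps)
      moreover have "\<gamma> ^ m * \<eta>0 \<le> 1 * \<eta>0" using \<gamma> \<gamma>0 \<eta>0 by (intro mult_right_mono power_le_one) auto
      ultimately have "eventually_tracking (\<gamma> * (\<gamma> ^ m * \<eta>0)) d"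
        using relax_step[of b "\<gamma> ^ m * \<eta>0" \<eta>0 \<phi> \<gamma> d] b c Suc \<phi>4 \<gamma> \<gamma>0 \<eta>0 by simp
      then show "eventually_tracking (\<gamma> ^ Suc m * \<eta>0) d" by (simp add: mult.assoc)
    qed
  qed
  obtain m where "\<gamma> ^ m < \<eta> / \<eta>0" using real_arch_pow_inv[of "\<eta> / \<eta>0" \<gamma>] \<eta> \<eta>0 \<gamma> by auto
  then have "\<gamma> ^ m * \<eta>0 \<le> \<eta>" using \<eta>0 by (simp add: pos_less_divide_eq)
  then show ?thesis using it[of m] c' eventually_tracking_mono by blast
qed

text \<open>Once the window is reached it is kept: the relaxation towards the quasi-equilibrium dominates
  the driving by the preceding index.\<close>

lemma window_invariant:
  assumes c: "c > 8" and \<phi>: "fstar (1 / c) = \<phi>" "\<phi> + 2 * \<eta> < 1 / 4" and \<eta>: "0 < \<eta>"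
    and a: "c * real (Suc K) \<le> a" "a \<le> T" and g: "\<And>t. t \<ge> a \<Longrightarrow> tracking \<eta> K t"
    and Ea: "\<bar>E (Suc K) a\<bar> \<le> \<eta>" and Xa: "0 < X (Suc K) a"
    and Ca: "4 / (1 - 4 * \<phi>) / a \<le> (1 - 4 * \<phi> - 4 * \<eta>) * \<eta> / 4"
  shows "0 < X (Suc K) T \<and> \<bar>E (Suc K) T\<bar> \<le> \<eta>"
proof -
  have "c * real (Suc K) > 0" using c by simp
  then have apos: "a > 0" using a by linarith
  have nz: "X j t \<noteq> 0" if "t \<ge> a" "1 \<le> j" "j \<le> K" for t j using tracking_pos[OF g[OF that(1)] that(2,3)] by simp
  have Xpos: "0 < X (Suc K) t" if "a \<le> t" for t
  proof (rule positive_invariant[of a t _ "V K"])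
    show "(X (Suc K) has_real_derivative V K t) (at t)" if "a \<le> t" for t
      using X_deriv[of t K] nz that apos by auto
    \<comment> \<open>At a zero of \<open>X (Suc K)\<close> the drift is Suc K / (3 t).\<close>
    show "0 < V K t" if "a \<le> t" "X (Suc K) t = 0" for t
      unfolding V_def that(2) using that(1) apos by simp
  qed (use that Xa in auto)
  define s where "s = 1 - 2 * \<phi> - 2 * (\<phi> + 2 * \<eta>) * 1"
  have s: "s > 0" "s = 1 - 4 * \<phi> - 4 * \<eta>" unfolding s_def using \<phi>(2) \<eta> by simp_all
  have "\<bar>E (Suc K) T\<bar> \<le> \<eta>"
  proof (rule E_decay[OF c a, where M = "2 * \<eta>" and r = "s / 6"])
    show "exp (- (s / 6) * (T - a)) * \<bar>E (Suc K) a\<bar> \<le> \<eta>"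
      using mult_mono[of "exp (- (s / 6) * (T - a))" 1 "\<bar>E (Suc K) a\<bar>" \<eta>] s a Ea by simp
    fix t assume t: "a \<le> t" "t \<le> T" "\<eta> < \<bar>E (Suc K) t\<bar>" "\<bar>E (Suc K) t\<bar> \<le> 2 * \<eta>"
    show "E (Suc K) t * dE K t \<le> - (s / 6) * (E (Suc K) t)\<^sup>2"
    proof (rule E_dE_damping[OF c _ _ _ _ _ _ s_def])
      show "\<bar>E K t\<bar> \<le> 1 * \<bar>E (Suc K) t\<bar>" using trackingD[OF g[OF t(1)], of K] \<eta> t(3) by simp
      have "4 / (1 - 4 * \<phi>) / t \<le> 4 / (1 - 4 * \<phi>) / a" using t apos \<phi> \<eta> by (intro divide_left_mono) auto
      also have "\<dots> \<le> s * \<eta> / 4" using Ca unfolding s(2) .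
      also have "\<dots> \<le> s * \<bar>E (Suc K) t\<bar> / 4" using s t(3) by simp
      finally show "4 / (1 - 4 * fstar (1 / c)) / t \<le> s * \<bar>E (Suc K) t\<bar> / 4" unfolding \<phi>(1) .
    qed (use \<phi> \<eta> s a t Xpos in auto)
  qed (use nz \<eta> s Ea in auto)
  then show ?thesis using Xpos[OF a(2)] by simp
qed

end

text \<open>With \<open>v = sqrt (1 - 4 * f)\<close> and the multiplier \<open>l = (1 + v) / (1 - v)\<close> this is the inequality by
  which the damping beats the amplification.\<close>

lemma ln_ratio_bound:
  fixes v :: real
  assumes "0 < v" "v < 1"
  shows "ln ((1 + v) / (1 - v)) < (2 / 3) * (3 * v + v ^ 3) / (1 - v ^ 4)"
proof -
  define \<phi> where "\<phi> v = (2 / 3) * (3 * v + v ^ 3) / (1 - v ^ 4) - (ln (1 + v) - ln (1 - v))" for v :: real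
  \<comment> \<open>Both sides agree at 0, and the derivative of the difference collapses to (8 / 3)
    x^4 (3 + x^2) / (1 - x^4)^2.\<close>
  have "\<phi> 0 < \<phi> v"
  proof (rule DERIV_pos_imp_increasing_open[OF assms(1)])
    fix x :: real assume x: "0 < x" "x < v"
    have x4: "x ^ 4 < 1" using x assms by (intro power_less_one_iff[THEN iffD2]) auto
    define D where "D = (2 / 3) * ((3 + 3 * x ^ 2) * (1 - x ^ 4) + (3 * x + x ^ 3) * (4 * x ^ 3)) / (1 - x ^ 4) ^ 2
        - (1 / (1 + x) + 1 / (1 - x))"
    have "(\<phi> has_real_derivative D) (at x)"
    proof -
      have p: "((\<lambda>v. (2 / 3) * (3 * v + v ^ 3)) has_real_derivative (2 / 3) * (3 + 3 * x ^ 2)) (at x)"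
        by (auto intro!: derivative_eq_intros)
      have q: "((\<lambda>v. 1 - v ^ 4) has_real_derivative - (4 * x ^ 3)) (at x)"
        by (auto intro!: derivative_eq_intros)
      have r: "((\<lambda>v. ln (1 + v) - ln (1 - v)) has_real_derivative (1 / (1 + x) + 1 / (1 - x))) (at x)"
        using x assms by (auto intro!: derivative_eq_intros)
      have nz: "1 - x ^ 4 \<noteq> 0" using x4 by simp
      show ?thesis unfolding \<phi>_def
        by (rule DERIV_cong[OF DERIV_diff[OF DERIV_divide[OF p q nz] r]])
          (simp add: D_def power2_eq_square algebra_simps)
    qed
    moreover have "D = (8 / 3) * x ^ 4 * (3 + x ^ 2) / (1 - x ^ 4) ^ 2"
    proof -
      have e: "1 / (1 + x) + 1 / (1 - x) = 2 * (1 + x ^ 2) * (1 - x ^ 4) / (1 - x ^ 4) ^ 2"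
      proof -
        define P where "P = 1 - x ^ 4"
        have P: "P \<noteq> 0" unfolding P_def using x4 by simp
        have PQ: "P = (1 + x) * (1 - x) * (1 + x ^ 2)" unfolding P_def by (simp add: algebra_simps power_numeral_reduce)
        have Q: "1 + x ^ 2 \<noteq> 0" using PQ P by auto
        have "2 * (1 + x ^ 2) * P / P ^ 2 = 2 * (1 + x ^ 2) / P" using P by (simp add: power2_eq_square)
        also have "\<dots> = 2 / ((1 + x) * (1 - x))" unfolding PQ by (rule mult_divide_mult_cancel_right[OF Q])
        also have "\<dots> = 1 / (1 + x) + 1 / (1 - x)" using x assms by (simp add: field_simps)
        finally show ?thesis unfolding P_def by simp
      qed
      have "(2 / 3) * ((3 + 3 * x ^ 2) * (1 - x ^ 4) + (3 * x + x ^ 3) * (4 * x ^ 3)) - 2 * (1 + x ^ 2) * (1 - x ^ 4)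
          = (8 / 3) * x ^ 4 * (3 + x ^ 2)"
        by (simp add: field_simps power_numeral_reduce)
      then show ?thesis unfolding D_def e diff_divide_distrib[symmetric] by (rule arg_cong)
    qed
    moreover have "(8 / 3) * x ^ 4 * (3 + x ^ 2) / (1 - x ^ 4) ^ 2 > 0" using x x4
      by (intro divide_pos_pos mult_pos_pos) (auto simp: add_pos_nonneg)
    ultimately show "\<exists>y. (\<phi> has_real_derivative y) (at x) \<and> 0 < y" by auto
  next
    show "continuous_on {0..v} \<phi>"
    proof -
      have "x ^ 4 \<noteq> 1" if "0 \<le> x" "x \<le> v" for x
        using that assms power_less_one_iff[of x 4] by (auto simp: order_less_imp_not_eq)
      then show ?thesis unfolding \<phi>_def using assms by (auto intro!: continuous_intros)
    qed
  qed
  then show ?thesis using assms unfolding \<phi>_def by (simp add: ln_div)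
qed

text \<open>Along the direction E k = E (k + 1) / l the linearised flow decays at rate (1 - f) v /
  3, and 1 / \<kappa> is the time by which the threshold T = k / \<kappa> advances per index. The
  last property thus says that one amplification is undone before the next. The square root v of 1 -
  4 f makes l rational.\<close>

lemma hyperbolic_multiplier:
  assumes \<kappa>: "0 < \<kappa>" "\<kappa> < 1 / 8"
  defines "f \<equiv> fstar \<kappa>"
  obtains l v where "1 < l" "0 < v" "l + 1 / l = (1 - 2 * f) / f" "(1 - 2 * f) - 2 * f / l = v"
    "ln l < (1 - f) * v / 3 / \<kappa>"
proof -
  have f: "0 < f" "f < 1 / 4"
    using fstar_bounds(1)[of \<kappa>] fstar_less[of \<kappa>] \<kappa> unfolding f_def by auto
  have k: "\<kappa> = f * (1 - 2 * f)" using fstar_eq[of \<kappa>] \<kappa> unfolding f_def by simp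
  define v where "v = sqrt (1 - 4 * f)"
  have v: "0 < v" "v < 1" using f unfolding v_def by auto
  have v2: "v ^ 2 = 1 - 4 * f" using f unfolding v_def by simp
  have fv: "f = (1 - v ^ 2) / 4" using v2 by simp
  have v21: "v ^ 2 < 1" using v2 f by simp
  define l where "l = (1 + v) / (1 - v)"
  have l: "1 < l" unfolding l_def using v by simp
  have a: "l + 1 / l = (1 - 2 * f) / f"
  proof -
    have "1 - v ^ 2 = (1 - v) * (1 + v)" by (simp add: algebra_simps power2_eq_square)
    moreover have "1 - v ^ 2 \<noteq> 0" using v21 by simp
    moreover have "(1 - 2 * f) / f = 2 * (1 + v ^ 2) / (1 - v ^ 2)"
      unfolding fv using v21 by (simp add: field_simps)
    moreover have "l + 1 / l = 2 * (1 + v ^ 2) / ((1 - v) * (1 + v))"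
      unfolding l_def using v by (simp add: field_simps power2_eq_square)
    ultimately show ?thesis by simp
  qed
  have b: "(1 - 2 * f) - 2 * f / l = v"
    unfolding l_def fv using v by (simp add: field_simps power2_eq_square)
  have c: "ln l < (1 - f) * v / 3 / \<kappa>"
  proof -
    have v4: "v ^ 4 = (1 - 4 * f) ^ 2" unfolding v2[symmetric] by (simp flip: power_mult)
    have v3: "v ^ 3 = v * (1 - 4 * f)" unfolding v2[symmetric] by (simp add: power_numeral_reduce)
    have k8: "\<kappa> = (1 - v ^ 4) / 8" unfolding k v4 by (simp add: algebra_simps power2_eq_square)
    moreover have "v ^ 4 < 1" using v by (intro power_less_one_iff[THEN iffD2]) auto
    moreover have fv3: "(1 - f) * v / 3 = (3 * v + v ^ 3) / 12" unfolding v3 by (simp add: field_simps)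
    ultimately have "(1 - f) * v / 3 / \<kappa> = (2 / 3) * (3 * v + v ^ 3) / (1 - v ^ 4)"
      unfolding fv3 k8 by (simp add: field_simps)
    then show ?thesis using ln_ratio_bound[OF v] unfolding l_def by simp
  qed
  show ?thesis using that[OF l v(1) a b c] .
qed

context dPI_flow begin

text \<open>At the equilibrium the linearised recursion has the multipliers \<open>l\<close> and \<open>1 / l\<close>. Deviations that
  stay bounded for \<open>J\<close> indices must therefore be close to the direction of \<open>l\<close>.\<close>

lemma unstable_direction:
  assumes c: "c > 8" and T: "T \<ge> c * real (Suc (b + J))" and l: "l > 1" and \<eta>: "\<eta> \<ge> 0" and J: "J \<ge> 1"
    and e: "\<And>j. b \<le> j \<Longrightarrow> j \<le> b + J \<Longrightarrow> \<bar>E j T\<bar> \<le> \<eta>"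
    and m: "\<And>j. b < j \<Longrightarrow> j \<le> b + J \<Longrightarrow> 0 < X j T \<and> \<bar>(1 - 2 * fstar (real j / T)) / X j T - (l + 1 / l)\<bar> \<le> \<zeta>"
    and C: "2 / (1 - 4 * fstar (1 / c)) / T \<le> \<zeta> * \<eta>"
  shows "\<bar>E (b + J) T - E (Suc (b + J)) T / l\<bar> \<le> 2 * \<eta> / l ^ J + 2 * \<zeta> * \<eta> / (l - 1)"
proof -
  have "\<bar>E (b + i) T - E (Suc (b + i)) T / l\<bar> \<le> 2 * \<eta> / l ^ i + 2 * \<zeta> * \<eta> / (l - 1)" if "i \<le> J" for i
    using that
  proof (induction i)
    case 0
    have "\<zeta> \<ge> 0" using m[of "Suc b"] J by auto
    then have "2 * \<zeta> * \<eta> / (l - 1) \<ge> 0" using \<eta> l by simp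
    moreover have "\<bar>E (Suc b) T / l\<bar> \<le> \<eta>"
    proof -
      have "\<bar>E (Suc b) T\<bar> / l \<le> \<eta> / 1" using e[of "Suc b"] J l \<eta> by (intro frac_le) auto
      then show ?thesis using l by (simp add: abs_divide)
    qed
    moreover have "\<bar>E b T\<bar> \<le> \<eta>" using e[of b] by simp
    ultimately have "\<bar>E b T - E (Suc b) T / l\<bar> \<le> 2 * \<eta> + 2 * \<zeta> * \<eta> / (l - 1)" by linarith
    then show ?case by simp
  next
    case (Suc i)
    define k where "k = b + i"
    define mm where "mm = (1 - 2 * fstar (real (Suc k) / T)) / X (Suc k) T"
    define w where "w = E (Suc (Suc k)) T + E k T - mm * E (Suc k) T"
    define \<delta> where "\<delta> = mm - (l + 1 / l)"
    have kJ: "Suc k \<le> b + J" using Suc.prems unfolding k_def by simp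
    have "c * real (Suc (Suc k)) \<le> c * real (Suc (b + J))" using kJ c by simp
    then have "\<bar>w\<bar> \<le> \<zeta> * \<eta>"
      using E_rec[OF c, of k T] m[of "Suc k"] kJ T C unfolding w_def mm_def k_def by fastforce
    moreover have "\<bar>\<delta> * E (Suc k) T\<bar> \<le> \<zeta> * \<eta>"
      unfolding abs_mult using m[of "Suc k"] e[of "Suc k"] kJ unfolding \<delta>_def mm_def k_def
      by (intro mult_mono) auto
    ultimately have 1: "\<bar>\<delta> * E (Suc k) T + w\<bar> \<le> 2 * \<zeta> * \<eta>" by linarith
    \<comment> \<open>The defect from the direction of l obeys a recursion with factor 1 / l,
      because the roots of the linear recurrence are l and 1 / l.\<close>
    have "E (Suc k) T - E (Suc (Suc k)) T / l = ((E k T - E (Suc k) T / l) - (\<delta> * E (Suc k) T + w)) / l"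
      unfolding w_def \<delta>_def using l by (simp add: field_simps)
    also have "\<bar>\<dots>\<bar> \<le> ((2 * \<eta> / l ^ i + 2 * \<zeta> * \<eta> / (l - 1)) + 2 * \<zeta> * \<eta>) / l"
    proof -
      have "\<bar>E k T - E (Suc k) T / l\<bar> \<le> 2 * \<eta> / l ^ i + 2 * \<zeta> * \<eta> / (l - 1)"
        using Suc unfolding k_def by simp
      then have "\<bar>(E k T - E (Suc k) T / l) - (\<delta> * E (Suc k) T + w)\<bar> \<le> (2 * \<eta> / l ^ i + 2 * \<zeta> * \<eta> / (l - 1)) + 2 * \<zeta> * \<eta>"
        using 1 by linarith
      then show ?thesis using l by (simp add: abs_divide divide_right_mono)
    qed
    also have "\<dots> = 2 * \<eta> / l ^ Suc i + 2 * \<zeta> * \<eta> / (l - 1)" using l by (simp add: field_simps)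
    finally show ?case unfolding k_def by simp
  qed
  from this[of J] show ?thesis by simp
qed

end

text \<open>Joint continuity at (f, f) of the coefficient in \<open>E_rec\<close> and of the damping
  rate along the direction of l.\<close>

lemma local_constants:
  fixes f l r :: real
  assumes f: "0 < f" and \<zeta>: "0 < \<zeta>"
  obtains \<omega> where "0 < \<omega>" "\<omega> < f"
    "\<And>x F. \<bar>x - f\<bar> \<le> \<omega> \<Longrightarrow> \<bar>F - f\<bar> \<le> \<omega> \<Longrightarrow> \<bar>(1 - 2 * F) / x - (1 - 2 * f) / f\<bar> \<le> \<zeta>
        \<and> \<bar>(1 - x) * ((1 - 2 * F) - 2 * x / l) - (1 - f) * ((1 - 2 * f) - 2 * f / l)\<bar> \<le> \<zeta>"
proof -
  have t: "((\<lambda>p. p) \<longlongrightarrow> (f, f)) (nhds (f, f))" by (rule filterlim_ident)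
  have ts: "(fst \<longlongrightarrow> f) (nhds (f, f))" "(snd \<longlongrightarrow> f) (nhds (f, f))"
    using tendsto_fst[OF t] tendsto_snd[OF t] by simp_all
  have 1: "((\<lambda>p. (1 - 2 * snd p) / fst p) \<longlongrightarrow> (1 - 2 * f) / f) (nhds (f, f))"
    using f by (intro tendsto_intros ts) auto
  have 2: "((\<lambda>p. (1 - fst p) * ((1 - 2 * snd p) - 2 * fst p / l)) \<longlongrightarrow> (1 - f) * ((1 - 2 * f) - 2 * f / l)) (nhds (f, f))"
    unfolding divide_inverse by (intro tendsto_intros ts)
  have "\<forall>\<^sub>F p in nhds (f, f). dist ((1 - 2 * snd p) / fst p) ((1 - 2 * f) / f) < \<zeta> \<and>
      dist ((1 - fst p) * ((1 - 2 * snd p) - 2 * fst p / l)) ((1 - f) * ((1 - 2 * f) - 2 * f / l)) < \<zeta>"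
    by (intro eventually_conj tendstoD[OF 1 \<zeta>] tendstoD[OF 2 \<zeta>])
  then obtain d where d: "d > 0" "\<And>p. dist p (f, f) < d \<Longrightarrow> dist ((1 - 2 * snd p) / fst p) ((1 - 2 * f) / f) < \<zeta> \<and>
      dist ((1 - fst p) * ((1 - 2 * snd p) - 2 * fst p / l)) ((1 - f) * ((1 - 2 * f) - 2 * f / l)) < \<zeta>"
    unfolding eventually_nhds_metric by blast
  show ?thesis
  proof (rule that[of "min (d / 4) (f / 2)"])
    fix x F assume *: "\<bar>x - f\<bar> \<le> min (d / 4) (f / 2)" "\<bar>F - f\<bar> \<le> min (d / 4) (f / 2)"
    have "dist (x, F) (f, f) \<le> \<bar>x - f\<bar> + \<bar>F - f\<bar>"
      unfolding dist_prod_def dist_real_def by (simp add: sqrt_sum_squares_le_sum_abs)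
    also have "\<dots> < d" using * d(1) by linarith
    finally show "\<bar>(1 - 2 * F) / x - (1 - 2 * f) / f\<bar> \<le> \<zeta>
        \<and> \<bar>(1 - x) * ((1 - 2 * F) - 2 * x / l) - (1 - f) * ((1 - 2 * f) - 2 * f / l)\<bar> \<le> \<zeta>"
      using d(2)[of "(x, F)"] by (simp add: dist_real_def)
  qed (use f d in auto)
qed

context dPI_flow begin

text \<open>The time from \<open>a\<close> to \<open>b\<close> suffices to damp the deviation of \<open>X (Suc K)\<close>, which is at most
  about \<open>l * \<eta>\<close> at \<open>a\<close>, to \<open>\<eta>\<close>.\<close>

lemma extend_step:
  assumes c: "8 < c" and \<phi>: "fstar (1 / c) = \<phi>" "\<phi> + 2 * \<eta> < 1 / 4" and \<eta>: "0 < \<eta>"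
    and l: "1 < l" and \<epsilon>: "0 < \<epsilon>" "\<epsilon> < r"
    and \<omega>: "0 < \<omega>" "\<omega> < f" "f < 1 / 4" "l * (1 + \<epsilon>) * \<eta> \<le> \<omega> / 2"
    and loc: "\<And>x F. \<bar>x - f\<bar> \<le> \<omega> \<Longrightarrow> \<bar>F - f\<bar> \<le> \<omega> \<Longrightarrow>
      \<bar>(1 - 2 * F) / x - (l + 1 / l)\<bar> \<le> \<zeta> \<and> 3 * r - \<epsilon> \<le> (1 - x) * ((1 - 2 * F) - 2 * x / l)"
    and J: "1 \<le> J" "J \<le> K" "2 / l ^ J \<le> \<epsilon> / 2"
    and \<zeta>: "0 < \<zeta>" "\<zeta> \<le> \<epsilon>" "2 * \<zeta> / (l - 1) \<le> \<epsilon> / 2"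
    and a: "c * real (Suc K) \<le> a" "a \<le> b" "l * (1 + \<epsilon>) * exp (- (r - \<epsilon>) * (b - a)) \<le> 1"
    and F: "\<And>k t. a \<le> t \<Longrightarrow> t \<le> b \<Longrightarrow> K - J \<le> k \<Longrightarrow> k \<le> Suc K \<Longrightarrow> \<bar>fstar (real k / t) - f\<bar> \<le> \<omega> / 2"
    and C: "4 / (1 - 4 * \<phi>) / a \<le> \<zeta> * \<eta>" "4 / (1 - 4 * \<phi>) / a \<le> (1 - 4 * \<phi> - 4 * \<eta>) * \<eta> / 4"
    and tracking: "\<And>t. a \<le> t \<Longrightarrow> tracking \<eta> K t" and T: "b \<le> T"
  shows "tracking \<eta> (Suc K) T"
proof -
  have "c * real (Suc K) > 0" using c by simp
  then have apos: "0 < a" using a(1) by linarith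
  have \<phi>4: "\<phi> < 1 / 4" using \<phi> \<eta> by simp
  have Ct: "4 / (1 - 4 * \<phi>) / t \<le> 4 / (1 - 4 * \<phi>) / a" if "a \<le> t" for t
    using that apos \<phi>4 by (intro divide_left_mono) auto
  have le: "1 < l * (1 + \<epsilon>)" using l \<epsilon>(1) by (simp add: less_1_mult)
  then have le\<eta>: "\<eta> < l * (1 + \<epsilon>) * \<eta>" using \<eta> by simp
  have near: "\<bar>X k t - f\<bar> \<le> \<omega>" if "a \<le> t" "t \<le> b" "K - J \<le> k" "k \<le> Suc K" "\<bar>E k t\<bar> \<le> \<omega> / 2" for k t
    using F[OF that(1-4)] that(5) unfolding E_def by linarith
  \<comment> \<open>Knowing \<open>E\<close> only up to index K already ties
    \<open>E (Suc K)\<close> to l * \<open>E K\<close>: this bounds it at time a and turns its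
    driving term into a known fraction of itself.\<close>
  have d: "\<bar>E K t - E (Suc K) t / l\<bar> \<le> \<epsilon> * \<eta>" if t: "a \<le> t" "t \<le> b" for t
  proof -
    have bJ: "K - J + J = K" using J by simp
    have eb: "\<bar>E j t\<bar> \<le> \<eta>" if "j \<le> K" for j using trackingD[OF tracking[OF t(1)] that] \<eta> by simp
    have "\<bar>E (K - J + J) t - E (Suc (K - J + J)) t / l\<bar> \<le> 2 * \<eta> / l ^ J + 2 * \<zeta> * \<eta> / (l - 1)"
    proof (rule unstable_direction[OF c _ l])
      show "c * real (Suc (K - J + J)) \<le> t" using a t unfolding bJ by simp
      show "\<And>j. K - J \<le> j \<Longrightarrow> j \<le> K - J + J \<Longrightarrow> \<bar>E j t\<bar> \<le> \<eta>" using eb unfolding bJ by blast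
      have "2 / (1 - 4 * \<phi>) / t \<le> 4 / (1 - 4 * \<phi>) / t"
        using t apos \<phi>4 by (intro divide_right_mono) auto
      then show "2 / (1 - 4 * fstar (1 / c)) / t \<le> \<zeta> * \<eta>"
        using C(1) Ct[OF t(1)] unfolding \<phi>(1) by linarith
      fix j assume j: "K - J < j" "j \<le> K - J + J"
      have jK: "1 \<le> j" "j \<le> K" using j bJ by auto
      have "\<bar>X j t - f\<bar> \<le> \<omega>" using near[OF t, of j] eb[OF jK(2)] le\<eta> \<omega>(4) j jK by auto
      moreover have "\<bar>fstar (real j / t) - f\<bar> \<le> \<omega>" using F[OF t, of j] j jK \<omega>(1) by auto
      ultimately show "0 < X j t \<and> \<bar>(1 - 2 * fstar (real j / t)) / X j t - (l + 1 / l)\<bar> \<le> \<zeta>"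
        using loc[of "X j t"] tracking_pos[OF tracking[OF t(1)] jK] by blast
    qed (use \<eta> J in simp_all)
    also have "\<dots> = (2 / l ^ J + 2 * \<zeta> / (l - 1)) * \<eta>" by (simp add: algebra_simps)
    also have "\<dots> \<le> (\<epsilon> / 2 + \<epsilon> / 2) * \<eta>" using J \<zeta> \<eta> by (intro mult_right_mono add_mono) auto
    finally show ?thesis unfolding bJ by simp
  qed
  have e1: "\<bar>E (Suc K) t\<bar> \<le> l * (1 + \<epsilon>) * \<eta>" if t: "a \<le> t" "t \<le> b" for t
  proof -
    have "\<bar>E K t\<bar> \<le> \<eta>" using trackingD[OF tracking[OF t(1)], of K] \<eta> by simp
    then have "\<bar>E (Suc K) t / l\<bar> \<le> (1 + \<epsilon>) * \<eta>" using d[OF t] by (simp add: algebra_simps)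
    then show ?thesis using l by (simp add: abs_divide pos_divide_le_eq mult_ac)
  qed
  have nz: "X j t \<noteq> 0" if "a \<le> t" "1 \<le> j" "j \<le> K" for t j
    using tracking_pos[OF tracking[OF that(1)] that(2,3)] by simp
  have xf: "\<bar>X (Suc K) t - f\<bar> \<le> \<omega>" if t: "a \<le> t" "t \<le> b" for t
    using near[OF t, of "Suc K"] e1[OF t] \<omega>(4) by simp
  have Eb: "\<bar>E (Suc K) b\<bar> \<le> \<eta>"
  proof (rule E_decay[OF c a(1,2) nz _ le\<eta> e1[OF order_refl a(2)], where r = "r - \<epsilon>"])
    have "exp (- (r - \<epsilon>) * (b - a)) * \<bar>E (Suc K) a\<bar> \<le> exp (- (r - \<epsilon>) * (b - a)) * (l * (1 + \<epsilon>) * \<eta>)"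
      using e1[OF order_refl a(2)] by (intro mult_left_mono) auto
    also have "\<dots> = (l * (1 + \<epsilon>) * exp (- (r - \<epsilon>) * (b - a))) * \<eta>" by (simp only: mult_ac)
    also have "\<dots> \<le> 1 * \<eta>" using a(3) \<eta> by (intro mult_right_mono) auto
    finally show "exp (- (r - \<epsilon>) * (b - a)) * \<bar>E (Suc K) a\<bar> \<le> \<eta>" by simp
    fix t assume t: "a \<le> t" "t \<le> b" and E: "\<eta> < \<bar>E (Suc K) t\<bar>"
    define e x F' where "e = \<bar>E (Suc K) t\<bar>" and "x = X (Suc K) t" and "F' = fstar (real (Suc K) / t)"
    define d' where "d' = E K t - E (Suc K) t / l"
    have e: "\<eta> < e" "0 < e" using E \<eta> unfolding e_def by auto
    have xb: "\<bar>x - f\<bar> \<le> \<omega>" unfolding x_def by (rule xf[OF t])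
    have x: "0 < x" "x < 1 / 2" using xb \<omega> by linarith+
    have "\<bar>F' - f\<bar> \<le> \<omega> / 2" unfolding F'_def by (rule F[OF t]) auto
    then have Fb: "\<bar>F' - f\<bar> \<le> \<omega>" using \<omega>(1) by linarith
    define Q where "Q = (1 - x) * ((1 - 2 * F') - 2 * x / l)"
    have Q: "3 * r - \<epsilon> \<le> Q" using loc[OF xb Fb] unfolding Q_def by blast
    have "3 * (E (Suc K) t * dE K t) \<le> (1 - x) * (- (1 - 2 * F') * e\<^sup>2 + 2 * x * (E (Suc K) t * E K t)) + e * (4 / (1 - 4 * \<phi>) / t)"
      using E_dE_le[OF c, of K t] a t x unfolding x_def F'_def e_def \<phi>(1) by simp
    also have "E (Suc K) t * E K t = e\<^sup>2 / l + E (Suc K) t * d'"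
      unfolding d'_def e_def by (simp add: algebra_simps power2_eq_square)
    also have "(1 - x) * (- (1 - 2 * F') * e\<^sup>2 + 2 * x * (e\<^sup>2 / l + E (Suc K) t * d'))
        = - Q * e\<^sup>2 + (1 - x) * (2 * x) * (E (Suc K) t * d')"
      unfolding Q_def using l by (simp add: field_simps)
    finally have 1: "3 * (E (Suc K) t * dE K t) \<le> - Q * e\<^sup>2 + (1 - x) * (2 * x) * (E (Suc K) t * d') + e * (4 / (1 - 4 * \<phi>) / t)" .
    have 2: "- Q * e\<^sup>2 \<le> - (3 * r - \<epsilon>) * e\<^sup>2" using Q by (intro mult_right_mono) auto
    have 3: "(1 - x) * (2 * x) * (E (Suc K) t * d') \<le> \<epsilon> * e\<^sup>2"
    proof -
      have "E (Suc K) t * d' \<le> e * (\<epsilon> * \<eta>)" unfolding e_def d'_def by (rule mult_le_abs[OF d[OF t]])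
      also have "e * (\<epsilon> * \<eta>) \<le> e * (\<epsilon> * e)" using e \<epsilon> by (intro mult_left_mono) auto
      finally have "(1 - x) * (2 * x) * (E (Suc K) t * d') \<le> (1 - x) * (2 * x) * (e * (\<epsilon> * e))"
        using x by (intro mult_left_mono mult_nonneg_nonneg) auto
      also have "\<dots> \<le> 1 * 1 * (e * (\<epsilon> * e))"
        using x e \<epsilon> by (intro mult_right_mono mult_mono) auto
      finally show ?thesis by (simp add: power2_eq_square mult_ac)
    qed
    have 4: "e * (4 / (1 - 4 * \<phi>) / t) \<le> \<epsilon> * e\<^sup>2"
    proof -
      have "\<zeta> * \<eta> \<le> \<epsilon> * e" using \<zeta> e \<eta> by (intro mult_mono) auto
      then have "e * (4 / (1 - 4 * \<phi>) / t) \<le> e * (\<epsilon> * e)"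
        using Ct[OF t(1)] C(1) e by (intro mult_left_mono) auto
      then show ?thesis by (simp add: power2_eq_square mult_ac)
    qed
    \<comment> \<open>Of the rate 3 * r one \<epsilon> each goes to the variation of Q, the defect
      d' and the O(1 / t) error, leaving 3 * (r - \<epsilon>).\<close>
    have "3 * (E (Suc K) t * dE K t) \<le> - (3 * r - \<epsilon>) * e\<^sup>2 + \<epsilon> * e\<^sup>2 + \<epsilon> * e\<^sup>2"
      using 1 2 3 4 by linarith
    also have "\<dots> = 3 * (- (r - \<epsilon>) * e\<^sup>2)" by (simp add: algebra_simps)
    finally show "E (Suc K) t * dE K t \<le> - (r - \<epsilon>) * (E (Suc K) t)\<^sup>2" unfolding e_def by simp
  qed (use \<eta> \<epsilon> in simp_all)
  \<comment> \<open>Beyond b the ratio K / T leaves the neighbourhood of \<kappa>; from there only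
    the weaker invariance of the window is used.\<close>
  have "0 < X (Suc K) T \<and> \<bar>E (Suc K) T\<bar> \<le> \<eta>"
  proof (rule window_invariant[OF c \<phi> \<eta> _ T])
    show "0 < X (Suc K) b" using xf[OF a(2) order_refl] \<omega>(2) by simp
    show "4 / (1 - 4 * \<phi>) / b \<le> (1 - 4 * \<phi> - 4 * \<eta>) * \<eta> / 4"
      using Ct[OF a(2)] C(2) by linarith
  qed (use a tracking Eb in auto)
  moreover have "tracking \<eta> K T" using tracking T a(2) by simp
  ultimately show ?thesis unfolding tracking_def by (auto simp: le_Suc_eq)
qed

text \<open>The induction follows a moving boundary \<open>t K\<close> that advances by at least \<open>g\<close> in each step, where
  \<open>ln l / r < g < cs\<close>. Since \<open>g < cs - \<xi>\<close>, it ends up below the line \<open>(cs - \<xi>) * K\<close>.\<close>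

lemma eventually_tracking_extend:
  assumes cs: "8 < cs" and H: "\<And>c \<eta>. cs < c \<Longrightarrow> 0 < \<eta> \<Longrightarrow> eventually_tracking \<eta> c"
  shows "\<exists>\<xi> \<eta>. 0 < \<xi> \<and> 8 < cs - \<xi> \<and> 0 < \<eta> \<and> fstar (1 / (cs - \<xi>)) + \<eta> < 1 / 4 \<and> eventually_tracking \<eta> (cs - \<xi>)"
proof -
  define \<kappa> where "\<kappa> = 1 / cs"
  have \<kappa>: "0 < \<kappa>" "\<kappa> < 1 / 8" unfolding \<kappa>_def using cs by (auto simp: field_simps)
  define f where "f = fstar \<kappa>"
  have f: "0 < f" "f < 1 / 4" using fstar_bounds(1)[of \<kappa>] fstar_less[of \<kappa>] \<kappa> unfolding f_def by auto
  obtain l v where lv: "1 < l" "0 < v" "l + 1 / l = (1 - 2 * f) / f" "(1 - 2 * f) - 2 * f / l = v"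
      "ln l < (1 - f) * v / 3 / \<kappa>"
    using hyperbolic_multiplier[OF \<kappa>] unfolding f_def by blast
  define r where "r = (1 - f) * v / 3"
  have r: "r > 0" unfolding r_def using f lv by simp
  have "ln l / r < cs"
    using lv(5) r unfolding r_def[symmetric] \<kappa>_def by (simp add: pos_divide_less_eq mult.commute)
  from dense[OF this] obtain g where g: "ln l / r < g" "g < cs" by blast
  have "0 \<le> ln l / r" using lv r by simp
  then have g0: "0 < g" using g(1) by linarith
  have "l * exp (- r * g) < 1"
  proof -
    have "ln l < r * g" using g(1) r by (simp add: pos_divide_less_eq mult.commute)
    then have "exp (ln l) < exp (r * g)" by simp
    then show ?thesis using lv(1) by (simp add: exp_minus field_simps)
  qed
  moreover have "((\<lambda>\<epsilon>. l * (1 + \<epsilon>) * exp (- (r - \<epsilon>) * g)) \<longlongrightarrow> l * (1 + 0) * exp (- (r - 0) * g)) (at_right 0)"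
    by (intro tendsto_intros)
  ultimately have "\<forall>\<^sub>F \<epsilon> in at_right 0. l * (1 + \<epsilon>) * exp (- (r - \<epsilon>) * g) < 1"
    by (intro order_tendstoD(2)) auto
  moreover have "\<forall>\<^sub>F \<epsilon> in at_right 0. \<epsilon> < r" using r by (rule eventually_at_right_real[THEN eventually_mono]) auto
  moreover have "\<forall>\<^sub>F \<epsilon> in at_right (0::real). 0 < \<epsilon>" by (rule eventually_at_right_less)
  ultimately have "\<forall>\<^sub>F \<epsilon> in at_right 0. l * (1 + \<epsilon>) * exp (- (r - \<epsilon>) * g) < 1 \<and> \<epsilon> < r \<and> 0 < \<epsilon>"
    by eventually_elim auto
  from eventually_happens'[OF trivial_limit_at_right_real this]
  obtain \<epsilon> where \<epsilon>: "l * (1 + \<epsilon>) * exp (- (r - \<epsilon>) * g) < 1" "\<epsilon> < r" "0 < \<epsilon>"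
    by blast
  obtain J0 where J0: "(1 / l) ^ J0 < \<epsilon> / 4" using real_arch_pow_inv[of "\<epsilon> / 4" "1 / l"] lv \<epsilon> by auto
  define J where "J = Suc J0"
  have J: "2 / l ^ J \<le> \<epsilon> / 2"
  proof -
    have "(1 / l) ^ J \<le> (1 / l) ^ J0" unfolding J_def using lv(1) by (intro power_decreasing) auto
    then have "(1 / l) ^ J \<le> \<epsilon> / 4" using J0 by linarith
    then show ?thesis by (simp add: power_one_over)
  qed
  define \<zeta> where "\<zeta> = min (\<epsilon>) ((l - 1) * \<epsilon> / 4)"
  have \<zeta>: "0 < \<zeta>" unfolding \<zeta>_def using lv \<epsilon> by simp
  have \<zeta>2: "2 * \<zeta> / (l - 1) \<le> \<epsilon> / 2" "\<zeta> \<le> \<epsilon>"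
  proof -
    have "\<zeta> \<le> (l - 1) * \<epsilon> / 4" unfolding \<zeta>_def by (rule min.cobounded2)
    then have "2 * \<zeta> \<le> (\<epsilon> / 2) * (l - 1)" by (simp add: mult.commute)
    then show "2 * \<zeta> / (l - 1) \<le> \<epsilon> / 2" using lv(1) by (simp add: pos_divide_le_eq)
    show "\<zeta> \<le> \<epsilon>" unfolding \<zeta>_def by simp
  qed
  have r3: "(1 - f) * v = 3 * r" unfolding r_def by simp
  obtain \<omega> where \<omega>: "0 < \<omega>" "\<omega> < f" and loc': "\<And>x F. \<bar>x - f\<bar> \<le> \<omega> \<Longrightarrow> \<bar>F - f\<bar> \<le> \<omega> \<Longrightarrow>
      \<bar>(1 - 2 * F) / x - (l + 1 / l)\<bar> \<le> \<zeta> \<and> \<bar>(1 - x) * ((1 - 2 * F) - 2 * x / l) - 3 * r\<bar> \<le> \<zeta>"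
    using local_constants[OF f(1) \<zeta>, of l] unfolding lv(3,4) r3 by blast
  have loc: "\<bar>(1 - 2 * F) / x - (l + 1 / l)\<bar> \<le> \<zeta> \<and> 3 * r - \<epsilon> \<le> (1 - x) * ((1 - 2 * F) - 2 * x / l)"
    if "\<bar>x - f\<bar> \<le> \<omega>" "\<bar>F - f\<bar> \<le> \<omega>" for x F
    using loc'[OF that] \<zeta>2(2) by linarith
  have "isCont fstar \<kappa>" using DERIV_isCont[OF fstar_deriv[OF \<kappa>(2)]] .
  then obtain \<delta> where \<delta>: "\<delta> > 0" "\<And>\<kappa>'. \<bar>\<kappa>' - \<kappa>\<bar> < \<delta> \<Longrightarrow> \<bar>fstar \<kappa>' - f\<bar> < \<omega> / 2"
    using \<omega>(1) unfolding continuous_at_eps_delta f_def dist_real_def by (metis half_gt_zero)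
  have "((\<lambda>\<xi>. 1 / (cs - \<xi>)) \<longlongrightarrow> 1 / (cs - 0)) (at_right 0)" "((\<lambda>\<xi>. 1 / (cs + \<xi>)) \<longlongrightarrow> 1 / (cs + 0)) (at_right 0)"
    using cs by (intro tendsto_intros; simp)+
  then have "\<forall>\<^sub>F \<xi> in at_right 0. 1 / (cs - \<xi>) < \<kappa> + \<delta>" "\<forall>\<^sub>F \<xi> in at_right 0. \<kappa> - \<delta> < 1 / (cs + \<xi>)"
    using \<delta>(1) unfolding \<kappa>_def by (auto intro: order_tendstoD)
  moreover have "\<forall>\<^sub>F \<xi> in at_right 0. \<xi> < min ((cs - 8) / 4) (cs - g)"
    using cs g(2) by (intro order_tendstoD(2)[OF tendsto_ident_at]) auto
  ultimately have "\<forall>\<^sub>F \<xi> in at_right 0. 1 / (cs - \<xi>) < \<kappa> + \<delta> \<and> \<kappa> - \<delta> < 1 / (cs + \<xi>) \<and> \<xi> < min ((cs - 8) / 4) (cs - g) \<and> 0 < \<xi>"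
    using eventually_at_right_less[of "0::real"] by eventually_elim auto
  from eventually_happens'[OF trivial_limit_at_right_real this]
  obtain \<xi> where \<xi>: "1 / (cs - \<xi>) < \<kappa> + \<delta>" "\<kappa> - \<delta> < 1 / (cs + \<xi>)" "\<xi> < (cs - 8) / 4" "\<xi> < cs - g" "0 < \<xi>"
    by auto
  \<comment> \<open>A fixed constant below all lines in play: the tolerance \<eta> and the error
    constants depend on c and not on K.\<close>
  define c where "c = 8 + (cs - 8) / 2"
  have c: "8 < c" "c < cs - \<xi>" unfolding c_def using cs \<xi> by argo+
  define \<phi> where "\<phi> = fstar (1 / c)"
  have \<phi>: "\<phi> < 1 / 4" unfolding \<phi>_def using c by (intro fstar_less) (simp add: field_simps)
  have \<phi>': "fstar (1 / (cs - \<xi>)) \<le> \<phi>" unfolding \<phi>_def using c by (intro fstar_mono) (simp add: field_simps)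
  define \<eta> where "\<eta> = min ((1 / 4 - \<phi>) / 4) (\<omega> / (2 * (l * (1 + \<epsilon>))))"
  have le: "1 < l * (1 + \<epsilon>)" using lv(1) \<epsilon>(3) by (simp add: less_1_mult)
  have \<eta>: "0 < \<eta>" "\<phi> + 2 * \<eta> < 1 / 4" "l * (1 + \<epsilon>) * \<eta> \<le> \<omega> / 2"
  proof -
    show "0 < \<eta>" unfolding \<eta>_def using \<phi> \<omega> le by simp
    have "\<eta> \<le> (1 / 4 - \<phi>) / 4" unfolding \<eta>_def by (rule min.cobounded1)
    then show "\<phi> + 2 * \<eta> < 1 / 4" using \<phi> by argo
    have "\<eta> \<le> \<omega> / (2 * (l * (1 + \<epsilon>)))" unfolding \<eta>_def by (rule min.cobounded2)
    moreover have "P * z \<le> w / 2" if "z \<le> w / (2 * P)" "1 < P" for P z w :: real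
      using that by (simp add: pos_le_divide_eq mult_ac)
    ultimately show "l * (1 + \<epsilon>) * \<eta> \<le> \<omega> / 2" using le by blast
  qed
  define C where "C = 4 / (1 - 4 * \<phi>)"
  have C: "C > 0" unfolding C_def using \<phi> by simp
  define s where "s = 1 - 4 * \<phi> - 4 * \<eta>"
  have s: "s > 0" unfolding s_def using \<eta> by simp
  define T0 where "T0 = max (C / (\<zeta> * \<eta>)) (4 * C / (s * \<eta>))"
  obtain K0 where K0: "\<And>k T. k \<ge> K0 \<Longrightarrow> T \<ge> (cs + \<xi>) * real k \<Longrightarrow> tracking \<eta> k T"
    using H[of "cs + \<xi>" \<eta>] \<xi> \<eta> unfolding eventually_tracking_def by auto
  \<comment> \<open>For large K every k / \<tau> with K - J \<le> k \<le> Suc K and \<tau> from (cs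
    - \<xi>) K to (cs + \<xi>) (K + 1) lies within \<delta> of \<kappa>.\<close>
  have "(\<lambda>K. (real K + 1) / ((cs - \<xi>) * real K)) \<longlonglongrightarrow> inverse (cs - \<xi>)" using c by real_asymp
  then have ev1: "\<forall>\<^sub>F K in sequentially. (real K + 1) / ((cs - \<xi>) * real K) < \<kappa> + \<delta>" using \<xi>(1) unfolding inverse_eq_divide by (rule order_tendstoD)
  have "(\<lambda>K. (real K - real J) / ((cs + \<xi>) * (real K + 1))) \<longlonglongrightarrow> inverse (cs + \<xi>)" using cs \<xi> by real_asymp
  then have ev2: "\<forall>\<^sub>F K in sequentially. \<kappa> - \<delta> < (real K - real J) / ((cs + \<xi>) * (real K + 1))" using \<xi>(2) unfolding inverse_eq_divide by (rule order_tendstoD)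
  have ev3: "\<forall>\<^sub>F K in sequentially. c * (real K + 1) \<le> (cs - \<xi>) * real K" using c by real_asymp
  have ev4: "\<forall>\<^sub>F K in sequentially. T0 \<le> (cs - \<xi>) * real K" using c by real_asymp
  have ev5: "\<forall>\<^sub>F K in sequentially. K \<ge> max K0 (Suc J)" by (rule eventually_ge_at_top)
  from ev1 ev2 ev3 ev4 ev5 have "\<forall>\<^sub>F K in sequentially. (real K + 1) / ((cs - \<xi>) * real K) < \<kappa> + \<delta> \<and>
      \<kappa> - \<delta> < (real K - real J) / ((cs + \<xi>) * (real K + 1)) \<and> c * (real K + 1) \<le> (cs - \<xi>) * real K \<and>
      T0 \<le> (cs - \<xi>) * real K \<and> K \<ge> max K0 (Suc J)" by eventually_elim auto
  then obtain K1 where K1: "\<And>K. K \<ge> K1 \<Longrightarrow> (real K + 1) / ((cs - \<xi>) * real K) < \<kappa> + \<delta> \<and>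
      \<kappa> - \<delta> < (real K - real J) / ((cs + \<xi>) * (real K + 1)) \<and> c * (real K + 1) \<le> (cs - \<xi>) * real K \<and>
      T0 \<le> (cs - \<xi>) * real K \<and> K \<ge> max K0 (Suc J)"
    unfolding eventually_sequentially by blast
  \<comment> \<open>The second branch starts where H gives tracking; the first one keeps k / \<tau>
    near \<kappa> and eventually dominates, as g < cs - \<xi>.\<close>
  define t where "t K = max ((cs - \<xi>) * real K) ((cs + \<xi>) * real K1 + g * (real K - real K1))" for K
  have main: "\<forall>T\<ge>t K. tracking \<eta> K T" if "K \<ge> K1" for K
    using that
  proof (induction K rule: dec_induct)
    case base
    have "K1 \<ge> K0" using K1[of K1] by simp
    then show ?case using K0 unfolding t_def by auto
  next
    case (step K)
    note K = K1[OF step(1)]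
    have KK1: "real K1 \<le> real K" using step by simp
    have \<alpha>\<beta>: "g < cs - \<xi>" "cs - \<xi> < cs + \<xi>" "0 < cs - \<xi>" using \<xi> g0 by auto
    have K0': "K \<ge> Suc J" using K by simp
    have tK: "(cs - \<xi>) * real K \<le> t K" "t K + g \<le> t (Suc K)" "t (Suc K) \<le> (cs + \<xi>) * (real K + 1)"
    proof -
      show "(cs - \<xi>) * real K \<le> t K" unfolding t_def by simp
      show "t K + g \<le> t (Suc K)" unfolding t_def using \<alpha>\<beta> by (simp add: algebra_simps max_def)
      have "(cs - \<xi>) * (real K + 1) \<le> (cs + \<xi>) * (real K + 1)" using \<alpha>\<beta> by (intro mult_right_mono) auto
      moreover have "g * (real K + 1 - real K1) \<le> (cs + \<xi>) * (real K + 1 - real K1)"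
        using \<alpha>\<beta> KK1 by (intro mult_right_mono) auto
      then have "(cs + \<xi>) * real K1 + g * (real K + 1 - real K1) \<le> (cs + \<xi>) * (real K + 1)"
        by (simp add: algebra_simps)
      ultimately show "t (Suc K) \<le> (cs + \<xi>) * (real K + 1)" unfolding t_def by (simp add: add.commute)
    qed
    have Kc: "c * (real K + 1) \<le> (cs - \<xi>) * real K" "T0 \<le> (cs - \<xi>) * real K" using K by auto
    have T0pos: "T0 > 0" unfolding T0_def using C \<zeta> \<eta> by (simp add: less_max_iff_disj)
    have \<tau>: "\<tau> \<ge> c * real (Suc K)" "\<tau> \<ge> T0" "\<tau> > 0" if "\<tau> \<ge> t K" for \<tau>
      using that tK Kc T0pos by (auto simp: add.commute)
    have CT: "C / \<tau> \<le> \<zeta> * \<eta>" "C / \<tau> \<le> s * \<eta> / 4" if "\<tau> \<ge> t K" for \<tau>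
    proof -
      have "C / (\<zeta> * \<eta>) \<le> \<tau>" "4 * C / (s * \<eta>) \<le> \<tau>" using \<tau>[OF that] unfolding T0_def by auto
      then show "C / \<tau> \<le> \<zeta> * \<eta>" "C / \<tau> \<le> s * \<eta> / 4"
        using \<tau>(3)[OF that] \<zeta> \<eta>(1) s by (auto simp: pos_divide_le_eq mult_ac)
    qed
    have F: "\<bar>fstar (real k / \<tau>) - f\<bar> \<le> \<omega> / 2" if "t K \<le> \<tau>" "\<tau> \<le> t (Suc K)" "K - J \<le> k" "k \<le> Suc K" for k \<tau>
    proof -
      have kb: "real K - real J \<le> real k" "real k \<le> real K + 1" using that K0' by linarith+
      have \<tau>b: "(cs - \<xi>) * real K \<le> \<tau>" "\<tau> \<le> (cs + \<xi>) * (real K + 1)" using that tK by auto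
      have "0 < (cs - \<xi>) * real K" using \<alpha>\<beta> K0' by simp
      then have "real k / \<tau> \<le> (real K + 1) / ((cs - \<xi>) * real K)" using kb \<tau>b by (intro frac_le) auto
      moreover have "(real K - real J) / ((cs + \<xi>) * (real K + 1)) \<le> real k / \<tau>"
        using kb \<tau>b \<tau>(3)[OF that(1)] K0' by (intro frac_le) auto
      ultimately have "\<bar>real k / \<tau> - \<kappa>\<bar> < \<delta>" using K by linarith
      then show ?thesis using \<delta>(2) by force
    qed
    have tle: "t K \<le> t (Suc K)" using tK g0 by simp
    show ?case
    proof (intro allI impI, rule extend_step[OF c(1) \<phi>_def[symmetric] \<eta>(2,1) lv(1) \<epsilon>(3,2) \<omega> f(2) \<eta>(3) loc _ _ J \<zeta> \<zeta>2(2,1) _ tle _ F])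
      show "1 \<le> J" "J \<le> K" unfolding J_def using K0' by (simp_all add: J_def)
      show "c * real (Suc K) \<le> t K" using \<tau>(1)[of "t K"] by simp
      have "l * (1 + \<epsilon>) * exp (- (r - \<epsilon>) * (t (Suc K) - t K)) \<le> l * (1 + \<epsilon>) * exp (- (r - \<epsilon>) * g)"
        using tK \<epsilon> le by (intro mult_left_mono) auto
      then show "l * (1 + \<epsilon>) * exp (- (r - \<epsilon>) * (t (Suc K) - t K)) \<le> 1" using \<epsilon>(1) by linarith
      show "4 / (1 - 4 * \<phi>) / t K \<le> \<zeta> * \<eta>" "4 / (1 - 4 * \<phi>) / t K \<le> (1 - 4 * \<phi> - 4 * \<eta>) * \<eta> / 4"
        using CT[of "t K"] unfolding C_def s_def by auto
    qed (use step.IH in auto)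
  qed
  have "eventually_tracking \<eta> (cs - \<xi>)"
    unfolding eventually_tracking_def
  proof (intro exI allI impI)
    fix k T assume k: "K1 + nat \<lceil>(cs + \<xi>) * real K1 / (cs - \<xi> - g)\<rceil> \<le> k" and T: "(cs - \<xi>) * real k \<le> T"
    have "real k \<ge> (cs + \<xi>) * real K1 / (cs - \<xi> - g)" using k by linarith
    then have "(cs + \<xi>) * real K1 \<le> (cs - \<xi> - g) * real k" using \<xi> by (simp add: pos_divide_le_eq mult.commute)
    moreover have "0 \<le> g * real K1" using g0 by simp
    ultimately have "t k \<le> T" unfolding t_def using T by (simp add: algebra_simps)
    then show "tracking \<eta> k T" using main[of k] k by simp
  qed
  then show ?thesis using \<xi> c \<phi>' \<eta> by (intro exI[of _ \<xi>] exI[of _ \<eta>]) auto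
qed

text \<open>The set S of good constants is upward closed and nonempty by the crude bounds. Were its
  infimum above 8, the extension would yield a smaller constant, though for one tolerance only;
  \<open>relax\<close> restores all tolerances at the price of half the gain \<xi>.\<close>

theorem eventually_tracking_all:
  assumes c: "8 < c" and \<eta>: "0 < \<eta>"
  shows "eventually_tracking \<eta> c"
proof -
  define S where "S = {c. 8 < c \<and> (\<forall>\<eta>>0. eventually_tracking \<eta> c)}"
  obtain c0 where c0: "c0 \<ge> 200" "\<And>j t. j \<ge> 1 \<Longrightarrow> t \<ge> c0 * real j \<Longrightarrow> real j / 2 \<le> t * X j t \<and> t * X j t \<le> 4 * real j"
    using crude_bounds by blast
  \<comment> \<open>With c0 \<ge> 200 the crude bounds give X \<le> 4 / 200 and fstar \<le> 2 / 200,
    so the deviation stays below 1 / 25.\<close>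
  have "eventually_tracking (1 / 25) c0"
    unfolding eventually_tracking_def
  proof (intro exI allI impI)
    fix k T assume T: "c0 * real k \<le> T"
    show "tracking (1 / 25) k T"
      unfolding tracking_def
    proof (intro allI impI)
      fix j assume j: "1 \<le> j" "j \<le> k"
      have "c0 * real j \<le> c0 * real k" using j c0(1) by simp
      then have Tj: "c0 * real j \<le> T" using T by linarith
      moreover have "c0 * real j > 0" using j c0(1) by simp
      ultimately have Tpos: "T > 0" by linarith
      have cr: "real j / 2 \<le> T * X j T" "T * X j T \<le> 4 * real j" using c0(2)[OF j(1) Tj] by auto
      have "0 < T * X j T" using cr(1) j by linarith
      then have X0: "0 < X j T" using Tpos by (simp add: zero_less_mult_iff)
      have r: "real j / T \<le> 1 / c0" using ratio_le[OF _ Tj Tpos] c0(1) by simp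
      have c0i: "1 / c0 \<le> 1 / 200" using c0(1) by (simp add: field_simps)
      have "X j T \<le> 4 * (real j / T)" using cr(2) Tpos by (simp add: field_simps)
      moreover have "0 \<le> fstar (real j / T)" using Tpos by (intro fstar_nonneg) simp
      moreover have "fstar (real j / T) \<le> 2 * (real j / T)"
        by (rule fstar_bounds(2)) (use Tpos order_trans[OF r c0i] in \<open>linarith | simp\<close>)+
      ultimately show "0 < X j T \<and> \<bar>E j T\<bar> \<le> 1 / 25" using X0 r c0i unfolding E_def by linarith
    qed
  qed
  moreover have "fstar (1 / c0) + 1 / 25 < 1 / 4"
  proof -
    have "1 / c0 \<le> 1 / 200" "0 \<le> 1 / c0" using c0(1) by (auto simp: field_simps)
    then have "fstar (1 / c0) \<le> 2 * (1 / c0)" by (intro fstar_bounds(2)) linarith+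
    then show ?thesis using \<open>1 / c0 \<le> 1 / 200\<close> by linarith
  qed
  ultimately have "eventually_tracking \<eta> (c0 + 1)" if "0 < \<eta>" for \<eta>
    by (intro relax[of c0 "1 / 25" \<eta> "c0 + 1"]) (use c0(1) that in simp_all)
  then have "c0 + 1 \<in> S" unfolding S_def using c0(1) by simp
  then have Sne: "S \<noteq> {}" by auto
  have Sbb: "bdd_below S" unfolding S_def by (intro bdd_belowI[of _ 8]) auto
  have Sup: "y \<in> S" if "x \<in> S" "x \<le> y" for x y
    using that eventually_tracking_mono[OF _ order_refl that(2)] unfolding S_def by simp
  have "Inf S \<le> 8"
  proof (rule ccontr)
    assume "\<not> Inf S \<le> 8"
    then have cs: "8 < Inf S" by simp
    have "eventually_tracking \<eta> c" if Sc: "Inf S < c" and e: "0 < \<eta>" for c \<eta>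
    proof -
      obtain x where "x \<in> S" "x < c" using cInf_lessD[OF Sne Sc] by auto
      then have "c \<in> S" using Sup[of x c] by simp
      then show ?thesis using e unfolding S_def by blast
    qed
    from eventually_tracking_extend[OF cs this] obtain \<xi> \<eta> where *: "0 < \<xi>" "8 < Inf S - \<xi>" "0 < \<eta>"
      "fstar (1 / (Inf S - \<xi>)) + \<eta> < 1 / 4" "eventually_tracking \<eta> (Inf S - \<xi>)" by blast
    have "eventually_tracking \<eta>' (Inf S - \<xi> / 2)" if "0 < \<eta>'" for \<eta>'
      by (rule relax[OF *(2,3,4,5) that]) (use *(1) in simp)
    moreover have "8 < Inf S - \<xi> / 2" using *(1,2) by linarith
    moreover have "c \<in> S" if "8 < c" "\<And>\<eta>. 0 < \<eta> \<Longrightarrow> eventually_tracking \<eta> c" for c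
      using that unfolding S_def by blast
    ultimately have "Inf S - \<xi> / 2 \<in> S" by blast
    then have "Inf S \<le> Inf S - \<xi> / 2" using Sbb by (rule cInf_lower)
    then show False using *(1) by simp
  qed
  then have "Inf S < c" using c by simp
  then obtain x where "x \<in> S" "x < c" using cInf_lessD[OF Sne] by auto
  then have "c \<in> S" using Sup[of x c] by simp
  then show ?thesis using \<eta> unfolding S_def by blast
qed

end

section \<open>Polynomials with zeros on a three-pointed star\<close>

fun star_poly :: "(nat \<Rightarrow> real) \<Rightarrow> nat \<Rightarrow> complex poly" where
  "star_poly a 0 = 1"
| "star_poly a (Suc 0) = [:0, 1:]"
| "star_poly a (Suc (Suc 0)) = [:0, 0, 1:]"
| "star_poly a (Suc (Suc (Suc k))) =
     pCons 0 (star_poly a (Suc (Suc k))) - smult (of_real (a (Suc (Suc k)))) (star_poly a k)"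

lemma star_poly_monic: "degree (star_poly a k) = k \<and> lead_coeff (star_poly a k) = 1"
proof (induction k rule: less_induct)
  case (less k)
  consider "k = 0" | "k = Suc 0" | "k = Suc (Suc 0)" | m where "k = Suc (Suc (Suc m))"
    by (cases k; cases "k - 1"; cases "k - 2") auto
  then show ?case
  proof cases
    case 4
    define p q where "p = star_poly a (Suc (Suc m))" and "q = smult (of_real (a (Suc (Suc m)))) (star_poly a m)"
    have p: "degree p = Suc (Suc m)" "lead_coeff p = 1" using less.IH[of "Suc (Suc m)"] 4 unfolding p_def by auto
    have p0: "p \<noteq> 0" using p by auto
    have "degree q \<le> m" using less.IH[of m] 4 degree_smult_le[of _ "star_poly a m"] unfolding q_def by auto
    then have dq: "degree q < degree (pCons 0 p)" using p p0 by simp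
    have e: "star_poly a k = pCons 0 p - q" using 4 unfolding p_def q_def by simp
    have "degree (pCons 0 p - q) = degree (pCons 0 p)"
      using degree_add_eq_left[of "- q" "pCons 0 p"] dq by simp
    moreover have "coeff q (degree (pCons 0 p)) = 0" using dq by (rule coeff_eq_0)
    ultimately show ?thesis unfolding e using p p0 4 by simp
  qed (auto simp: numeral_2_eq_2)
qed

lemma star_poly_rotate:
  assumes "w ^ 3 = 1" shows "poly (star_poly a k) (w * z) = w ^ k * poly (star_poly a k) z"
proof (induction k rule: star_poly.induct[of _ a])
  case (4 a k)
  have e: "w ^ Suc (Suc (Suc k)) = w ^ k" using assms by (simp add: eval_nat_numeral mult.assoc[symmetric])
  have "poly (star_poly a (Suc (Suc (Suc k)))) (w * z)
      = w ^ Suc (Suc (Suc k)) * (z * poly (star_poly a (Suc (Suc k))) z) - of_real (a (Suc (Suc k))) * (w ^ k * poly (star_poly a k) z)"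
    using 4 by simp
  also have "\<dots> = w ^ Suc (Suc (Suc k)) * poly (star_poly a (Suc (Suc (Suc k)))) z"
    unfolding e by (simp add: algebra_simps)
  finally show ?case .
qed (auto simp: power2_eq_square)

lemma star_poly_cnj: "poly (star_poly a k) (cnj z) = cnj (poly (star_poly a k) z)"
  by (induction k rule: star_poly.induct[of _ a]) auto

text \<open>Rotating by - \<phi> puts the first direction on the positive axis; the sign of Im (w *
  cis (- b)) then excludes an argument beyond b. The opening below pi prevents cancellation.\<close>

lemma cis_sum:
  assumes "0 < r" "0 \<le> s" "\<phi> \<le> \<beta>" "\<beta> < \<phi> + pi"
  obtains \<rho> \<alpha> where "0 < \<rho>" "\<phi> \<le> \<alpha>" "\<alpha> \<le> \<beta>" "of_real r * cis \<phi> + of_real s * cis \<beta> = of_real \<rho> * cis \<alpha>"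
proof -
  define b where "b = \<beta> - \<phi>"
  have b: "0 \<le> b" "b < pi" unfolding b_def using assms by auto
  define w where "w = of_real r + of_real s * cis b"
  have sb: "sin b \<ge> 0" using b by (intro sin_ge_zero) auto
  have Im: "Im w \<ge> 0" unfolding w_def using sb assms by simp
  have w0: "w \<noteq> 0"
  proof
    assume "w = 0"
    then have i: "s * sin b = 0" "r + s * cos b = 0" unfolding w_def by (auto simp: complex_eq_iff)
    show False
    proof (cases "s = 0 \<or> b = 0")
      case True
      then show ?thesis using i assms by auto
    next
      case False
      then have "sin b > 0" using b by (intro sin_gt_zero) auto
      then show ?thesis using i False by auto
    qed
  qed
  define \<alpha> where "\<alpha> = Arg w"
  have wa: "w = of_real (cmod w) * cis \<alpha>" unfolding \<alpha>_def using rcis_cmod_Arg[of w] unfolding rcis_def by simp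
  have a: "0 \<le> \<alpha>" "\<alpha> \<le> pi" unfolding \<alpha>_def using Im Arg_less_0[of w] Arg_le_pi[of w] by auto
  have "\<alpha> \<le> b"
  proof (rule ccontr)
    assume "\<not> \<alpha> \<le> b"
    then have "b < \<alpha>" by simp
    have e: "w * cis (- b) = of_real (cmod w) * cis (\<alpha> - b)"
      by (subst wa) (simp add: cis_mult)
    have "Im (w * cis (- b)) = - r * sin b"
      unfolding w_def by (simp add: algebra_simps cis_mult)
    then have "cmod w * sin (\<alpha> - b) = - r * sin b" unfolding e by simp
    then have "cmod w * sin (\<alpha> - b) \<le> 0" using sb assms by simp
    moreover have "cmod w > 0" using w0 by simp
    ultimately have "sin (\<alpha> - b) \<le> 0" by (simp add: mult_le_0_iff)
    then have "\<not> \<alpha> - b < pi" using sin_gt_zero[of "\<alpha> - b"] \<open>b < \<alpha>\<close> by auto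
    then have "\<alpha> = pi" "b = 0" using a b by auto
    then have "w = of_real (r + s)" unfolding w_def by simp
    then have "\<alpha> = 0" unfolding \<alpha>_def using assms Arg_of_real[of "r + s"] by simp
    then show False using \<open>\<alpha> = pi\<close> by simp
  qed
  have "of_real r * cis \<phi> + of_real s * cis \<beta> = w * cis \<phi>"
    unfolding w_def b_def by (simp add: algebra_simps cis_mult)
  also have "\<dots> = of_real (cmod w) * cis (\<alpha> + \<phi>)" by (subst wa) (simp add: cis_mult)
  finally show ?thesis using that[of "cmod w" "\<alpha> + \<phi>"] w0 a \<open>\<alpha> \<le> b\<close> unfolding b_def by auto
qed

text \<open>The invariant bounds the arguments of the ratios of consecutive polynomials. It survives the
  recurrence because the new ratio has its argument between \<open>\<phi>\<close> and \<open>pi - \<alpha> - \<alpha>'\<close>.\<close>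

lemma star_poly_nonzero_sector:
  assumes a: "\<And>k. 2 \<le> k \<Longrightarrow> k < n \<Longrightarrow> 0 < a k" and r: "0 < r" and \<phi>: "0 < \<phi>" "\<phi> \<le> pi / 3"
  shows "poly (star_poly a n) (of_real r * cis \<phi>) \<noteq> 0"
proof -
  define z where "z = of_real r * cis \<phi>"
  define p where "p k = poly (star_poly a k) z" for k
  \<comment> \<open>The maximum with 2 admits the base case for every n; the induction step needs
    \<open>a\<close> only at indices below n.\<close>
  have "p k \<noteq> 0 \<and> (\<exists>\<rho> \<rho>' \<alpha> \<alpha>'. 0 < \<rho> \<and> 0 < \<rho>' \<and> \<phi> \<le> \<alpha> \<and> \<phi> \<le> \<alpha>' \<and> \<alpha> + \<alpha>' \<le> pi - \<phi>
      \<and> p (Suc k) = of_real \<rho> * cis \<alpha> * p k \<and> p (Suc (Suc k)) = of_real \<rho>' * cis \<alpha>' * p (Suc k))" if "k + 2 \<le> max n 2" for k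
    using that
  proof (induction k)
    case 0
    show ?case
    proof (intro conjI exI)
      show "p (Suc 0) = of_real r * cis \<phi> * p 0" "p (Suc (Suc 0)) = of_real r * cis \<phi> * p (Suc 0)"
        unfolding p_def z_def by auto
    qed (use r \<phi> in \<open>auto simp: p_def\<close>)
  next
    case (Suc k)
    then have "k + 2 \<le> max n 2" by simp
    from Suc.IH[OF this] obtain \<rho> \<rho>' \<alpha> \<alpha>' where IH: "0 < \<rho>" "0 < \<rho>'" "\<phi> \<le> \<alpha>" "\<phi> \<le> \<alpha>'" "\<alpha> + \<alpha>' \<le> pi - \<phi>"
      "p (Suc k) = of_real \<rho> * cis \<alpha> * p k" "p (Suc (Suc k)) = of_real \<rho>' * cis \<alpha>' * p (Suc k)" "p k \<noteq> 0" by blast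
    have n: "Suc (Suc k) < n" using Suc.prems by auto
    \<comment> \<open>By the two known ratios, - a p k / p (k + 2) has modulus s, and the minus sign
      turns its argument into pi - \<alpha> - \<alpha>'.\<close>
    define s where "s = a (Suc (Suc k)) / (\<rho> * \<rho>')"
    have s: "s > 0" unfolding s_def using a[of "Suc (Suc k)"] n IH by simp
    obtain \<rho>'' \<alpha>'' where new: "0 < \<rho>''" "\<phi> \<le> \<alpha>''" "\<alpha>'' \<le> pi - \<alpha> - \<alpha>'"
      "of_real r * cis \<phi> + of_real s * cis (pi - \<alpha> - \<alpha>') = of_real \<rho>'' * cis \<alpha>''"
      using cis_sum[of r s \<phi> "pi - \<alpha> - \<alpha>'"] r s IH \<phi> by auto
    have "of_real (a (Suc (Suc k))) * p k = - (of_real s * cis (pi - \<alpha> - \<alpha>')) * p (Suc (Suc k))"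
    proof -
      have c: "cis (pi - \<alpha> - \<alpha>') * (cis \<alpha>' * cis \<alpha>) = - 1" by (simp add: cis_mult)
      have "- (of_real s * cis (pi - \<alpha> - \<alpha>')) * p (Suc (Suc k))
          = - (cis (pi - \<alpha> - \<alpha>') * (cis \<alpha>' * cis \<alpha>)) * (of_real (s * \<rho> * \<rho>') * p k)"
        unfolding IH(7) IH(6) by (simp add: mult_ac)
      also have "\<dots> = of_real (s * \<rho> * \<rho>') * p k" unfolding c by simp
      finally have "- (of_real s * cis (pi - \<alpha> - \<alpha>')) * p (Suc (Suc k)) = of_real (s * \<rho> * \<rho>') * p k" .
      moreover have "s * \<rho> * \<rho>' = a (Suc (Suc k))" unfolding s_def using IH by simp
      ultimately show ?thesis by metis
    qed
    moreover have "p (Suc (Suc (Suc k))) = z * p (Suc (Suc k)) - of_real (a (Suc (Suc k))) * p k"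
      unfolding p_def by simp
    ultimately have "p (Suc (Suc (Suc k))) = of_real \<rho>'' * cis \<alpha>'' * p (Suc (Suc k))"
      unfolding new(4)[symmetric] z_def by (simp add: algebra_simps)
    moreover have "p (Suc k) \<noteq> 0" using IH by simp
    moreover have "\<alpha>' + \<alpha>'' \<le> pi - \<phi>" using new IH by linarith
    ultimately show ?case using IH new by blast
  qed
  note main = this
  show ?thesis
  proof (cases "n < 2")
    case True
    then consider "n = 0" | "n = Suc 0" by linarith
    then show ?thesis using r by cases auto
  next
    case False
    then obtain k where k: "n = Suc (Suc k)" by (metis add_2_eq_Suc le_Suc_ex not_less)
    from main[of k] k obtain \<rho> \<rho>' \<alpha> \<alpha>' where "p k \<noteq> 0" "0 < \<rho>" "0 < \<rho>'"
      "p (Suc k) = of_real \<rho> * cis \<alpha> * p k" "p (Suc (Suc k)) = of_real \<rho>' * cis \<alpha>' * p (Suc k)" by auto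
    then show ?thesis unfolding k z_def[symmetric] p_def[symmetric] by simp
  qed
qed

text \<open>The ratios of consecutive values stay at least 2 x / 3: the next one is at least x - A
  (3 / (2 x))^2, and A \<le> 4 x^3 / 27 makes this 2 x / 3 again. The number 4 x^3 / 27 is the
  maximum of \<lambda>^2 (x - \<lambda>), attained at \<lambda> = 2 x / 3, which is the origin of 27
  / 4.\<close>

lemma star_poly_positive:
  fixes x :: real
  assumes a: "\<And>k. 2 \<le> k \<Longrightarrow> k < n \<Longrightarrow> 0 \<le> a k \<and> a k \<le> A" and x: "0 < x" "27 / 4 * A < x ^ 3" and A: "0 \<le> A"
  shows "poly (star_poly a n) (of_real x) \<noteq> 0"
proof -
  define p where "p k = Re (poly (star_poly a k) (of_real x))" for k
  have real: "poly (star_poly a k) (of_real x) = of_real (p k)" for k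
  proof -
    have "poly (star_poly a k) (of_real x) = cnj (poly (star_poly a k) (of_real x))"
      using star_poly_cnj[of a k "of_real x"] by simp
    then show ?thesis unfolding p_def by (metis Reals_cnj_iff of_real_Re)
  qed
  have p0: "p 0 = 1" "p (Suc 0) = x" "p (Suc (Suc 0)) = x * x" unfolding p_def by auto
  have prec: "p (Suc (Suc (Suc k))) = x * p (Suc (Suc k)) - a (Suc (Suc k)) * p k" for k
    unfolding p_def by simp
  have "0 < p k \<and> 2 * x / 3 * p k \<le> p (Suc k) \<and> 2 * x / 3 * p (Suc k) \<le> p (Suc (Suc k))" if "k + 2 \<le> max n 2" for k
    using that
  proof (induction k)
    case 0
    then show ?case unfolding p0 using x by (simp add: mult_mono)
  next
    case (Suc k)
    then have IH: "0 < p k" "2 * x / 3 * p k \<le> p (Suc k)" "2 * x / 3 * p (Suc k) \<le> p (Suc (Suc k))" by auto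
    have n: "Suc (Suc k) < n" using Suc.prems by auto
    have l: "0 < 2 * x / 3" using x by simp
    have p1: "0 < p (Suc k)" using mult_pos_pos[OF l IH(1)] IH(2) by linarith
    have "(2 * x / 3) * (2 * x / 3 * p k) \<le> (2 * x / 3) * p (Suc k)" using IH(2) l by (intro mult_left_mono) auto
    then have q: "(4 * x\<^sup>2 / 9) * p k \<le> p (Suc (Suc k))" using IH(3) by (simp add: power2_eq_square field_simps)
    have "a (Suc (Suc k)) * p k \<le> A * p k" using a[of "Suc (Suc k)"] n IH by (intro mult_right_mono) auto
    also have "A * p k \<le> (4 / 27 * x ^ 3) * p k" using x IH by (intro mult_right_mono) auto
    also have "\<dots> = (x / 3) * ((4 * x\<^sup>2 / 9) * p k)" by (simp add: power2_eq_square power3_eq_cube)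
    also have "\<dots> \<le> (x / 3) * p (Suc (Suc k))" using q x by (intro mult_left_mono) auto
    finally have "2 * x / 3 * p (Suc (Suc k)) \<le> p (Suc (Suc (Suc k)))" unfolding prec by (simp add: field_simps)
    then show ?case using IH p1 by simp
  qed
  note main = this
  have "p n \<noteq> 0"
  proof (cases "n < 2")
    case True
    then consider "n = 0" | "n = Suc 0" by linarith
    then show ?thesis using x p0 by cases auto
  next
    case False
    then obtain k where k: "n = Suc (Suc k)" by (metis add_2_eq_Suc le_Suc_ex not_less)
    have l: "0 < 2 * x / 3" using x by simp
    from main[of k] k have *: "0 < p k" "2 * x / 3 * p k \<le> p (Suc k)" "2 * x / 3 * p (Suc k) \<le> p (Suc (Suc k))" by auto
    have "0 < p (Suc k)" using mult_pos_pos[OF l *(1)] *(2) by linarith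
    then show ?thesis unfolding k using mult_pos_pos[OF l] *(3) by fastforce
  qed
  then show ?thesis unfolding real by simp
qed

text \<open>A rotation by a cube root of unity moves a zero to an argument of modulus at most pi /
  3, and conjugation makes it nonnegative. The sector result leaves only the positive axis.\<close>

theorem star_poly_zeros:
  assumes a: "\<And>k. 2 \<le> k \<Longrightarrow> k < n \<Longrightarrow> 0 < a k \<and> a k \<le> A" and A: "0 \<le> A" and z: "poly (star_poly a n) z = 0"
  shows "\<exists>s. 0 \<le> s \<and> s \<le> 27 / 4 * A \<and> z ^ 3 = of_real s"
proof (cases "z = 0")
  case True
  then show ?thesis using A by (intro exI[of _ 0]) auto
next
  case False
  define \<theta> where "\<theta> = Arg (z ^ 3)"
  define y where "y = of_real (cmod z) * cis (\<theta> / 3)"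
  have z3: "z ^ 3 = of_real (cmod z ^ 3) * cis \<theta>"
    using rcis_cmod_Arg[of "z ^ 3"] unfolding \<theta>_def rcis_def by (simp add: norm_power)
  have "y ^ 3 = z ^ 3" unfolding y_def z3 using Complex.DeMoivre[of "\<theta> / 3" 3] by (simp add: power_mult_distrib)
  moreover have y0: "y \<noteq> 0" unfolding y_def using False by simp
  ultimately have w: "(z / y) ^ 3 = 1" using False by (simp add: power_divide)
  have "poly (star_poly a n) y = 0"
    using star_poly_rotate[OF w, of a n y] z y0 False by simp
  have "\<theta> = 0"
  proof (rule ccontr)
    assume "\<theta> \<noteq> 0"
    have b: "- pi < \<theta>" "\<theta> \<le> pi" unfolding \<theta>_def using Arg_bounded[of "z ^ 3"] by auto
    have "poly (star_poly a n) (of_real (cmod z) * cis \<bar>\<theta> / 3\<bar>) \<noteq> 0"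
      using a False b \<open>\<theta> \<noteq> 0\<close> by (intro star_poly_nonzero_sector) auto
    moreover have "of_real (cmod z) * cis \<bar>\<theta> / 3\<bar> = y \<or> of_real (cmod z) * cis \<bar>\<theta> / 3\<bar> = cnj y"
      unfolding y_def by (cases "\<theta> \<ge> 0") (auto simp: cis_cnj)
    ultimately show False using \<open>poly (star_poly a n) y = 0\<close> star_poly_cnj[of a n y] by auto
  qed
  then have "y = of_real (cmod z)" unfolding y_def by simp
  then have "\<not> 27 / 4 * A < cmod z ^ 3"
    using star_poly_positive[of n a A "cmod z"] a A False \<open>poly (star_poly a n) y = 0\<close> by fastforce
  then show ?thesis using z3 \<open>\<theta> = 0\<close> by (intro exI[of _ "cmod z ^ 3"]) auto
qed

section \<open>Orthogonality from the string equation\<close>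

lemma degree_less_sub:
  fixes p q :: "complex poly"
  assumes "degree p = k" "degree q = k" "lead_coeff p = lead_coeff q" "0 < k"
  shows "degree (p - q) < k"
proof -
  have "coeff (p - q) k = 0" using assms by simp
  moreover have "degree (p - q) \<le> k" using assms degree_diff_le[of p k q] by simp
  ultimately show ?thesis using assms(4)
    by (metis degree_0 leading_coeff_0_iff le_neq_implies_less)
qed

lemma monic_pCons:
  fixes p :: "complex poly"
  assumes "degree p = k" "lead_coeff p = 1"
  shows "degree (pCons 0 p) = Suc k" "lead_coeff (pCons 0 p) = 1"
  using assms by (auto simp: lead_coeff_pCons)

lemma mod3_neq: "(m::nat) mod 3 \<noteq> Suc m mod 3" "m mod 3 \<noteq> Suc (Suc m) mod 3"
  unfolding mod_Suc[of "Suc m" 3] mod_Suc[of m 3] by auto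

lemma mod3_shift:
  "Suc (Suc (Suc k)) mod 3 = k mod 3" "Suc (Suc k) mod 3 = Suc (Suc j) mod 3 \<Longrightarrow> k mod 3 = j mod 3"
proof -
  show "Suc (Suc (Suc k)) mod 3 = k mod 3" for k by simp
  have "Suc k mod 3 = Suc j mod 3 \<Longrightarrow> k mod 3 = j mod 3" for k j
    unfolding mod_Suc[of k 3] mod_Suc[of j 3] by (auto split: if_splits)
  then show "Suc (Suc k) mod 3 = Suc (Suc j) mod 3 \<Longrightarrow> k mod 3 = j mod 3" by blast
qed

text \<open>A symmetric bilinear stand-in for the Hermitian form, without conjugation of the second
  argument. The axiom \<open>string\<close> is integration by parts in z: the derivative of the
  exponent is - N (w - t z^2), and multiplication by w acts on the second argument.\<close>

locale string_form =
  fixes B :: "complex poly \<Rightarrow> complex poly \<Rightarrow> complex" and N t :: real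
  assumes add_left: "B (f + g) h = B f h + B g h"
    and smult_left: "B (smult c f) h = c * B f h"
    and sym: "B f g = B g f"
    and rot: "i mod 3 \<noteq> j mod 3 \<Longrightarrow> B (monom 1 i) (monom 1 j) = 0"
    and string: "B (pderiv f) g = of_real N * (B f (pCons 0 g) - of_real t * B (pCons 0 (pCons 0 f)) g)"
    and N: "N > 0" and t: "t > 0"
begin

lemma add_right: "B h (f + g) = B h f + B h g"
  using add_left sym by metis

lemma smult_right: "B h (smult c f) = c * B h f"
  using smult_left sym by metis

lemma zero_left [simp]: "B 0 h = 0"
  using smult_left[of 0 0 h] by simp

lemma zero_right [simp]: "B h 0 = 0"
  using sym[of h 0] by simp

lemma diff_left: "B (f - g) h = B f h - B g h"
  using add_left[of "f - g" g h] by simp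

lemma sum_right: "B h (\<Sum>i\<in>A. f i) = (\<Sum>i\<in>A. B h (f i))"
  by (induction A rule: infinite_finite_induct) (auto simp: add_right)

lemma right_as_sum: "B h g = (\<Sum>j\<le>degree g. coeff g j * B h (monom 1 j))"
proof -
  have "B h g = B h (\<Sum>j\<le>degree g. smult (coeff g j) (monom 1 j))"
    by (simp add: smult_monom poly_as_sum_of_monoms)
  then show ?thesis by (simp add: sum_right smult_right)
qed

text \<open>The string equation with the arguments exchanged. Multiplication by z on the left raises
  the degree on the right by only 2, which is why the recurrence is finite.\<close>

lemma shift: "B (pCons 0 f) g = of_real t * B f (pCons 0 (pCons 0 g)) + B f (pderiv g) / of_real N"
  using string[of g f] sym[of g "pCons 0 f"] sym[of "pCons 0 (pCons 0 g)" f] sym[of "pderiv g" f] N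
  by (simp add: field_simps)

lemma pCons_monom: "pCons 0 (monom (1::complex) j) = monom 1 (Suc j)"
  by (simp add: monom_Suc)

lemma shift_monom: "B (pCons 0 f) (monom 1 j)
    = of_real t * B f (monom 1 (Suc (Suc j))) + of_nat j * B f (monom 1 (j - 1)) / of_real N"
proof -
  have "pderiv (monom (1::complex) j) = smult (of_nat j) (monom 1 (j - 1))"
    by (simp add: pderiv_monom smult_monom)
  then show ?thesis unfolding shift pCons_monom by (simp add: smult_right)
qed

text \<open>For arbitrary coefficients \<open>a\<close>, the rotation symmetry settles all j in the
  wrong residue class, so orthogonality has to be checked in one class mod 3 only.\<close>

lemma star_poly_rot:
  assumes "k mod 3 \<noteq> j mod 3" shows "B (star_poly a k) (monom 1 j) = 0"
  using assms
proof (induction k arbitrary: j rule: star_poly.induct[of _ a])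
  case (1 a)
  then show ?case using rot[of 0 j] by (simp add: monom_0 one_pCons)
next
  case (2 a)
  then show ?case using rot[of 1 j] by (simp add: monom_Suc monom_0)
next
  case (3 a)
  then show ?case using rot[of 2 j] by (simp add: monom_Suc monom_0 numeral_2_eq_2)
next
  case (4 a k)
  have kj: "k mod 3 \<noteq> j mod 3" using 4(3) unfolding mod3_shift(1) .
  have "B (star_poly a k) (monom 1 j) = 0" by (rule 4) (rule kj)
  moreover have "B (star_poly a (Suc (Suc k))) (monom 1 (Suc (Suc j))) = 0" by (rule 4) (use kj mod3_shift(2) in blast)
  moreover have "of_nat j * B (star_poly a (Suc (Suc k))) (monom 1 (j - 1)) = 0"
  proof (cases j)
    case (Suc i)
    have "Suc (Suc k) mod 3 \<noteq> Suc (Suc (Suc i)) mod 3" using kj mod3_shift(2) unfolding Suc by blast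
    then have "B (star_poly a (Suc (Suc k))) (monom 1 i) = 0" unfolding mod3_shift(1) by (rule 4)
    then show ?thesis using Suc by simp
  qed simp
  ultimately show ?case by (simp add: diff_left smult_left shift_monom)
qed

text \<open>Orthogonality to z^(k - 2) forces the coefficient t * h k / h (k - 2); with h i / h (i -
  1) = X i / t^2 it takes this form.\<close>

definition rec_coeff :: "(nat \<Rightarrow> real) \<Rightarrow> nat \<Rightarrow> real" where
  "rec_coeff X k = X k * X (k - 1) / t ^ 3"

definition norm_ratio_prod :: "(nat \<Rightarrow> real) \<Rightarrow> complex \<Rightarrow> nat \<Rightarrow> complex" where
  "norm_ratio_prod X h0 k = h0 * of_real (\<Prod>i=1..k. X i / t\<^sup>2)"

context
  fixes X :: "nat \<Rightarrow> real" and n :: nat and h0 :: complex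
  assumes X0: "X 0 = 0" and Xnz: "\<And>k. 1 \<le> k \<Longrightarrow> k \<le> n \<Longrightarrow> X k \<noteq> 0"
    and rec: "\<And>k. 1 \<le> k \<Longrightarrow> k \<le> n \<Longrightarrow> X (Suc k) = 1 - (real k * t\<^sup>2 / N) / X k - X (k - 1)"
    and B00: "B 1 1 = h0" and h0: "h0 \<noteq> 0" and B11: "B [:0, 1:] [:0, 1:] = of_real (X 1 / t\<^sup>2) * h0"
begin

abbreviation "a \<equiv> rec_coeff X"

abbreviation "h \<equiv> norm_ratio_prod X h0"

abbreviation "P \<equiv> star_poly a"

lemma h_Suc: "h (Suc k) = h k * of_real (X (Suc k) / t\<^sup>2)"
  unfolding norm_ratio_prod_def by simp

lemma h_nz: "k \<le> n \<Longrightarrow> h k \<noteq> 0"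
  unfolding norm_ratio_prod_def using h0 Xnz t by (auto simp: prod_zero_iff)

lemma monic: "degree (P k) = k" "lead_coeff (P k) = 1"
  using star_poly_monic[of a k] by auto

lemma orth_lower:
  assumes "\<And>j. j < k \<Longrightarrow> B (P k) (monom 1 j) = 0" "degree g < k" shows "B (P k) g = 0"
  unfolding right_as_sum[of _ g] using assms by (intro sum.neutral) auto

lemma norm_monic:
  assumes "\<And>j. j < k \<Longrightarrow> B (P k) (monom 1 j) = 0" "degree g = k" "lead_coeff g = c"
  shows "B (P k) g = c * B (P k) (monom 1 k)"
proof -
  have "B (P k) g = (\<Sum>j\<le>k. coeff g j * B (P k) (monom 1 j))" unfolding right_as_sum[of _ g] assms(2) ..
  also have "\<dots> = (\<Sum>j\<in>{k}. coeff g j * B (P k) (monom 1 j))" using assms(1) by (intro sum.mono_neutral_right) auto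
  finally show ?thesis using assms by simp
qed

text \<open>At k = 1 truncated subtraction gives \<open>P 0\<close> in the last term; it drops out
  because \<open>a 1\<close> contains the factor \<open>X 0\<close> = 0.\<close>

lemma P_Suc: "1 \<le> k \<Longrightarrow> P (Suc k) = pCons 0 (P k) - smult (of_real (a k)) (P (k - 2))"
proof -
  assume "1 \<le> k"
  then consider "k = Suc 0" | m where "k = Suc (Suc m)" by (cases k; cases "k - 1") auto
  then show ?thesis
  proof cases
    case 1
    then show ?thesis using X0 by (simp add: rec_coeff_def)
  qed simp
qed

text \<open>In the surviving residue class j \<le> m - 2, so \<open>shift_monom\<close> reduces to
  \<open>B (P m)\<close> against z^(j + 2), nonzero only for j = m - 2, where \<open>a m\<close>
  cancels it. The norm of the new polynomial comes from the string equation for the pair m, m -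
  1.\<close>

lemma orthogonal: "k \<le> Suc n \<Longrightarrow> (\<forall>j<k. B (P k) (monom 1 j) = 0) \<and> B (P k) (monom 1 k) = h k"
proof (induction k rule: less_induct)
  case (less k)
  consider "k = 0" | "k = 1" | m where "k = Suc m" "m \<ge> 1" by (cases k; cases "k - 1") auto
  then show ?case
  proof cases
    case 1
    then show ?thesis using B00 by (simp add: norm_ratio_prod_def monom_0 one_pCons)
  next
    case 2
    have "B (P 1) (monom 1 0) = 0" by (rule star_poly_rot) simp
    then show ?thesis using 2 B11 by (simp add: norm_ratio_prod_def monom_Suc monom_0 mult.commute)
  next
    case 3
    have m: "1 \<le> m" "m \<le> n" using 3 less.prems by auto
    have IH: "B (P i) (monom 1 j) = 0" if "i \<le> m" "j < i" for i j using less.IH[of i] 3 less.prems that by auto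
    have IHh: "B (P i) (monom 1 i) = h i" if "i \<le> m" for i using less.IH[of i] 3 less.prems that by auto
    have hm: "h m = h (m - 1) * of_real (X m / t\<^sup>2)" using h_Suc[of "m - 1"] m by simp
    have orth: "B (P (Suc m)) (monom 1 j) = 0" if j: "j < Suc m" for j
    proof (cases "j mod 3 = Suc m mod 3")
      case False
      then show ?thesis by (intro star_poly_rot) simp
    next
      case True
      have "j \<noteq> m" using True mod3_neq(1)[of m] by auto
      moreover have "Suc j \<noteq> m" using True mod3_neq(2)[of j] by auto
      ultimately have m2: "2 \<le> m" and j2: "j \<le> m - 2" using j m by linarith+
      have z: "of_nat j * B (P m) (monom 1 (j - 1)) = 0" using IH[of m "j - 1"] j2 m2 by auto
      have "B (P (Suc m)) (monom 1 j) = of_real t * B (P m) (monom 1 (Suc (Suc j))) - of_real (a m) * B (P (m - 2)) (monom 1 j)"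
        unfolding P_Suc[OF m(1)] diff_left smult_left shift_monom z by simp
      also have "\<dots> = 0"
      proof (cases "j = m - 2")
        case True
        have "h m = h (m - 2) * of_real (X m / t\<^sup>2) * of_real (X (m - 1) / t\<^sup>2)"
          using hm h_Suc[of "m - 2"] m2 by (simp add: Suc_diff_Suc numeral_2_eq_2)
        moreover have "Suc (Suc j) = m" using True m2 by simp
        ultimately show ?thesis using IHh[of m] IHh[of "m - 2"] True t
          by (simp add: rec_coeff_def power2_eq_square power3_eq_cube)
      next
        case False
        then have "Suc (Suc j) < m" "j < m - 2" using j2 by auto
        then show ?thesis using IH[of m "Suc (Suc j)"] IH[of "m - 2" j] by auto
      qed
      finally show ?thesis .
    qed
    define H where "H = B (P (Suc m)) (monom 1 (Suc m))"
    have m1: "m - 1 \<le> m" "Suc (m - 1) = m" using m by auto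
    have L: "B (pderiv (P m)) (P (m - 1)) = of_nat m * h (m - 1)"
    proof -
      have "degree (pderiv (P m)) = m - 1" "lead_coeff (pderiv (P m)) = of_nat m"
        using monic[of m] m1 by (auto simp: degree_pderiv coeff_pderiv)
      then have "B (P (m - 1)) (pderiv (P m)) = of_nat m * B (P (m - 1)) (monom 1 (m - 1))"
        using IH m1 by (intro norm_monic) auto
      then show ?thesis using IHh[of "m - 1"] sym[of "pderiv (P m)"] by simp
    qed
    have R1: "B (P m) (pCons 0 (P (m - 1))) = h m"
    proof -
      have "degree (pCons 0 (P (m - 1))) = m" "lead_coeff (pCons 0 (P (m - 1))) = 1"
        using monic_pCons[OF monic[of "m - 1"]] unfolding m1(2) by blast+
      then have "B (P m) (pCons 0 (P (m - 1))) = 1 * B (P m) (monom 1 m)"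
        using IH by (intro norm_monic) auto
      then show ?thesis using IHh by simp
    qed
    have R2: "B (pCons 0 (pCons 0 (P m))) (P (m - 1)) = of_real t * H + of_real (a m) * h (m - 1)"
    proof -
      have "pCons 0 (P m) = P (Suc m) + smult (of_real (a m)) (P (m - 2))" using P_Suc[OF m(1)] by simp
      then have e: "pCons 0 (pCons 0 (P m)) = pCons 0 (P (Suc m)) + smult (of_real (a m)) (pCons 0 (P (m - 2)))"
        by simp
      have d: "degree (pCons 0 (pCons 0 (P (m - 1)))) = Suc m" "lead_coeff (pCons 0 (pCons 0 (P (m - 1)))) = 1"
        using monic_pCons[OF monic_pCons[OF monic[of "m - 1"]]] unfolding m1(2) by blast+
      have "B (P (Suc m)) (pCons 0 (pCons 0 (P (m - 1)))) = 1 * H"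
        unfolding H_def using orth d by (intro norm_monic) auto
      moreover have "degree (pderiv (P (m - 1))) < Suc m" using monic[of "m - 1"] by (simp add: degree_pderiv)
      then have "B (P (Suc m)) (pderiv (P (m - 1))) = 0" by (rule orth_lower[rotated]) (rule orth)
      ultimately have 1: "B (pCons 0 (P (Suc m))) (P (m - 1)) = of_real t * H"
        unfolding shift by simp
      have 2: "of_real (a m) * B (pCons 0 (P (m - 2))) (P (m - 1)) = of_real (a m) * h (m - 1)"
      proof (cases "m = 1")
        case True
        then show ?thesis using X0 by (simp add: rec_coeff_def)
      next
        case False
        then have m2: "Suc (m - 2) = m - 1" using m by simp
        have "degree (pCons 0 (P (m - 2))) = m - 1" "lead_coeff (pCons 0 (P (m - 2))) = 1"
          using monic_pCons[OF monic[of "m - 2"]] unfolding m2 by blast+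
        then have "B (P (m - 1)) (pCons 0 (P (m - 2))) = 1 * B (P (m - 1)) (monom 1 (m - 1))"
          using IH m1 by (intro norm_monic) auto
        then show ?thesis using IHh[of "m - 1"] sym[of "pCons 0 (P (m - 2))"] by simp
      qed
      show ?thesis unfolding e add_left smult_left 1 2 ..
    qed
    \<comment> \<open>All terms but H are known by induction; the discrete equation
      \<open>rec\<close> identifies H with h (Suc m).\<close>
    have eq: "of_nat m * h (m - 1) = of_real N * (h m - of_real t * (of_real t * H + of_real (a m) * h (m - 1)))"
      using string[of "P m" "P (m - 1)"] unfolding L R1 R2 .
    have "H = h (Suc m)"
    proof -
      define c where "c = h (m - 1)"
      have "of_real (t\<^sup>2) * H = h m - of_real (real m / N) * c - of_real (t * a m) * c"
        using eq N unfolding c_def by (simp add: field_simps power2_eq_square)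
      also have "\<dots> = c * of_real (X m / t\<^sup>2 - real m / N - t * a m)"
        unfolding hm c_def by (simp add: algebra_simps)
      also have "X m / t\<^sup>2 - real m / N - t * a m = X m * X (Suc m) / t\<^sup>2"
        unfolding rec[OF m] rec_coeff_def using Xnz[OF m] t N by (simp add: field_simps power2_eq_square power3_eq_cube)
      also have "X m * X (Suc m) / t\<^sup>2 = t\<^sup>2 * (X m / t\<^sup>2 * (X (Suc m) / t\<^sup>2))"
        using t by (simp add: power2_eq_square)
      finally have "of_real (t\<^sup>2) * H = of_real (t\<^sup>2) * (c * of_real (X m / t\<^sup>2) * of_real (X (Suc m) / t\<^sup>2))"
        unfolding of_real_mult by (simp only: mult_ac)
      moreover have "complex_of_real (t\<^sup>2) \<noteq> 0" using t by simp
      ultimately have "H = c * of_real (X m / t\<^sup>2) * of_real (X (Suc m) / t\<^sup>2)" by (rule mult_left_cancel[THEN iffD1, rotated])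
      then show ?thesis by (simp only: h_Suc[of m] hm c_def)
    qed
    then show ?thesis using orth 3 unfolding H_def by auto
  qed
qed

text \<open>Nonvanishing norms replace positivity: a difference D of degree d < n is orthogonal to
  \<open>P d\<close>, yet this product is its leading coefficient times h d.\<close>

theorem orthogonal_unique:
  assumes Q: "degree Q = n" "lead_coeff Q = 1" "\<And>j. j < n \<Longrightarrow> B Q (monom 1 j) = 0"
  shows "Q = P n"
proof (rule ccontr)
  assume "Q \<noteq> P n"
  define D where "D = Q - P n"
  have D0: "D \<noteq> 0" using \<open>Q \<noteq> P n\<close> unfolding D_def by simp
  have n0: "0 < n"
  proof (rule ccontr)
    assume "\<not> 0 < n"
    then have *: "degree Q = 0" "lead_coeff Q = 1" "n = 0" using Q by auto
    obtain c where "Q = [:c:]" using *(1) by (rule degree_eq_zeroE)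
    then have "Q = 1" using *(2) by (simp add: one_pCons)
    then show False using \<open>Q \<noteq> P n\<close> *(3) by simp
  qed
  define d where "d = degree D"
  have d: "d < n" unfolding d_def D_def using degree_less_sub[of Q n "P n"] Q monic n0 by auto
  have orth: "B (P k) (monom 1 j) = 0" if "k \<le> n" "j < k" for j k using orthogonal[of k] that by auto
  have "B D (monom 1 j) = 0" if "j < n" for j
    unfolding D_def diff_left using Q(3)[OF that] orth[of n j] that by simp
  then have "B D (P d) = 0" unfolding right_as_sum[of _ "P d"] using monic[of d] d by (intro sum.neutral) auto
  moreover have "B (P d) D = lead_coeff D * B (P d) (monom 1 d)"
    using orth d by (intro norm_monic) (auto simp: d_def)
  ultimately have "lead_coeff D * h d = 0" using orthogonal[of d] d sym[of D] by simp
  then show False using D0 h_nz[of d] d by simp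
qed

end
end

section \<open>Contour integrals as integrals along rays\<close>

lemma integrable_exp_ray: "(\<lambda>x. C * exp (- x)) integrable_on {a..}" for a C :: real
  using has_integral_mult_right[OF has_integral_exp_minus_to_infinity[of 1 a], of C]
  by (auto intro: has_integral_integrable)

lemma integral_exp_ray: "integral {a..} (\<lambda>x. C * exp (- x)) = C * exp (- a)" for a C :: real
proof (rule integral_unique)
  show "((\<lambda>x. C * exp (- x)) has_integral C * exp (- a)) {a..}"
    using has_integral_mult_right[OF has_integral_exp_minus_to_infinity[of 1 a], of C] by simp
qed

lemma exp_decay_integrable:
  fixes f :: "real \<Rightarrow> 'a::euclidean_space"
  assumes "continuous_on {a..} f" "\<And>x. a \<le> x \<Longrightarrow> norm (f x) \<le> C * exp (- x)"
  shows "f integrable_on {a..}"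
  using assms
  by (intro measurable_bounded_by_integrable_imp_integrable[OF _ integrable_exp_ray[of C]]
        continuous_imp_measurable_on_sets_lebesgue) auto

lemma exp_decay_tail:
  fixes f :: "real \<Rightarrow> 'a::euclidean_space"
  assumes f: "continuous_on {0..} f" "\<And>x. 0 \<le> x \<Longrightarrow> norm (f x) \<le> C * exp (- x)" and R: "0 \<le> R"
  shows "norm (integral {0..} f - integral {0..R} f) \<le> C * exp (- R)"
proof -
  have t: "f integrable_on {R..}" using f R by (intro exp_decay_integrable[where C = C] continuous_on_subset[OF f(1)]) auto
  have "{0..R} \<inter> {R..} = {R}" using R by auto
  then have neg: "negligible ({0..R} \<inter> {R..})" by simp
  have "f integrable_on {0..R}" using f(1) by (intro integrable_continuous_interval continuous_on_subset[OF f(1)]) auto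
  then have "(f has_integral (integral {0..R} f + integral {R..} f)) ({0..R} \<union> {R..})"
    using t by (intro has_integral_Un[OF _ _ neg]) (auto simp: integrable_integral)
  moreover have "{0..R} \<union> {R..} = {0..}" using R by auto
  ultimately have "integral {0..} f - integral {0..R} f = integral {R..} f" by (simp add: integral_unique)
  moreover have "norm (integral {R..} f) \<le> integral {R..} (\<lambda>x. C * exp (- x))"
    using f R by (intro integral_norm_bound_integral t integrable_exp_ray) auto
  ultimately show ?thesis unfolding integral_exp_ray by simp
qed

lemma exp_decay_integral_limit:
  fixes f :: "real \<Rightarrow> 'a::euclidean_space"
  assumes f: "continuous_on {0..} f" "\<And>x. 0 \<le> x \<Longrightarrow> norm (f x) \<le> C * exp (- x)"
  shows "((\<lambda>R. integral {0..R} f) \<longlongrightarrow> integral {0..} f) at_top"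
proof -
  have "\<forall>\<^sub>F R in at_top. norm (integral {0..} f - integral {0..R} f) \<le> C * exp (- R)"
    using eventually_ge_at_top[of 0] by eventually_elim (use exp_decay_tail[OF f] in auto)
  moreover have "((\<lambda>R. C * exp (- R)) \<longlongrightarrow> 0) at_top" by real_asymp
  ultimately have "((\<lambda>R. integral {0..} f - integral {0..R} f) \<longlongrightarrow> 0) at_top"
    by (rule Lim_null_comparison)
  then have "((\<lambda>R. integral {0..} f - (integral {0..} f - integral {0..R} f)) \<longlongrightarrow> integral {0..} f - 0) at_top"
    by (intro tendsto_diff tendsto_const)
  then show ?thesis by simp
qed

lemma exp_decay_FTC:
  fixes f g :: "real \<Rightarrow> 'a::euclidean_space"
  assumes f: "continuous_on {0..} f" "\<And>x. 0 \<le> x \<Longrightarrow> norm (f x) \<le> C * exp (- x)"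
    and g: "\<And>x. 0 \<le> x \<Longrightarrow> (g has_vector_derivative f x) (at x)" and l: "(g \<longlongrightarrow> l) at_top"
  shows "integral {0..} f = l - g 0"
proof -
  have "\<forall>\<^sub>F R in at_top. g R - g 0 = integral {0..R} f"
    using eventually_ge_at_top[of 0]
  proof eventually_elim
    case (elim R)
    then have "(f has_integral g R - g 0) {0..R}"
      by (intro fundamental_theorem_of_calculus g[THEN has_vector_derivative_at_within]) auto
    then show ?case by (simp add: integral_unique)
  qed
  moreover have "((\<lambda>R. g R - g 0) \<longlongrightarrow> l - g 0) at_top" by (intro tendsto_diff tendsto_const l)
  ultimately have "((\<lambda>R. integral {0..R} f) \<longlongrightarrow> l - g 0) at_top"
    by (rule Lim_transform_eventually[rotated])
  with exp_decay_integral_limit[OF f] show ?thesis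
    by (intro tendsto_unique[OF trivial_limit_at_top_linorder])
qed

text \<open>One majorant C * exp (- r) for all later integrands: the quadratic term absorbs the
  growth that the mixed factor exp (- N z w) causes.\<close>

lemma exp_cubic_bound:
  fixes A B D :: real
  assumes "A > 0"
  shows "\<exists>C>0. \<forall>r\<ge>0. r ^ m * exp (B * r ^ 2 + D * r - A * r ^ 3) \<le> C * exp (- r)"
proof -
  define g where "g r = r ^ m * exp (B * r ^ 2 + (D + 1) * r - A * r ^ 3)" for r
  have "(g \<longlongrightarrow> 0) at_top" unfolding g_def using assms by real_asymp
  then have "\<forall>\<^sub>F r in at_top. g r < 1" by (rule order_tendstoD) simp
  then obtain R where R: "\<And>r. r \<ge> R \<Longrightarrow> g r < 1" by (auto simp: eventually_at_top_linorder)
  have "bounded (g ` {0..R})" unfolding g_def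
    by (intro compact_imp_bounded compact_continuous_image continuous_intros) auto
  then obtain C where C: "\<And>r. 0 \<le> r \<Longrightarrow> r \<le> R \<Longrightarrow> norm (g r) \<le> C" unfolding bounded_iff by force
  have b: "g r \<le> max C 1" if "r \<ge> 0" for r
    using R[of r] C[of r] that by (cases "r \<le> R") auto
  show ?thesis
  proof (intro exI conjI allI impI)
    show "max C 1 > 0" by simp
    fix r :: real assume "r \<ge> 0"
    have "r ^ m * exp (B * r ^ 2 + D * r - A * r ^ 3) = g r * exp (- r)"
      unfolding g_def by (simp add: mult.assoc exp_add[symmetric]) (simp add: algebra_simps)
    then show "r ^ m * exp (B * r ^ 2 + D * r - A * r ^ 3) \<le> max C 1 * exp (- r)"
      using b[OF \<open>r \<ge> 0\<close>] by (simp add: mult_right_mono)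
  qed
qed

lemma cubic_integrable:
  fixes A B D :: real
  assumes "A > 0" shows "(\<lambda>r. r ^ m * exp (B * r ^ 2 + D * r - A * r ^ 3)) integrable_on {0..}"
proof -
  obtain C where C: "\<And>r. r \<ge> 0 \<Longrightarrow> r ^ m * exp (B * r ^ 2 + D * r - A * r ^ 3) \<le> C * exp (- r)"
    using exp_cubic_bound[OF assms] by blast
  show ?thesis using C by (intro exp_decay_integrable[where C = C] continuous_intros) auto
qed

section \<open>Moments of the cubic weight on a ray\<close>

definition mu :: "real \<Rightarrow> nat \<Rightarrow> real" where
  "mu A m = integral {0..} (\<lambda>r. r ^ m * exp (- (A / 3) * r ^ 3))"

lemma mu_integrable: "A > 0 \<Longrightarrow> (\<lambda>r::real. r ^ m * exp (- (A / 3) * r ^ 3)) integrable_on {0..}"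
  using cubic_integrable[of "A / 3" m 0 0] by simp

lemma mu_bound:
  fixes A :: real
  assumes "A > 0"
  obtains C where "\<And>r::real. r \<ge> 0 \<Longrightarrow> norm (r ^ m * exp (- (A / 3) * r ^ 3)) \<le> C * exp (- r)"
  using exp_cubic_bound[of "A / 3" m 0 0] assms by auto

text \<open>Functional equation of the Gamma function, as \<open>mu A m\<close> is (1 / 3) (3 /
  A)^((m + 1) / 3) Gamma ((m + 1) / 3).\<close>

lemma mu_rec: assumes "A > 0" shows "A * mu A (m + 3) = real (m + 1) * mu A m"
proof -
  define f where "f r = real (m + 1) * (r ^ m * exp (- (A / 3) * r ^ 3)) - A * (r ^ (m + 3) * exp (- (A / 3) * r ^ 3))" for r
  obtain C1 where C1: "\<And>r. r \<ge> 0 \<Longrightarrow> norm (r ^ m * exp (- (A / 3) * r ^ 3)) \<le> C1 * exp (- r)"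
    using mu_bound[OF assms, of m] by blast
  obtain C2 where C2: "\<And>r. r \<ge> 0 \<Longrightarrow> norm (r ^ (m + 3) * exp (- (A / 3) * r ^ 3)) \<le> C2 * exp (- r)"
    using mu_bound[OF assms, of "m + 3"] by blast
  have "integral {0..} f = 0 - (\<lambda>r. r ^ (m + 1) * exp (- (A / 3) * r ^ 3)) 0"
  proof (rule exp_decay_FTC)
    show "continuous_on {0..} f" unfolding f_def by (intro continuous_intros)
    show "norm (f r) \<le> (real (m + 1) * C1 + A * C2) * exp (- r)" if "0 \<le> r" for r
    proof -
      have "norm (f r) \<le> real (m + 1) * norm (r ^ m * exp (- (A / 3) * r ^ 3)) + A * norm (r ^ (m + 3) * exp (- (A / 3) * r ^ 3))"
        unfolding f_def using norm_triangle_ineq4[of "real (m + 1) * (r ^ m * exp (- (A / 3) * r ^ 3))" "A * (r ^ (m + 3) * exp (- (A / 3) * r ^ 3))"]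
          assms unfolding norm_mult by simp
      also have "\<dots> \<le> real (m + 1) * (C1 * exp (- r)) + A * (C2 * exp (- r))"
        using C1[OF that] C2[OF that] assms by (intro add_mono mult_left_mono) auto
      finally show ?thesis by (simp add: algebra_simps)
    qed
    show "((\<lambda>r. r ^ (m + 1) * exp (- (A / 3) * r ^ 3)) has_vector_derivative f r) (at r)" for r
    proof -
      have d1: "((\<lambda>r. r ^ (m + 1)) has_real_derivative real (m + 1) * r ^ m) (at r)"
        using DERIV_pow[of "m + 1" r UNIV] by simp
      have d2: "((\<lambda>r. exp (- (A / 3) * r ^ 3)) has_real_derivative exp (- (A / 3) * r ^ 3) * (- (A / 3) * (3 * r ^ 2))) (at r)"
        by (auto intro!: derivative_eq_intros)
      have "((\<lambda>r. r ^ (m + 1) * exp (- (A / 3) * r ^ 3)) has_real_derivative f r) (at r)"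
        by (rule DERIV_cong[OF DERIV_mult[OF d1 d2]])
          (simp add: f_def algebra_simps power_add power2_eq_square power3_eq_cube)
      then show ?thesis by (simp add: has_real_derivative_iff_has_vector_derivative)
    qed
    show "((\<lambda>r. r ^ (m + 1) * exp (- (A / 3) * r ^ 3)) \<longlongrightarrow> 0) at_top" using assms by real_asymp
  qed
  moreover have "integral {0..} f = real (m + 1) * mu A m - A * mu A (m + 3)"
    unfolding f_def mu_def
    using integrable_cmul[OF mu_integrable[OF assms, of "m + 3"], of A]
      integrable_cmul[OF mu_integrable[OF assms, of m], of "real (m + 1)"]
    by (subst integral_diff) auto
  ultimately show ?thesis by simp
qed

lemma mu_pos: assumes "A > 0" shows "mu A m > 0"
proof -
  define f where "f r = r ^ m * exp (- (A / 3) * r ^ 3)" for r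
  have "exp (- (A / 3) * 8) \<le> f r" if "1 \<le> r" "r \<le> 2" for r
  proof -
    have "r ^ 3 \<le> 2 ^ 3" using that by (intro power_mono) auto
    then have "exp (- (A / 3) * 8) \<le> exp (- (A / 3) * r ^ 3)" using assms by simp
    moreover have "1 \<le> r ^ m" using that by (intro one_le_power)
    ultimately have "1 * exp (- (A / 3) * 8) \<le> f r" unfolding f_def by (intro mult_mono) auto
    then show ?thesis by simp
  qed
  then have "integral {1..2::real} (\<lambda>r. exp (- (A / 3) * 8)) \<le> integral {1..2} f"
    unfolding f_def by (intro integral_le integrable_continuous_interval continuous_intros) auto
  also have "\<dots> \<le> integral {0..} f"
    unfolding f_def using mu_integrable[OF assms]
    by (intro integral_subset_le integrable_continuous_interval continuous_intros) auto
  finally have "exp (- (A / 3) * 8) \<le> mu A m" unfolding mu_def f_def by simp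
  then show ?thesis by (smt (verit) exp_gt_zero)
qed

lemma mu_scale: assumes "s > 0" shows "mu (s ^ 3) m = mu 1 m / s ^ (m + 1)"
proof -
  define f where "f A r = r ^ m * exp (- (A / 3) * r ^ 3)" for A r :: real
  have lim: "((\<lambda>R. integral {0..R} (f A)) \<longlongrightarrow> mu A m) at_top" if "A > 0" for A
  proof -
    obtain C where C: "\<And>r. r \<ge> 0 \<Longrightarrow> norm (r ^ m * exp (- (A / 3) * r ^ 3)) \<le> C * exp (- r)"
      using mu_bound[OF \<open>A > 0\<close>, of m] by blast
    show ?thesis unfolding mu_def f_def by (rule exp_decay_integral_limit[OF _ C]) (auto intro!: continuous_intros)
  qed
  have "integral {0..R} (f (s ^ 3)) = integral {0..s * R} (f 1) / s ^ (m + 1)" if "R \<ge> 0" for R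
  proof -
    have "(\<lambda>x. x / s) ` {0..s * R} = {0..R}"
    proof
      show "{0..R} \<subseteq> (\<lambda>x. x / s) ` {0..s * R}"
        using assms by (auto intro!: image_eqI[of _ _ "s * _"] simp: mult_left_mono)
    qed (use assms in \<open>auto simp: pos_divide_le_eq mult.commute\<close>)
    then have "integral {0..R} (\<lambda>x. f 1 (s * x)) = integral {0..s * R} (f 1) / s"
      using integral_stretch_real[of s 0 "s * R" "f 1"] assms by simp
    moreover have "(\<lambda>x. f 1 (s * x)) = (\<lambda>x. s ^ m * f (s ^ 3) x)"
      unfolding f_def by (intro ext) (simp add: power_mult_distrib)
    ultimately have "s ^ m * integral {0..R} (f (s ^ 3)) = integral {0..s * R} (f 1) / s" by simp
    then show ?thesis using assms by (simp add: field_simps)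
  qed
  then have "\<forall>\<^sub>F R in at_top. integral {0..s * R} (f 1) / s ^ (m + 1) = integral {0..R} (f (s ^ 3))"
    by (intro eventually_mono[OF eventually_ge_at_top[of 0]]) metis
  moreover have "filterlim (\<lambda>R. s * R) at_top at_top" using assms by real_asymp
  then have "((\<lambda>R. integral {0..s * R} (f 1) / s ^ (m + 1)) \<longlongrightarrow> mu 1 m / s ^ (m + 1)) at_top"
    using assms by (intro tendsto_divide tendsto_const filterlim_compose[OF lim]) auto
  ultimately have "((\<lambda>R. integral {0..R} (f (s ^ 3))) \<longlongrightarrow> mu 1 m / s ^ (m + 1)) at_top"
    by (rule Lim_transform_eventually[rotated])
  then show ?thesis using lim[of "s ^ 3"] assms by (intro tendsto_unique[of at_top]) auto
qed

text \<open>Any constant between \<open>cos (pi / 6)\<close> and 1 would do: on the cone about a direction whose cube is \<open>- 1\<close>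
  cubes have negative real part.\<close>

definition decays :: "real \<Rightarrow> (complex \<Rightarrow> complex) \<Rightarrow> bool" where
  "decays \<alpha> F \<longleftrightarrow> (\<exists>C. \<forall>z. 95 / 100 * cmod z \<le> Re (z * cis (- \<alpha>)) \<longrightarrow> cmod (F z) \<le> C * exp (- cmod z))"

section \<open>From contours to rays\<close>

definition ray_int :: "real \<Rightarrow> (complex \<Rightarrow> complex) \<Rightarrow> complex" where
  "ray_int \<alpha> F = integral {0..} (\<lambda>r. F (of_real r * cis \<alpha>) * cis \<alpha>)"

lemma decaysE:
  assumes "decays \<alpha> F"
  obtains C where "0 < C" "\<And>z. 95 / 100 * cmod z \<le> Re (z * cis (- \<alpha>)) \<Longrightarrow> cmod (F z) \<le> C * exp (- cmod z)"
proof -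
  obtain C where C: "\<And>z. 95 / 100 * cmod z \<le> Re (z * cis (- \<alpha>)) \<Longrightarrow> cmod (F z) \<le> C * exp (- cmod z)"
    using assms unfolding decays_def by blast
  have "cmod (F z) \<le> max C 1 * exp (- cmod z)" if "95 / 100 * cmod z \<le> Re (z * cis (- \<alpha>))" for z
    by (rule order_trans[OF C[OF that] mult_right_mono[OF max.cobounded1 exp_ge_zero]])
  then show ?thesis using that[of "max C 1"] by simp
qed

lemma ray_in_cone: "0 \<le> r \<Longrightarrow> of_real r * cis \<alpha> * cis (- \<alpha>) = of_real r"
  by (simp add: cis_mult mult.assoc)

lemma decays_ray_bound:
  assumes "\<And>z. 95 / 100 * cmod z \<le> Re (z * cis (- \<alpha>)) \<Longrightarrow> cmod (F z) \<le> C * exp (- cmod z)" "0 \<le> r"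
  shows "norm (F (of_real r * cis \<alpha>) * cis \<alpha>) \<le> C * exp (- r)"
  using assms(1)[of "of_real r * cis \<alpha>"] ray_in_cone[OF assms(2)] assms(2) by (simp add: norm_mult)

lemma ray_continuous:
  assumes "continuous_on UNIV F" shows "continuous_on {0..} (\<lambda>r. F (of_real r * cis \<alpha>) * cis \<alpha>)"
  by (intro continuous_intros continuous_on_compose2[OF assms]) auto

text \<open>The curve is compared with the point of the ray of equal modulus R. The segment joining
  them lies in the cone, where F is exponentially small, and has length at most 2 R, so the
  primitive has the same limit along both.\<close>

lemma primitive_limit:
  assumes \<Phi>: "\<And>z. (\<Phi> has_field_derivative F z) (at z)" and dec: "decays \<alpha> F"
    and \<gamma>: "goes_to_infinity_in_direction \<gamma> G \<alpha>" and F: "continuous_on UNIV F"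
  shows "((\<lambda>t. \<Phi> (\<gamma> t)) \<longlongrightarrow> \<Phi> 0 + ray_int \<alpha> F) G"
proof -
  obtain C where C0: "0 < C" and C: "\<And>z. 95 / 100 * cmod z \<le> Re (z * cis (- \<alpha>)) \<Longrightarrow> cmod (F z) \<le> C * exp (- cmod z)"
    using decaysE[OF dec] by blast
  define f where "f r = F (of_real r * cis \<alpha>) * cis \<alpha>" for r
  have fc: "continuous_on {0..} f" unfolding f_def using F by (rule ray_continuous)
  have fb: "norm (f r) \<le> C * exp (- r)" if "0 \<le> r" for r unfolding f_def using decays_ray_bound[OF C that] .
  have I: "integral {0..R} f = \<Phi> (of_real R * cis \<alpha>) - \<Phi> 0" if "0 \<le> R" for R
  proof -
    have "((\<lambda>r. \<Phi> (of_real r * cis \<alpha>)) has_vector_derivative f r) (at r)" for r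
    proof -
      have "((\<lambda>r. of_real r * cis \<alpha>) has_vector_derivative cis \<alpha>) (at r)"
        by (auto intro!: derivative_eq_intros simp: has_vector_derivative_def scaleR_conv_of_real)
      from field_vector_diff_chain_at[OF this \<Phi>] show ?thesis
        unfolding f_def by (simp add: o_def mult.commute)
    qed
    from fundamental_theorem_of_calculus[OF that this[THEN has_vector_derivative_at_within]]
    show ?thesis by (simp add: integral_unique)
  qed
  have mod: "filterlim (\<lambda>t. cmod (\<gamma> t)) at_top G"
    using \<gamma> unfolding goes_to_infinity_in_direction_def by (simp add: filterlim_at_infinity_conv_norm_at_top)
  have "((\<lambda>t. integral {0..cmod (\<gamma> t)} f) \<longlongrightarrow> ray_int \<alpha> F) G"
    using filterlim_compose[OF exp_decay_integral_limit[OF fc fb] mod] unfolding ray_int_def f_def by simp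
  then have 1: "((\<lambda>t. \<Phi> (of_real (cmod (\<gamma> t)) * cis \<alpha>) - \<Phi> 0) \<longlongrightarrow> ray_int \<alpha> F) G"
    by (simp add: I)
  have "((\<lambda>t. Re (sgn (\<gamma> t) * cis (- \<alpha>))) \<longlongrightarrow> Re (cis \<alpha> * cis (- \<alpha>))) G"
    using \<gamma> unfolding goes_to_infinity_in_direction_def by (intro tendsto_intros) auto
  then have "((\<lambda>t. Re (sgn (\<gamma> t) * cis (- \<alpha>))) \<longlongrightarrow> 1) G" by (simp add: cis_mult)
  then have cone: "\<forall>\<^sub>F t in G. 95 / 100 < Re (sgn (\<gamma> t) * cis (- \<alpha>))" by (rule order_tendstoD) simp
  have "\<forall>\<^sub>F t in G. norm (\<Phi> (\<gamma> t) - \<Phi> (of_real (cmod (\<gamma> t)) * cis \<alpha>)) \<le> 2 * C * (cmod (\<gamma> t) * exp (- (95 / 100) * cmod (\<gamma> t)))"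
    using cone
  proof eventually_elim
    case (elim t)
    define R where "R = cmod (\<gamma> t)"
    have R: "R \<ge> 0" unfolding R_def by simp
    \<comment> \<open>Half-plane and disc are convex, and their intersection lies in the cone, at
      distance at least 95 / 100 * R from the origin.\<close>
    define S where "S = {z. 95 / 100 * R \<le> Re (z * cis (- \<alpha>)) \<and> cmod z \<le> R}"
    have g: "\<gamma> t = of_real R * sgn (\<gamma> t)" unfolding R_def by (simp add: sgn_eq)
    have "Re (\<gamma> t * cis (- \<alpha>)) = R * Re (sgn (\<gamma> t) * cis (- \<alpha>))"
      by (subst g) (simp add: mult.assoc)
    moreover have "R * (95 / 100) \<le> R * Re (sgn (\<gamma> t) * cis (- \<alpha>))"
      using elim R by (intro mult_left_mono) auto
    ultimately have "95 / 100 * R \<le> Re (\<gamma> t * cis (- \<alpha>))" by linarith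
    then have gS: "\<gamma> t \<in> S" unfolding S_def by (simp add: R_def)
    have rS: "of_real R * cis \<alpha> \<in> S"
      unfolding S_def mem_Collect_eq ray_in_cone[OF R] using R by (simp add: norm_mult)
    have "S = (\<lambda>z. Re (z * cis (- \<alpha>))) -` {95 / 100 * R..} \<inter> cball 0 R" unfolding S_def by auto
    moreover have "convex ((\<lambda>z. Re (z * cis (- \<alpha>))) -` {95 / 100 * R..})"
      by (intro convex_linear_vimage convex_real_interval linearI) (auto simp: algebra_simps)
    ultimately have "convex S" by (simp add: convex_Int)
    moreover have "norm (F z) \<le> C * exp (- (95 / 100) * R)" if "z \<in> S" for z
    proof -
      have z: "95 / 100 * R \<le> Re (z * cis (- \<alpha>))" "cmod z \<le> R" using that unfolding S_def by auto
      then have "95 / 100 * cmod z \<le> Re (z * cis (- \<alpha>))" by linarith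
      then have "norm (F z) \<le> C * exp (- cmod z)" by (rule C)
      also have "95 / 100 * R \<le> cmod z" using z(1) complex_Re_le_cmod[of "z * cis (- \<alpha>)"] by (simp add: norm_mult)
      then have "C * exp (- cmod z) \<le> C * exp (- (95 / 100) * R)" using C0 by simp
      finally show ?thesis .
    qed
    ultimately have "norm (\<Phi> (\<gamma> t) - \<Phi> (of_real R * cis \<alpha>)) \<le> (C * exp (- (95 / 100) * R)) * norm (\<gamma> t - of_real R * cis \<alpha>)"
      using field_differentiable_bound[OF _ has_field_derivative_at_within[OF \<Phi>] _ gS rS] by blast
    also have "norm (\<gamma> t - of_real R * cis \<alpha>) \<le> R + R"
      using norm_triangle_ineq4[of "\<gamma> t" "of_real R * cis \<alpha>"] R by (simp add: norm_mult R_def)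
    then have "(C * exp (- (95 / 100) * R)) * norm (\<gamma> t - of_real R * cis \<alpha>) \<le> (C * exp (- (95 / 100) * R)) * (R + R)"
      using C0 by (intro mult_left_mono) auto
    finally show ?case unfolding R_def by (simp add: algebra_simps)
  qed
  moreover have "((\<lambda>t. 2 * C * (cmod (\<gamma> t) * exp (- (95 / 100) * cmod (\<gamma> t)))) \<longlongrightarrow> 2 * C * 0) G"
  proof (intro tendsto_mult tendsto_const)
    have "((\<lambda>x::real. x * exp (- (95 / 100) * x)) \<longlongrightarrow> 0) at_top" by real_asymp
    then show "((\<lambda>t. cmod (\<gamma> t) * exp (- (95 / 100) * cmod (\<gamma> t))) \<longlongrightarrow> 0) G"
      by (rule filterlim_compose[OF _ mod])
  qed
  ultimately have 2: "((\<lambda>t. \<Phi> (\<gamma> t) - \<Phi> (of_real (cmod (\<gamma> t)) * cis \<alpha>)) \<longlongrightarrow> 0) G"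
    unfolding mult_zero_right by (rule Lim_null_comparison)
  from tendsto_add[OF tendsto_add[OF 2 1] tendsto_const[of "\<Phi> 0"]] show ?thesis by (simp add: algebra_simps)
qed

text \<open>The gauge integral over the line is a limit over growing intervals, so a primitive with
  limits at both ends determines it.\<close>

lemma has_integral_UNIV_limits:
  fixes h \<Psi> :: "real \<Rightarrow> complex"
  assumes d: "\<And>t. (\<Psi> has_vector_derivative h t) (at t)" and u: "(\<Psi> \<longlongrightarrow> u) at_top" and l: "(\<Psi> \<longlongrightarrow> l) at_bot"
  shows "(h has_integral (u - l)) UNIV"
proof -
  have I: "(h has_integral (\<Psi> b - \<Psi> a)) {a..b}" if "a \<le> b" for a b
    by (rule fundamental_theorem_of_calculus[OF that d[THEN has_vector_derivative_at_within]])
  have int: "h integrable_on cbox a b" for a b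
  proof (cases "a \<le> b")
    case True
    then show ?thesis using I[OF True] by (auto simp: integrable_on_def)
  qed (auto simp: not_le)
  have "\<exists>B>0. \<forall>a b. ball 0 B \<subseteq> cbox a b \<longrightarrow> norm (integral (cbox a b) h - (u - l)) < e" if e: "e > 0" for e
  proof -
    have "\<forall>\<^sub>F t in at_top. dist (\<Psi> t) u < e / 2" "\<forall>\<^sub>F t in at_bot. dist (\<Psi> t) l < e / 2"
      using tendstoD[OF u, of "e / 2"] tendstoD[OF l, of "e / 2"] e by auto
    then obtain T1 T2 where T: "\<And>t. t \<ge> T1 \<Longrightarrow> dist (\<Psi> t) u < e / 2" "\<And>t. t \<le> T2 \<Longrightarrow> dist (\<Psi> t) l < e / 2"
      by (auto simp: eventually_at_top_linorder eventually_at_bot_linorder)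
    define B where "B = \<bar>T1\<bar> + \<bar>T2\<bar> + 1"
    show ?thesis
    proof (intro exI[of _ B] conjI allI impI)
      show "B > 0" unfolding B_def by simp
      fix a b :: real assume sub: "ball 0 B \<subseteq> cbox a b"
      have "B > 0" unfolding B_def by simp
      have "{- B<..<B} \<subseteq> {a..b}" using sub by (simp add: ball_eq_greaterThanLessThan)
      then have ab: "a \<le> - B" "B \<le> b"
        using \<open>B > 0\<close> greaterThanLessThan_subseteq_atLeastAtMost_iff[of "- B" B a b] by auto
      then have "integral (cbox a b) h = \<Psi> b - \<Psi> a" using I[of a b] \<open>B > 0\<close> by (simp add: integral_unique)
      moreover have "dist (\<Psi> b) u < e / 2" "dist (\<Psi> a) l < e / 2" using T ab unfolding B_def by auto
      moreover have "norm ((\<Psi> b - \<Psi> a) - (u - l)) \<le> dist (\<Psi> b) u + dist (\<Psi> a) l"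
        using norm_triangle_ineq4[of "\<Psi> b - u" "\<Psi> a - l"] by (simp add: dist_norm algebra_simps)
      ultimately show "norm (integral (cbox a b) h - (u - l)) < e" by simp
    qed
  qed
  then show ?thesis using int unfolding has_integral_alt' by simp
qed

theorem line_contour_integral_rays:
  assumes \<gamma>: "\<And>t. \<gamma> differentiable (at t)"
    and a: "goes_to_infinity_in_direction \<gamma> at_bot \<alpha>" and b: "goes_to_infinity_in_direction \<gamma> at_top \<beta>"
    and F: "F holomorphic_on UNIV" and dec: "decays \<alpha> F" "decays \<beta> F"
  shows "line_contour_integral \<gamma> F = ray_int \<beta> F - ray_int \<alpha> F"
proof -
  obtain \<Phi> where \<Phi>: "\<And>z. (\<Phi> has_field_derivative F z) (at z)"
    using holomorphic_convex_primitive'[OF convex_UNIV open_UNIV F] by auto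
  have F': "continuous_on UNIV F" using F by (rule holomorphic_on_imp_continuous_on)
  have "((\<lambda>t. \<Phi> (\<gamma> t)) has_vector_derivative F (\<gamma> t) * vector_derivative \<gamma> (at t)) (at t)" for t
    using field_vector_diff_chain_at[OF vector_derivative_works[THEN iffD1, OF \<gamma>[of t]] \<Phi>]
    by (simp add: o_def mult.commute)
  from has_integral_UNIV_limits[OF this primitive_limit[OF \<Phi> dec(2) b F'] primitive_limit[OF \<Phi> dec(1) a F']]
  show ?thesis unfolding line_contour_integral_def by (simp add: integral_unique)
qed

text \<open>For u of modulus R with real part a, Re (u^3) = a (4 a^2 - 3 R^2). At a = 0.95 R this is
  0.95 * 0.61 * R^3, which exceeds R^3 / 2.\<close>

lemma cone_cube:
  assumes a: "cis \<alpha> ^ 3 = - 1" and w: "95 / 100 * cmod w \<le> Re (w * cis (- \<alpha>))"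
  shows "Re (w ^ 3) \<le> - (1 / 2) * cmod w ^ 3"
proof -
  define u R a where "u = w * cis (- \<alpha>)" and "R = cmod w" and "a = Re u"
  have "u * cis \<alpha> = w" unfolding u_def by (simp add: mult.assoc cis_mult)
  then have "w ^ 3 = u ^ 3 * cis \<alpha> ^ 3" by (metis power_mult_distrib)
  then have w3: "Re (w ^ 3) = - Re (u ^ 3)" unfolding a by simp
  have "cmod u = R" unfolding u_def R_def by (simp add: norm_mult)
  then have R2: "R\<^sup>2 = a\<^sup>2 + (Im u)\<^sup>2" unfolding a_def by (metis cmod_power2)
  have "Re (u ^ 3) = a ^ 3 - 3 * a * (Im u)\<^sup>2"
    unfolding a_def by (simp add: power3_eq_cube power2_eq_square algebra_simps)
  then have u3: "Re (u ^ 3) = a * (4 * a\<^sup>2 - 3 * R\<^sup>2)"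
    unfolding R2 by (simp add: power3_eq_cube power2_eq_square algebra_simps)
  have R0: "R \<ge> 0" unfolding R_def by simp
  have aR: "95 / 100 * R \<le> a" using w unfolding a_def u_def R_def .
  then have "(95 / 100 * R)\<^sup>2 \<le> a\<^sup>2" using R0 by (intro power_mono) auto
  then have "61 / 100 * R\<^sup>2 \<le> 4 * a\<^sup>2 - 3 * R\<^sup>2" by (simp add: power_mult_distrib power2_eq_square)
  then have "(95 / 100 * R) * (61 / 100 * R\<^sup>2) \<le> a * (4 * a\<^sup>2 - 3 * R\<^sup>2)"
    using aR R0 by (intro mult_mono) auto
  moreover have "(1 / 2) * R ^ 3 \<le> (95 / 100 * R) * (61 / 100 * R\<^sup>2)"
    using R0 by (simp add: power3_eq_cube power2_eq_square)
  ultimately show ?thesis unfolding w3 u3 R_def by linarith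
qed

section \<open>Termwise integration of power series along rays\<close>

lemma ray_cube: "cis \<alpha> ^ 3 = - 1 \<Longrightarrow> (of_real r * cis \<alpha>) ^ 3 = - of_real (r ^ 3)"
  by (simp add: power_mult_distrib)

text \<open>Entire functions with a Gaussian bound on the partial sums of absolute values. It serves
  twice: for the exponential series in the inner integral and for the inner integral as a series in
  z.\<close>

locale power_growth =
  fixes d :: "nat \<Rightarrow> complex" and C B :: real
  assumes bound: "0 \<le> r \<Longrightarrow> (\<Sum>m<M. norm (d m) * r ^ m) \<le> C * exp (B * r\<^sup>2)"
begin

lemma C_nonneg: "0 \<le> C"
  using bound[of 0 0] by simp

lemma abs_summable: "summable (\<lambda>m. norm (d m * z ^ m))"
proof (rule summableI_nonneg_bounded)
  show "(\<Sum>m<M. norm (d m * z ^ m)) \<le> C * exp (B * (cmod z)\<^sup>2)" for M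
    using bound[of "cmod z" M] by (simp add: norm_mult norm_power)
qed simp

lemma summable: "summable (\<lambda>m. d m * z ^ m)"
  using abs_summable by (rule summable_norm_cancel)

definition D :: "complex \<Rightarrow> complex" where "D z = (\<Sum>m. d m * z ^ m)"

lemma D_bound: "cmod (D z) \<le> C * exp (B * (cmod z)\<^sup>2)"
proof -
  have "cmod (D z) \<le> (\<Sum>m. norm (d m * z ^ m))" unfolding D_def by (rule summable_norm[OF abs_summable])
  also have "\<dots> \<le> C * exp (B * (cmod z)\<^sup>2)"
    using bound[of "cmod z"] by (intro suminf_le_const[OF abs_summable]) (simp add: norm_mult norm_power)
  finally show ?thesis .
qed

lemma D_holomorphic: "D holomorphic_on UNIV"
proof -
  have "(D has_field_derivative (\<Sum>n. diffs d n * z ^ n)) (at z)" for z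
    using termdiffs_strong_converges_everywhere[of d z] summable D_def by (simp add: D_def[abs_def])
  then show ?thesis by (auto simp: holomorphic_on_open)
qed

definition F :: "real \<Rightarrow> nat \<Rightarrow> complex \<Rightarrow> complex" where
  "F A p z = z ^ p * D z * exp (of_real (A / 3) * z ^ 3)"

lemma F_holomorphic: "F A p holomorphic_on UNIV"
  unfolding F_def by (intro holomorphic_intros D_holomorphic)

lemma F_decays:
  assumes A: "A > 0" and a: "cis \<alpha> ^ 3 = - 1" shows "decays \<alpha> (F A p)"
proof -
  have "A / 6 > 0" using A by simp
  from exp_cubic_bound[OF this, of p B 0] obtain K where K: "K > 0"
    "\<And>r. r \<ge> 0 \<Longrightarrow> r ^ p * exp (B * r\<^sup>2 - A / 6 * r ^ 3) \<le> K * exp (- r)" by auto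
  have "cmod (F A p z) \<le> C * K * exp (- cmod z)" if "95 / 100 * cmod z \<le> Re (z * cis (- \<alpha>))" for z
  proof -
    define r where "r = cmod z"
    have "cmod (F A p z) = r ^ p * cmod (D z) * exp (A / 3 * Re (z ^ 3))"
      unfolding F_def r_def by (simp add: norm_mult norm_power)
    also have "\<dots> \<le> r ^ p * (C * exp (B * r\<^sup>2)) * exp (- (A / 6) * r ^ 3)"
    proof (intro mult_mono)
      have "A / 3 * Re (z ^ 3) \<le> A / 3 * (- (1 / 2) * r ^ 3)"
        using cone_cube[OF a that] A unfolding r_def by (intro mult_left_mono) auto
      then show "exp (A / 3 * Re (z ^ 3)) \<le> exp (- (A / 6) * r ^ 3)" by simp
    qed (use D_bound[of z] C_nonneg in \<open>auto simp: r_def\<close>)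
    also have "\<dots> = C * (r ^ p * exp (B * r\<^sup>2 - A / 6 * r ^ 3))"
    proof -
      have "exp (B * r\<^sup>2 - A / 6 * r ^ 3) = exp (B * r\<^sup>2) * exp (- (A / 6) * r ^ 3)" by (simp flip: exp_add)
      then show ?thesis by (simp only: mult_ac)
    qed
    also have "\<dots> \<le> C * (K * exp (- r))" using K(2)[of r] C_nonneg by (intro mult_left_mono) (auto simp: r_def)
    finally show ?thesis unfolding r_def by simp
  qed
  then show ?thesis unfolding decays_def by blast
qed

text \<open>The partial-sum bound provides the dominating function: Gaussian growth is integrable
  against cubic decay.\<close>

lemma F_ray_sums:
  assumes A: "A > 0" and a: "cis \<alpha> ^ 3 = - 1"
  shows "(\<lambda>m. d m * cis \<alpha> ^ (m + p + 1) * of_real (mu A (m + p))) sums ray_int \<alpha> (F A p)"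
proof -
  define h where "h r = C * (r ^ p * exp (B * r ^ 2 + 0 * r - (A / 3) * r ^ 3))" for r
  have hi: "h integrable_on {0..}"
    unfolding h_def using integrable_cmul[OF cubic_integrable[of "A / 3" p B 0], of C] A by simp
  define g where "g m r = d m * cis \<alpha> ^ (m + p + 1) * of_real (r ^ (m + p) * exp (- (A / 3) * r ^ 3))" for m and r :: real
  have "((\<lambda>r. of_real (r ^ (m + p) * exp (- (A / 3) * r ^ 3)) :: complex) has_integral of_real (mu A (m + p))) {0..}" for m
    using has_integral_linear[OF integrable_integral[OF mu_integrable[OF A, of "m + p"]] bounded_linear_of_real]
    unfolding mu_def o_def .
  then have gi: "(g m has_integral d m * cis \<alpha> ^ (m + p + 1) * of_real (mu A (m + p))) {0..}" for m
    unfolding g_def by (rule has_integral_mult_right)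
  have gS: "((\<lambda>r. \<Sum>m<M. g m r) has_integral (\<Sum>m<M. d m * cis \<alpha> ^ (m + p + 1) * of_real (mu A (m + p)))) {0..}" for M
    by (intro has_integral_sum gi) auto
  have exp_ray: "exp (of_real (A / 3) * (of_real r * cis \<alpha>) ^ 3) = of_real (exp (- (A / 3) * r ^ 3))" for r
    unfolding ray_cube[OF a] by (simp flip: exp_of_real)
  have gF: "g m r = d m * (of_real r * cis \<alpha>) ^ m * ((of_real r * cis \<alpha>) ^ p * exp (of_real (A / 3) * (of_real r * cis \<alpha>) ^ 3) * cis \<alpha>)" for m r
    unfolding exp_ray g_def by (simp add: power_add power_mult_distrib mult_ac)
  have "(\<lambda>M. integral {0..} (\<lambda>r. \<Sum>m<M. g m r)) \<longlonglongrightarrow> integral {0..} (\<lambda>r. F A p (of_real r * cis \<alpha>) * cis \<alpha>)"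
  proof (rule dominated_convergence(2)[OF _ hi])
    show "(\<lambda>r. \<Sum>m<M. g m r) integrable_on {0..}" for M using gS by (rule has_integral_integrable)
    show "norm (\<Sum>m<M. g m r) \<le> h r" if "r \<in> {0..}" for M r
    proof -
      have "norm (\<Sum>m<M. g m r) \<le> (\<Sum>m<M. norm (g m r))" by (rule norm_sum)
      also have "\<dots> = (\<Sum>m<M. norm (d m) * r ^ m) * (r ^ p * exp (- (A / 3) * r ^ 3))"
        using that unfolding sum_distrib_right g_def
        by (intro sum.cong) (auto simp: norm_mult norm_power power_add abs_mult)
      also have "\<dots> \<le> (C * exp (B * r\<^sup>2)) * (r ^ p * exp (- (A / 3) * r ^ 3))"
        using bound[of r M] that by (intro mult_right_mono) auto
      also have "\<dots> = h r"
      proof -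
        have "exp (B * r\<^sup>2 + 0 * r - A / 3 * r ^ 3) = exp (B * r\<^sup>2) * exp (- (A / 3) * r ^ 3)" by (simp flip: exp_add)
        then show ?thesis unfolding h_def by (simp only: mult_ac)
      qed
      finally show ?thesis .
    qed
    show "(\<lambda>M. \<Sum>m<M. g m r) \<longlonglongrightarrow> F A p (of_real r * cis \<alpha>) * cis \<alpha>" if "r \<in> {0..}" for r
    proof -
      have "(\<lambda>m. d m * (of_real r * cis \<alpha>) ^ m) sums D (of_real r * cis \<alpha>)"
        unfolding D_def by (rule summable_sums[OF summable])
      from sums_mult2[OF this, of "(of_real r * cis \<alpha>) ^ p * exp (of_real (A / 3) * (of_real r * cis \<alpha>) ^ 3) * cis \<alpha>"]
      show ?thesis unfolding gF[symmetric] sums_def F_def by (simp add: mult_ac)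
    qed
  qed
  moreover have "integral {0..} (\<lambda>r. \<Sum>m<M. g m r) = (\<Sum>m<M. d m * cis \<alpha> ^ (m + p + 1) * of_real (mu A (m + p)))" for M
    using gS by (rule integral_unique)
  ultimately show ?thesis unfolding sums_def ray_int_def by simp
qed

end

lemma ray_int_sum:
  assumes "finite I" "\<And>i. i \<in> I \<Longrightarrow> F i holomorphic_on UNIV" "\<And>i. i \<in> I \<Longrightarrow> decays \<alpha> (F i)"
  shows "ray_int \<alpha> (\<lambda>z. \<Sum>i\<in>I. c i * F i z) = (\<Sum>i\<in>I. c i * ray_int \<alpha> (F i))"
proof -
  have "((\<lambda>r. F i (of_real r * cis \<alpha>) * cis \<alpha>) has_integral ray_int \<alpha> (F i)) {0..}" if "i \<in> I" for i
  proof -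
    note dec = assms(3)[OF that] and hol = assms(2)[OF that]
    obtain C where "\<And>z. 95 / 100 * cmod z \<le> Re (z * cis (- \<alpha>)) \<Longrightarrow> cmod (F i z) \<le> C * exp (- cmod z)"
      using decaysE[OF dec] by blast
    from decays_ray_bound[OF this]
    have "(\<lambda>r. F i (of_real r * cis \<alpha>) * cis \<alpha>) integrable_on {0..}"
      by (intro exp_decay_integrable[where C = C] ray_continuous holomorphic_on_imp_continuous_on hol) auto
    then show ?thesis unfolding ray_int_def by (rule integrable_integral)
  qed
  then have "((\<lambda>r. \<Sum>i\<in>I. c i * (F i (of_real r * cis \<alpha>) * cis \<alpha>)) has_integral (\<Sum>i\<in>I. c i * ray_int \<alpha> (F i))) {0..}"
    using assms(1) by (intro has_integral_sum has_integral_mult_right) auto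
  then show ?thesis unfolding ray_int_def by (simp add: sum_distrib_right mult.assoc integral_unique)
qed

lemma decays_sum:
  assumes "finite I" "\<And>i. i \<in> I \<Longrightarrow> decays \<alpha> (F i)"
  shows "decays \<alpha> (\<lambda>z. \<Sum>i\<in>I. c i * F i z)"
proof -
  have "\<exists>C. \<forall>z. 95 / 100 * cmod z \<le> Re (z * cis (- \<alpha>)) \<longrightarrow> cmod (F i z) \<le> C * exp (- cmod z)" if "i \<in> I" for i
    using assms(2)[OF that] unfolding decays_def .
  then obtain C where C: "\<And>i z. i \<in> I \<Longrightarrow> 95 / 100 * cmod z \<le> Re (z * cis (- \<alpha>)) \<Longrightarrow> cmod (F i z) \<le> C i * exp (- cmod z)"
    by metis
  have "cmod (\<Sum>i\<in>I. c i * F i z) \<le> (\<Sum>i\<in>I. cmod (c i) * C i) * exp (- cmod z)" if "95 / 100 * cmod z \<le> Re (z * cis (- \<alpha>))" for z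
  proof -
    have "cmod (\<Sum>i\<in>I. c i * F i z) \<le> (\<Sum>i\<in>I. cmod (c i * F i z))" by (rule norm_sum)
    also have "\<dots> \<le> (\<Sum>i\<in>I. cmod (c i) * (C i * exp (- cmod z)))"
      using C[OF _ that] by (intro sum_mono) (auto simp: norm_mult mult_left_mono)
    finally show ?thesis by (simp add: sum_distrib_right mult.assoc)
  qed
  then show ?thesis unfolding decays_def by blast
qed

section \<open>Moments of the Hermitian form\<close>

lemma sum_exp_le: "0 \<le> x \<Longrightarrow> (\<Sum>m<M. x ^ m / fact m) \<le> exp (x::real)"
  using sum_le_suminf[OF summable_exp[of x], of "{..<M}"] by (simp add: exp_def field_simps)

lemma exp_mixed_le: "N * a * b \<le> N * a\<^sup>2 + N * (b::real)\<^sup>2" if "0 \<le> N"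
proof -
  have "0 \<le> (a - b)\<^sup>2 + a\<^sup>2 + b\<^sup>2" by simp
  then have "a * b \<le> a\<^sup>2 + b\<^sup>2" by (simp add: power2_eq_square algebra_simps)
  from mult_left_mono[OF this that] show ?thesis by (simp add: algebra_simps)
qed

definition mixed_bound :: "real \<Rightarrow> real \<Rightarrow> nat \<Rightarrow> real" where
  "mixed_bound N A j = integral {0..} (\<lambda>s. s ^ j * exp (N * s ^ 2 + 0 * s - (A / 3) * s ^ 3))"

text \<open>Under the integral the sum is a partial sum of exp (N r s), and r s \<le> r^2 + s^2
  separates the variables.\<close>

lemma sum_mu_bound:
  assumes A: "A > 0" and N: "N \<ge> 0" and r: "r \<ge> 0"
  shows "(\<Sum>m<M. N ^ m / fact m * mu A (m + j) * r ^ m) \<le> mixed_bound N A j * exp (N * r\<^sup>2)"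
proof -
  define g where "g m s = (N * r * s) ^ m / fact m * (s ^ j * exp (- (A / 3) * s ^ 3))" for m and s :: real
  have gi: "(g m has_integral N ^ m / fact m * mu A (m + j) * r ^ m) {0..}" for m
  proof -
    have "((\<lambda>s. (N ^ m * r ^ m / fact m) * (s ^ (m + j) * exp (- (A / 3) * s ^ 3))) has_integral (N ^ m * r ^ m / fact m) * mu A (m + j)) {0..}"
      unfolding mu_def by (intro has_integral_mult_right integrable_integral mu_integrable A)
    moreover have "(\<lambda>s. (N ^ m * r ^ m / fact m) * (s ^ (m + j) * exp (- (A / 3) * s ^ 3))) = g m"
      unfolding g_def by (simp add: power_mult_distrib power_add mult_ac)
    ultimately show ?thesis by (simp add: mult_ac)
  qed
  then have S: "((\<lambda>s. \<Sum>m<M. g m s) has_integral (\<Sum>m<M. N ^ m / fact m * mu A (m + j) * r ^ m)) {0..}"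
    by (intro has_integral_sum) auto
  have I: "((\<lambda>s. exp (N * r\<^sup>2) * (s ^ j * exp (N * s ^ 2 + 0 * s - (A / 3) * s ^ 3))) has_integral exp (N * r\<^sup>2) * mixed_bound N A j) {0..}"
    unfolding mixed_bound_def using A by (intro has_integral_mult_right integrable_integral cubic_integrable) auto
  have "(\<Sum>m<M. g m s) \<le> exp (N * r\<^sup>2) * (s ^ j * exp (N * s ^ 2 + 0 * s - (A / 3) * s ^ 3))" if "s \<in> {0..}" for s
  proof -
    have s: "0 \<le> N * r * s" using that N r by simp
    have "(\<Sum>m<M. g m s) = (\<Sum>m<M. (N * r * s) ^ m / fact m) * (s ^ j * exp (- (A / 3) * s ^ 3))"
      unfolding g_def sum_distrib_right ..
    also have "\<dots> \<le> exp (N * r\<^sup>2 + N * s\<^sup>2) * (s ^ j * exp (- (A / 3) * s ^ 3))"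
      using order_trans[OF sum_exp_le[OF s]] exp_mixed_le[OF N, of r s] that by (intro mult_right_mono) auto
    also have "\<dots> = exp (N * r\<^sup>2) * (s ^ j * exp (N * s ^ 2 + 0 * s - (A / 3) * s ^ 3))"
    proof -
      have "exp (N * s ^ 2 + 0 * s - (A / 3) * s ^ 3) = exp (N * s\<^sup>2) * exp (- (A / 3) * s ^ 3)"
        by (simp flip: exp_add)
      then show ?thesis unfolding exp_add by (simp only: mult_ac)
    qed
    finally show ?thesis .
  qed
  from has_integral_le[OF S I this] show ?thesis by (simp add: mult.commute)
qed

definition zeta :: "nat \<Rightarrow> complex" where "zeta k = cis (theta k)"

lemma zeta_cube: "cis (theta k) ^ 3 = - 1" "cis (- theta k) ^ 3 = - 1"
proof -
  have "3 * theta k = - pi + real k * (2 * pi)" unfolding theta_def by simp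
  then have "cis (3 * theta k) = cis (- pi) * cis (real k * (2 * pi))" by (simp only: cis_mult)
  also have "cis (real k * (2 * pi)) = 1" by (simp flip: Complex.DeMoivre)
  finally have "cis (3 * theta k) = - 1" by (simp add: complex_eq_iff)
  then show c: "cis (theta k) ^ 3 = - 1" using Complex.DeMoivre[of "theta k" 3] by simp
  have "cis (- theta k) ^ 3 = cnj (cis (theta k) ^ 3)" by (simp add: cis_cnj)
  then show "cis (- theta k) ^ 3 = - 1" unfolding c by simp
qed

text \<open>The integral of z^p * exp (A / 3 * z^3) over the k-th contour is
  \<open>Zm k p * mu A p\<close>, the difference of its two end rays.\<close>

definition Zm :: "nat \<Rightarrow> nat \<Rightarrow> complex" where
  "Zm k p = zeta (Suc k) ^ (p + 1) - zeta k ^ (p + 1)"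

lemma cmod_Zm: "cmod (Zm k p) \<le> 2"
  using norm_triangle_ineq4[of "zeta (Suc k) ^ (p + 1)" "zeta k ^ (p + 1)"]
  unfolding Zm_def zeta_def by (simp add: norm_power norm_mult)

text \<open>The m-th coefficient in z of the inner integral, from expanding exp (- N z w); the
  conjugate appears because the w-contour is conjugated.\<close>

definition inner_coeff :: "real \<Rightarrow> real \<Rightarrow> nat \<Rightarrow> nat \<Rightarrow> nat \<Rightarrow> complex" where
  "inner_coeff A N j k m = of_real ((- N) ^ m / fact m * mu A (m + j)) * cnj (Zm k (m + j))"

lemma power_growth_inner:
  assumes "A > 0" "N > 0" shows "power_growth (inner_coeff A N j k) (2 * mixed_bound N A j) N"
proof
  fix r :: real and M :: nat assume r: "0 \<le> r"
  have "(\<Sum>m<M. norm (inner_coeff A N j k m) * r ^ m) \<le> (\<Sum>m<M. 2 * (N ^ m / fact m * mu A (m + j) * r ^ m))"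
  proof (rule sum_mono)
    fix m
    have "norm (inner_coeff A N j k m) = N ^ m / fact m * mu A (m + j) * cmod (Zm k (m + j))"
      unfolding inner_coeff_def using assms mu_pos[OF assms(1), of "m + j"]
      by (simp add: norm_mult norm_divide norm_power)
    also have "\<dots> \<le> N ^ m / fact m * mu A (m + j) * 2"
      using assms mu_pos[OF assms(1), of "m + j"] cmod_Zm by (intro mult_left_mono) auto
    finally have "norm (inner_coeff A N j k m) * r ^ m \<le> (N ^ m / fact m * mu A (m + j) * 2) * r ^ m"
      using r by (intro mult_right_mono) auto
    then show "norm (inner_coeff A N j k m) * r ^ m \<le> 2 * (N ^ m / fact m * mu A (m + j) * r ^ m)"
      by (simp only: mult_ac)
  qed
  also have "\<dots> \<le> 2 * (mixed_bound N A j * exp (N * r\<^sup>2))"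
    unfolding sum_distrib_left[symmetric] using assms r by (intro mult_left_mono sum_mu_bound) auto
  finally show "(\<Sum>m<M. norm (inner_coeff A N j k m) * r ^ m) \<le> 2 * mixed_bound N A j * exp (N * r\<^sup>2)" by simp
qed

text \<open>Here z is a parameter and the exponential is expanded in w; conjugating the contour
  negates its end directions.\<close>

lemma inner_integral:
  assumes A: "A > 0" and N: "N > 0" and G: "admissible_contours \<Gamma>" and k: "k < 3"
  shows "line_contour_integral (\<lambda>t. cnj (\<Gamma> k t)) (\<lambda>w. w ^ j * exp (- of_real N * z * w) * exp (of_real (A / 3) * w ^ 3))
      = (\<Sum>m. inner_coeff A N j k m * z ^ m)"
proof -
  define d where "d m = (- of_real N * z) ^ m / fact m" for m
  interpret g: power_growth d "exp (N * (cmod z)\<^sup>2)" N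
  proof
    fix r :: real and M :: nat assume r: "0 \<le> r"
    have "(\<Sum>m<M. norm (d m) * r ^ m) = (\<Sum>m<M. (N * cmod z * r) ^ m / fact m)"
      unfolding d_def using N by (intro sum.cong) (auto simp: norm_mult norm_power norm_divide power_mult_distrib)
    also have "\<dots> \<le> exp (N * cmod z * r)" using N r by (intro sum_exp_le) auto
    also have "\<dots> \<le> exp (N * (cmod z)\<^sup>2 + N * r\<^sup>2)" using exp_mixed_le[of N "cmod z" r] N by simp
    finally show "(\<Sum>m<M. norm (d m) * r ^ m) \<le> exp (N * (cmod z)\<^sup>2) * exp (N * r\<^sup>2)" by (simp add: exp_add)
  qed
  have D: "g.D w = exp (- of_real N * z * w)" for w
  proof -
    have "d m * w ^ m = (- of_real N * z * w) ^ m /\<^sub>R fact m" for m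
      unfolding d_def power_mult_distrib[of _ w] by (simp add: scaleR_conv_of_real field_simps)
    then show ?thesis unfolding g.D_def exp_def by simp
  qed
  have F: "(\<lambda>w. w ^ j * exp (- of_real N * z * w) * exp (of_real (A / 3) * w ^ 3)) = g.F A j"
    unfolding g.F_def D ..
  have S: "simple_smooth_curve (\<Gamma> k)" and e: "goes_to_infinity_in_direction (\<Gamma> k) at_bot (theta k)"
    "goes_to_infinity_in_direction (\<Gamma> k) at_top (theta (Suc k))"
    using G k unfolding admissible_contours_def by auto
  have df: "(\<lambda>t. cnj (\<Gamma> k t)) differentiable (at t)" for t
  proof -
    have "\<Gamma> k differentiable (at t)"
      using S unfolding simple_smooth_curve_def C1_differentiable_on_def
      by (auto simp: differentiable_def has_vector_derivative_def)
    then show ?thesis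
      unfolding differentiable_def by (metis has_derivative_cnj)
  qed
  have e': "goes_to_infinity_in_direction (\<lambda>t. cnj (\<Gamma> k t)) H (- \<alpha>)"
    if "goes_to_infinity_in_direction (\<Gamma> k) H \<alpha>" for H \<alpha>
  proof -
    have "((\<lambda>t. cnj (sgn (\<Gamma> k t))) \<longlongrightarrow> cnj (cis \<alpha>)) H"
      using that unfolding goes_to_infinity_in_direction_def by (intro tendsto_cnj) auto
    moreover have "cnj (sgn z) = sgn (cnj z)" for z by (simp add: sgn_eq)
    ultimately have "((\<lambda>t. sgn (cnj (\<Gamma> k t))) \<longlongrightarrow> cis (- \<alpha>)) H" by (simp add: cis_cnj)
    moreover have "filterlim (\<lambda>t. cnj (\<Gamma> k t)) at_infinity H"
      using that unfolding goes_to_infinity_in_direction_def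
      by (simp add: filterlim_at_infinity_conv_norm_at_top)
    ultimately show ?thesis unfolding goes_to_infinity_in_direction_def by simp
  qed
  have "line_contour_integral (\<lambda>t. cnj (\<Gamma> k t)) (g.F A j)
      = ray_int (- theta (Suc k)) (g.F A j) - ray_int (- theta k) (g.F A j)"
    by (intro line_contour_integral_rays df e' e g.F_holomorphic g.F_decays A zeta_cube)
  moreover have "(\<lambda>m. d m * cis (- theta (Suc k)) ^ (m + j + 1) * of_real (mu A (m + j)) -
       d m * cis (- theta k) ^ (m + j + 1) * of_real (mu A (m + j))) sums
      (ray_int (- theta (Suc k)) (g.F A j) - ray_int (- theta k) (g.F A j))"
    by (intro sums_diff g.F_ray_sums A zeta_cube)
  moreover have "d m * cis (- theta (Suc k)) ^ (m + j + 1) * of_real (mu A (m + j)) -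
       d m * cis (- theta k) ^ (m + j + 1) * of_real (mu A (m + j)) = inner_coeff A N j k m * z ^ m" for m
  proof -
    have dm: "d m = (- of_real N) ^ m * z ^ m / fact m" unfolding d_def power_mult_distrib ..
    show ?thesis unfolding dm inner_coeff_def Zm_def zeta_def
      by (simp add: cis_cnj field_simps)
  qed
  ultimately show ?thesis unfolding F by (simp add: sums_iff)
qed

text \<open>The same termwise integration, now with the inner integral as the power series in
  z.\<close>

lemma outer_integral:
  assumes A: "A > 0" and N: "N > 0" and G: "admissible_contours \<Gamma>" and j: "jj < 3"
  shows "(\<lambda>m. inner_coeff A N j k m * Zm jj (m + i) * of_real (mu A (m + i))) sums
      (ray_int (theta (Suc jj)) (power_growth.F (inner_coeff A N j k) A i) - ray_int (theta jj) (power_growth.F (inner_coeff A N j k) A i))"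
   (is "?a sums ?s")
   and "line_contour_integral (\<Gamma> jj) (\<lambda>z. poly f z * exp (of_real (A / 3) * z ^ 3) * (\<Sum>m. inner_coeff A N j k m * z ^ m))
      = (\<Sum>i\<le>degree f. coeff f i * (\<Sum>m. inner_coeff A N j k m * Zm jj (m + i) * of_real (mu A (m + i))))"
proof -
  interpret g: power_growth "inner_coeff A N j k" "2 * mixed_bound N A j" N
    using A N by (rule power_growth_inner)
  have 1: "(\<lambda>m. inner_coeff A N j k m * Zm jj (m + i) * of_real (mu A (m + i))) sums
      (ray_int (theta (Suc jj)) (g.F A i) - ray_int (theta jj) (g.F A i))" for i
    using sums_diff[OF g.F_ray_sums[OF A zeta_cube(1)[of "Suc jj"], of i] g.F_ray_sums[OF A zeta_cube(1)[of jj], of i]]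
    by (simp add: Zm_def zeta_def algebra_simps)
  show "?a sums ?s" by (rule 1)
  have e: "simple_smooth_curve (\<Gamma> jj)" "goes_to_infinity_in_direction (\<Gamma> jj) at_bot (theta jj)"
    "goes_to_infinity_in_direction (\<Gamma> jj) at_top (theta (Suc jj))"
    using G j unfolding admissible_contours_def by auto
  have df: "\<Gamma> jj differentiable (at t)" for t
    using e(1) unfolding simple_smooth_curve_def C1_differentiable_on_def
    by (auto simp: differentiable_def has_vector_derivative_def)
  have F: "(\<lambda>z. poly f z * exp (of_real (A / 3) * z ^ 3) * (\<Sum>m. inner_coeff A N j k m * z ^ m))
      = (\<lambda>z. \<Sum>i\<le>degree f. coeff f i * g.F A i z)"
    unfolding poly_altdef g.F_def g.D_def by (simp add: sum_distrib_left sum_distrib_right mult_ac)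
  have "line_contour_integral (\<Gamma> jj) (\<lambda>z. \<Sum>i\<le>degree f. coeff f i * g.F A i z)
      = ray_int (theta (Suc jj)) (\<lambda>z. \<Sum>i\<le>degree f. coeff f i * g.F A i z) - ray_int (theta jj) (\<lambda>z. \<Sum>i\<le>degree f. coeff f i * g.F A i z)"
    by (intro line_contour_integral_rays df e decays_sum g.F_decays A zeta_cube holomorphic_intros g.F_holomorphic) auto
  also have "\<dots> = (\<Sum>i\<le>degree f. coeff f i * ray_int (theta (Suc jj)) (g.F A i)) - (\<Sum>i\<le>degree f. coeff f i * ray_int (theta jj) (g.F A i))"
    by (subst (1 2) ray_int_sum) (auto intro: g.F_holomorphic g.F_decays A zeta_cube)
  also have "\<dots> = (\<Sum>i\<le>degree f. coeff f i * (ray_int (theta (Suc jj)) (g.F A i) - ray_int (theta jj) (g.F A i)))"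
    by (simp add: sum_subtractf right_diff_distrib)
  finally show "line_contour_integral (\<Gamma> jj) (\<lambda>z. poly f z * exp (of_real (A / 3) * z ^ 3) * (\<Sum>m. inner_coeff A N j k m * z ^ m))
      = (\<Sum>i\<le>degree f. coeff f i * (\<Sum>m. inner_coeff A N j k m * Zm jj (m + i) * of_real (mu A (m + i))))"
    unfolding F using 1 by (simp add: sums_iff)
qed

section \<open>Summation over the pairs of contours\<close>

definition sgn3 :: "nat \<Rightarrow> real" where "sgn3 p = (- 1) ^ (p div 3)"

definition chi3 :: "nat \<Rightarrow> real" where
  "chi3 p = (if p mod 3 = 0 then 1 else if p mod 3 = 1 then - 1 else 0)"

definition pair_weight :: "nat \<Rightarrow> nat \<Rightarrow> real" where
  "pair_weight p q = (if p mod 3 = q mod 3 then chi3 p * sgn3 p * sgn3 q else 0)"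

lemma sgn3_add3: "sgn3 (p + 3) = - sgn3 p" unfolding sgn3_def by simp

lemma chi3_add3: "chi3 (p + 3) = chi3 p" unfolding chi3_def by simp

lemma pair_weight_left: "pair_weight (p + 3) q = - pair_weight p q"
  unfolding pair_weight_def by (simp add: sgn3_add3 chi3_add3)

lemma pair_weight_sym: "pair_weight p q = pair_weight q p"
  unfolding pair_weight_def chi3_def by auto

lemma Zm_add3: "Zm k (p + 3) = - Zm k p"
proof -
  have "zeta k ^ (p + 3 + 1) = zeta k ^ 3 * zeta k ^ (p + 1)" for k
    by (simp only: power_add [symmetric]) (simp add: ac_simps)
  then have "zeta k ^ (p + 3 + 1) = - (zeta k ^ (p + 1))" for k
    using zeta_cube(1)[of k] unfolding zeta_def by simp
  then show ?thesis unfolding Zm_def by simp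
qed

lemma mod3_induct [case_names 0 1 2 add3]:
  assumes "P 0" "P 1" "P 2" "\<And>p::nat. P p \<Longrightarrow> P (p + 3)"
  shows "P p"
proof (induction p rule: less_induct)
  case (less p)
  show ?case
  proof (cases "p < 3")
    case True
    then have "p = 0 \<or> p = 1 \<or> p = 2" by linarith
    then show ?thesis using assms by auto
  next
    case False
    then have "P (p - 3)" "p = (p - 3) + 3" using less by auto
    then show ?thesis using assms(4) by metis
  qed
qed

lemma zeta_values:
  "zeta 0 = Complex (1 / 2) (- sqrt 3 / 2)" "zeta (Suc 0) = Complex (1 / 2) (sqrt 3 / 2)"
  "zeta (Suc (Suc 0)) = - 1" "zeta (Suc (Suc (Suc 0))) = Complex (1 / 2) (- sqrt 3 / 2)"
proof -
  have t: "theta 0 = - (pi / 3)" "theta (Suc 0) = pi / 3" "theta (Suc (Suc 0)) = pi"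
    unfolding theta_def by auto
  have "theta (Suc (Suc (Suc 0))) = - (pi / 3) + 2 * pi" unfolding theta_def by simp
  then have z3: "zeta (Suc (Suc (Suc 0))) = cis (- (pi / 3)) * cis (2 * pi)"
    unfolding zeta_def by (simp only: cis_mult)
  show "zeta 0 = Complex (1 / 2) (- sqrt 3 / 2)" "zeta (Suc 0) = Complex (1 / 2) (sqrt 3 / 2)"
    "zeta (Suc (Suc 0)) = - 1" "zeta (Suc (Suc (Suc 0))) = Complex (1 / 2) (- sqrt 3 / 2)"
    unfolding z3 unfolding zeta_def t by (simp_all add: complex_eq_iff cos_60 sin_60)
qed

lemma Zm_values:
  "Zm 0 0 = Complex 0 (sqrt 3)" "Zm 1 0 = Complex (- (3 / 2)) (- sqrt 3 / 2)" "Zm 2 0 = Complex (3 / 2) (- sqrt 3 / 2)"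
  "Zm 0 1 = Complex 0 (sqrt 3)" "Zm 1 1 = Complex (3 / 2) (- sqrt 3 / 2)" "Zm 2 1 = Complex (- (3 / 2)) (- sqrt 3 / 2)"
  "Zm k 2 = 0"
proof -
  have s: "sqrt 3 * sqrt 3 = (3::real)" by simp
  show "Zm 0 0 = Complex 0 (sqrt 3)" "Zm 1 0 = Complex (- (3 / 2)) (- sqrt 3 / 2)" "Zm 2 0 = Complex (3 / 2) (- sqrt 3 / 2)"
    unfolding Zm_def by (simp_all add: zeta_values numeral_2_eq_2 complex_eq_iff)
  show "Zm 0 1 = Complex 0 (sqrt 3)" "Zm 1 1 = Complex (3 / 2) (- sqrt 3 / 2)" "Zm 2 1 = Complex (- (3 / 2)) (- sqrt 3 / 2)"
    unfolding Zm_def by (simp_all add: zeta_values numeral_2_eq_2 complex_eq_iff s field_simps)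
  show "Zm k 2 = 0" unfolding Zm_def zeta_def using zeta_cube(1) by (simp add: power3_eq_cube numeral_3_eq_3)
qed

text \<open>All cubes of the end directions are - 1. Hence raising an exponent by 3 only flips a
  sign, residue 2 gives no contribution, and finitely many base cases remain. The residues 0 and 1
  occur with opposite orientation, the origin of \<open>chi3\<close>.\<close>

lemma eps_sum:
  "(\<Sum>j<3. \<Sum>k<3. eps j k * (Zm j p * cnj (Zm k q))) = of_real (9 * sqrt 3 * pair_weight p q) * \<i>"
proof -
  have lt3: "{..<3::nat} = {0, 1, 2}" by auto
  have e: "eps 0 0 = 0" "eps 0 1 = - 1" "eps 0 2 = 1" "eps 1 0 = 1" "eps 1 1 = 0" "eps 1 2 = - 1"
    "eps 2 0 = - 1" "eps 2 1 = 1" "eps 2 2 = 0"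
    unfolding eps_def by (simp_all add: numeral_2_eq_2)
  have s: "sqrt 3 * sqrt 3 = (3::real)" by simp
  have w: "pair_weight 0 0 = 1" "pair_weight 0 1 = 0" "pair_weight 1 0 = 0" "pair_weight 1 1 = - 1"
    "pair_weight 2 q = 0" "pair_weight p 2 = 0" for p q
    unfolding pair_weight_def chi3_def sgn3_def by auto
  have L: "(\<Sum>j<3. \<Sum>k<3. eps j k * (Zm j (p + 3) * cnj (Zm k q))) = - (\<Sum>j<3. \<Sum>k<3. eps j k * (Zm j p * cnj (Zm k q)))"
    "(\<Sum>j<3. \<Sum>k<3. eps j k * (Zm j p * cnj (Zm k (q + 3)))) = - (\<Sum>j<3. \<Sum>k<3. eps j k * (Zm j p * cnj (Zm k q)))" for p q
    unfolding Zm_add3 by (simp_all add: sum_negf)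
  have base: "(\<Sum>j<3. \<Sum>k<3. eps j k * (Zm j p * cnj (Zm k q))) = of_real (9 * sqrt 3 * pair_weight p q) * \<i>"
    if "p = 0 \<or> p = 1 \<or> p = 2" for p
  proof (induction q rule: mod3_induct)
    case 0
    show ?case using that by (elim disjE) (simp_all add: lt3 e Zm_values w complex_eq_iff s field_simps del: One_nat_def)
  next
    case 1
    show ?case using that by (elim disjE) (simp_all add: lt3 e Zm_values w complex_eq_iff s field_simps del: One_nat_def)
  next
    case 2
    show ?case by (simp add: Zm_values w)
  next
    case (add3 q)
    then show ?case unfolding L using pair_weight_left[of q p] by (simp add: pair_weight_sym[of p])
  qed
  show ?thesis
  proof (induction p rule: mod3_induct)
    case (add3 p)
    then show ?case unfolding L pair_weight_left by simp
  qed (rule base, simp)+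
qed

section \<open>Moments as real series\<close>

definition mom_term :: "real \<Rightarrow> real \<Rightarrow> nat \<Rightarrow> nat \<Rightarrow> nat \<Rightarrow> real" where
  "mom_term A N i j m = (- N) ^ m / fact m * (pair_weight (m + i) (m + j) * mu A (m + i) * mu A (m + j))"

text \<open>Keeping A and N independent, although the form has A = N * t3, later allows rescaling to
  A = 1.\<close>

definition moment :: "real \<Rightarrow> real \<Rightarrow> nat \<Rightarrow> nat \<Rightarrow> real" where
  "moment A N i j = (\<Sum>m. mom_term A N i j m)"

lemma inner_outer_term:
  "(\<Sum>jj<3. \<Sum>k<3. eps jj k * (inner_coeff A N j k m * Zm jj (m + i) * of_real (mu A (m + i))))
    = of_real (9 * sqrt 3) * \<i> * of_real (mom_term A N i j m)"
proof -
  define c where "c = complex_of_real ((- N) ^ m / fact m * mu A (m + j) * mu A (m + i))"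
  have "(\<Sum>jj<3. \<Sum>k<3. eps jj k * (inner_coeff A N j k m * Zm jj (m + i) * of_real (mu A (m + i))))
      = (\<Sum>jj<3. \<Sum>k<3. c * (eps jj k * (Zm jj (m + i) * cnj (Zm k (m + j)))))"
    unfolding inner_coeff_def c_def by (intro sum.cong refl) (simp add: mult_ac)
  also have "\<dots> = c * (of_real (9 * sqrt 3 * pair_weight (m + i) (m + j)) * \<i>)"
    unfolding sum_distrib_left[symmetric] eps_sum ..
  also have "\<dots> = of_real (9 * sqrt 3) * \<i> * of_real (mom_term A N i j m)"
    unfolding c_def mom_term_def by (simp add: mult_ac)
  finally show ?thesis .
qed

lemma mom_term_abs_bound: "\<bar>mom_term A N i j m\<bar> \<le> \<bar>N\<bar> ^ m / fact m * (\<bar>mu A (m + i)\<bar> * \<bar>mu A (m + j)\<bar>)"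
proof -
  have "\<bar>pair_weight p q\<bar> \<le> 1" for p q
    unfolding pair_weight_def chi3_def sgn3_def by (auto simp: abs_mult power_abs)
  then have "\<bar>pair_weight (m + i) (m + j)\<bar> * (\<bar>mu A (m + i)\<bar> * \<bar>mu A (m + j)\<bar>) \<le> 1 * (\<bar>mu A (m + i)\<bar> * \<bar>mu A (m + j)\<bar>)"
    by (intro mult_right_mono) auto
  then have "\<bar>N\<bar> ^ m / fact m * (\<bar>pair_weight (m + i) (m + j)\<bar> * (\<bar>mu A (m + i)\<bar> * \<bar>mu A (m + j)\<bar>))
      \<le> \<bar>N\<bar> ^ m / fact m * (1 * (\<bar>mu A (m + i)\<bar> * \<bar>mu A (m + j)\<bar>))"
    by (intro mult_left_mono) auto
  then show ?thesis unfolding mom_term_def by (simp add: abs_mult power_abs mult_ac)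
qed

lemma mom_abs_summable:
  assumes A: "A > 0" and N: "N \<ge> 0"
  shows "summable (\<lambda>m. N ^ m / fact m * (mu A (m + i) * mu A (m + j)))"
proof (rule summableI_nonneg_bounded)
  have mu0: "mu A m \<ge> 0" for m using mu_pos[OF A, of m] by simp
  show "0 \<le> N ^ m / fact m * (mu A (m + i) * mu A (m + j))" for m using N mu0 by simp
  define h where "h s = mixed_bound N A j * (s ^ i * exp (N * s ^ 2 + 0 * s - (A / 3) * s ^ 3))" for s
  have hi: "(h has_integral (mixed_bound N A j * mixed_bound N A i)) {0..}"
    unfolding h_def mixed_bound_def[of N A i] using A by (intro has_integral_mult_right integrable_integral cubic_integrable) auto
  show "(\<Sum>m<M. N ^ m / fact m * (mu A (m + i) * mu A (m + j))) \<le> mixed_bound N A j * mixed_bound N A i" for M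
  proof (rule has_integral_le[OF _ hi])
    have "((\<lambda>s. (N ^ m / fact m * mu A (m + j)) * (s ^ (m + i) * exp (- (A / 3) * s ^ 3))) has_integral
        (N ^ m / fact m * mu A (m + j)) * mu A (m + i)) {0..}" for m
      unfolding mu_def[of A "m + i"] by (intro has_integral_mult_right integrable_integral mu_integrable A)
    then have "((\<lambda>s. \<Sum>m<M. (N ^ m / fact m * mu A (m + j)) * (s ^ (m + i) * exp (- (A / 3) * s ^ 3))) has_integral
        (\<Sum>m<M. (N ^ m / fact m * mu A (m + j)) * mu A (m + i))) {0..}"
      by (intro has_integral_sum) auto
    then show "((\<lambda>s. \<Sum>m<M. (N ^ m / fact m * mu A (m + j)) * (s ^ (m + i) * exp (- (A / 3) * s ^ 3))) has_integral
        (\<Sum>m<M. N ^ m / fact m * (mu A (m + i) * mu A (m + j)))) {0..}" by (simp add: mult_ac)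
    fix s :: real assume "s \<in> {0..}"
    then have s: "0 \<le> s" by simp
    have "(\<Sum>m<M. (N ^ m / fact m * mu A (m + j)) * (s ^ (m + i) * exp (- (A / 3) * s ^ 3)))
        = (\<Sum>m<M. N ^ m / fact m * mu A (m + j) * s ^ m) * (s ^ i * exp (- (A / 3) * s ^ 3))"
      unfolding sum_distrib_right by (simp add: power_add mult_ac)
    also have "\<dots> \<le> (mixed_bound N A j * exp (N * s\<^sup>2)) * (s ^ i * exp (- (A / 3) * s ^ 3))"
      using s by (intro mult_right_mono sum_mu_bound A N) auto
    also have "\<dots> = h s"
    proof -
      have "exp (N * s ^ 2 + 0 * s - (A / 3) * s ^ 3) = exp (N * s\<^sup>2) * exp (- (A / 3) * s ^ 3)"
        by (simp flip: exp_add)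
      then show ?thesis unfolding h_def by (simp only: mult_ac)
    qed
    finally show "(\<Sum>m<M. (N ^ m / fact m * mu A (m + j)) * (s ^ (m + i) * exp (- (A / 3) * s ^ 3))) \<le> h s" .
  qed
qed

lemma mom_summable:
  assumes A: "A > 0" shows "summable (\<lambda>m. \<bar>mom_term A N i j m\<bar>)" "summable (mom_term A N i j)"
proof -
  have "\<bar>mom_term A N i j m\<bar> \<le> \<bar>N\<bar> ^ m / fact m * (mu A (m + i) * mu A (m + j))" for m
    using mom_term_abs_bound[of A N i j m] mu_pos[OF A, of "m + i"] mu_pos[OF A, of "m + j"] by simp
  then show "summable (\<lambda>m. \<bar>mom_term A N i j m\<bar>)"
    by (intro summable_comparison_test'[OF mom_abs_summable[OF A, of "\<bar>N\<bar>" i j], of 0]) auto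
  then show "summable (mom_term A N i j)" by (rule summable_rabs_cancel)
qed

theorem herm_form_moment:
  assumes t: "t0 > 0" "t3 > 0" "n > 0" and G: "admissible_contours \<Gamma>"
  defines "N \<equiv> real n / t0"
  shows "herm_form \<Gamma> t0 t3 n f (monom 1 j)
    = of_real (9 * sqrt 3 / (2 * pi)) * (\<Sum>i\<le>degree f. coeff f i * of_real (moment (N * t3) N i j))"
proof -
  define A where "A = N * t3"
  have N: "N > 0" and A: "A > 0" unfolding A_def N_def using t by auto
  have mono: "map_poly cnj (monom 1 j) = monom 1 j" by (simp add: map_poly_monom)
  have inner: "line_contour_integral (\<lambda>t. cnj (\<Gamma> k t)) (\<lambda>w. poly f z * poly (map_poly cnj (monom 1 j)) w *
          exp (- (of_nat n / of_real t0) * (w * z - of_real t3 / 3 * (w ^ 3 + z ^ 3))))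
      = poly f z * exp (of_real (A / 3) * z ^ 3) * (\<Sum>m. inner_coeff A N j k m * z ^ m)" if "k < 3" for k z
  proof -
    have "(\<lambda>w. poly f z * poly (map_poly cnj (monom 1 j)) w *
          exp (- (of_nat n / of_real t0) * (w * z - of_real t3 / 3 * (w ^ 3 + z ^ 3))))
        = (\<lambda>w. (poly f z * exp (of_real (A / 3) * z ^ 3)) * (w ^ j * exp (- of_real N * z * w) * exp (of_real (A / 3) * w ^ 3)))"
    proof
      fix w
      have "- (of_nat n / of_real t0) * (w * z - of_real t3 / 3 * (w ^ 3 + z ^ 3))
          = of_real (A / 3) * z ^ 3 + (- of_real N * z * w + of_real (A / 3) * w ^ 3)"
        unfolding A_def N_def using t by (simp add: field_simps)
      then show "poly f z * poly (map_poly cnj (monom 1 j)) w * exp (- (of_nat n / of_real t0) * (w * z - of_real t3 / 3 * (w ^ 3 + z ^ 3)))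
          = (poly f z * exp (of_real (A / 3) * z ^ 3)) * (w ^ j * exp (- of_real N * z * w) * exp (of_real (A / 3) * w ^ 3))"
        unfolding mono by (simp only: exp_add poly_monom mult_1 mult_ac)
    qed
    then have "line_contour_integral (\<lambda>t. cnj (\<Gamma> k t)) (\<lambda>w. poly f z * poly (map_poly cnj (monom 1 j)) w *
          exp (- (of_nat n / of_real t0) * (w * z - of_real t3 / 3 * (w ^ 3 + z ^ 3))))
        = (poly f z * exp (of_real (A / 3) * z ^ 3)) * line_contour_integral (\<lambda>t. cnj (\<Gamma> k t))
            (\<lambda>w. w ^ j * exp (- of_real N * z * w) * exp (of_real (A / 3) * w ^ 3))"
      by (simp only:) (simp only: line_contour_integral_def mult.assoc integral_mult_right)
    then show ?thesis unfolding inner_integral[OF A N G that] .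
  qed
  define T where "T jj k i = (\<Sum>m. inner_coeff A N j k m * Zm jj (m + i) * of_real (mu A (m + i)))" for jj k i
  have Tsums: "(\<lambda>m. inner_coeff A N j k m * Zm jj (m + i) * of_real (mu A (m + i))) sums T jj k i" if "jj < 3" for jj k i
    using outer_integral(1)[OF A N G that, of j k i] unfolding T_def by (simp add: sums_iff)
  \<comment> \<open>The nine series converge separately, so the finite sum over contour pairs can be
    taken inside, where it becomes the pair weight.\<close>
  have "(\<Sum>jj<3. \<Sum>k<3. eps jj k * T jj k i) = of_real (9 * sqrt 3) * \<i> * of_real (moment A N i j)" for i
  proof -
    have "(\<lambda>m. \<Sum>jj<3. \<Sum>k<3. eps jj k * (inner_coeff A N j k m * Zm jj (m + i) * of_real (mu A (m + i)))) sums
        (\<Sum>jj<3. \<Sum>k<3. eps jj k * T jj k i)"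
      by (intro sums_sum sums_mult Tsums) auto
    moreover have "(\<lambda>m. of_real (9 * sqrt 3) * \<i> * complex_of_real (mom_term A N i j m)) sums
        (of_real (9 * sqrt 3) * \<i> * of_real (moment A N i j))"
      unfolding moment_def by (intro sums_mult sums_of_real summable_sums mom_summable A)
    ultimately show ?thesis unfolding inner_outer_term by (rule sums_unique2)
  qed
  note TS = this
  have "herm_form \<Gamma> t0 t3 n f (monom 1 j) = 1 / (2 * of_real pi * \<i>) * (\<Sum>jj<3. \<Sum>k<3. eps jj k *
      (\<Sum>i\<le>degree f. coeff f i * T jj k i))"
    unfolding herm_form_def
    by (intro arg_cong2[where f = "(*)"] refl sum.cong) (simp only: lessThan_iff inner outer_integral(2)[OF A N G] T_def)
  also have "(\<Sum>jj<3. \<Sum>k<3. eps jj k * (\<Sum>i\<le>degree f. coeff f i * T jj k i))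
      = (\<Sum>i\<le>degree f. coeff f i * (\<Sum>jj<3. \<Sum>k<3. eps jj k * T jj k i))"
  proof -
    have "(\<Sum>jj<3. \<Sum>k<3. eps jj k * (\<Sum>i\<le>degree f. coeff f i * T jj k i))
        = (\<Sum>jj<3. \<Sum>k<3. \<Sum>i\<le>degree f. coeff f i * (eps jj k * T jj k i))"
      by (simp add: sum_distrib_left mult_ac)
    also have "\<dots> = (\<Sum>jj<3. \<Sum>i\<le>degree f. \<Sum>k<3. coeff f i * (eps jj k * T jj k i))"
      by (intro sum.cong refl sum.swap)
    also have "\<dots> = (\<Sum>i\<le>degree f. \<Sum>jj<3. \<Sum>k<3. coeff f i * (eps jj k * T jj k i))"
      by (rule sum.swap)
    finally show ?thesis by (simp add: sum_distrib_left)
  qed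
  finally show ?thesis unfolding TS A_def[symmetric] by (simp add: sum_distrib_left field_simps)
qed

section \<open>Symmetries and string equation of the moments\<close>

lemma mod3_add: "((m + i) mod 3 = (m + j) mod (3::nat)) \<longleftrightarrow> i mod 3 = j mod 3"
proof (induction m)
  case (Suc m)
  have "Suc (m + i) mod 3 = Suc (m + j) mod 3 \<longleftrightarrow> (m + i) mod 3 = (m + j) mod 3"
    unfolding mod_Suc[of "m + i" 3] mod_Suc[of "m + j" 3] by auto
  then show ?case using Suc by simp
qed simp

lemma moment_sym: "moment A N i j = moment A N j i"
  unfolding moment_def mom_term_def by (subst pair_weight_sym) (simp only: mult_ac)

lemma moment_rot: "i mod 3 \<noteq> j mod 3 \<Longrightarrow> moment A N i j = 0"
  unfolding moment_def mom_term_def pair_weight_def by (simp add: mod3_add)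

text \<open>Integration by parts, term by term: \<open>mu_rec\<close> turns A * mu (m + i + 2) into
  (m + i) * mu (m + i - 1). The part with i is the derivative of z^i; the part with m cancels
  against the factorial and shifts the series.\<close>

lemma moment_string:
  assumes A: "A > 0"
  shows "A * moment A N (i + 2) j = N * moment A N i (j + 1) - real i * moment A N (i - 1) j"
proof -
  \<comment> \<open>The factor m makes \<open>u 0\<close> vanish, and \<open>u (Suc m)\<close> is
    the m-th term of the series for N * moment i (j + 1).\<close>
  define u where "u m = - (real m * ((- N) ^ m / fact m * (pair_weight (m + i - 1) (m + j) * mu A (m + i - 1) * mu A (m + j))))" for m
  have "u (Suc m) = N * mom_term A N i (j + 1) m" for m
    unfolding u_def mom_term_def by (simp add: field_simps del: of_nat_Suc)
  moreover have "(\<lambda>m. N * mom_term A N i (j + 1) m) sums (N * moment A N i (j + 1))"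
    unfolding moment_def by (intro sums_mult summable_sums mom_summable A)
  ultimately have "u sums (N * moment A N i (j + 1))"
    using sums_Suc[of u] by (simp add: u_def)
  moreover have "(\<lambda>m. real i * mom_term A N (i - 1) j m) sums (real i * moment A N (i - 1) j)"
    unfolding moment_def by (intro sums_mult summable_sums mom_summable A)
  ultimately have "(\<lambda>m. u m - real i * mom_term A N (i - 1) j m) sums (N * moment A N i (j + 1) - real i * moment A N (i - 1) j)"
    by (rule sums_diff)
  moreover have "u m - real i * mom_term A N (i - 1) j m = A * mom_term A N (i + 2) j m" for m
  proof (cases "m + i")
    \<comment> \<open>The truncated index m + i - 1 is harmless: u has the factor m = 0, and the
      weight at 2 is zero.\<close>
    case 0
    then show ?thesis unfolding u_def mom_term_def pair_weight_def chi3_def by simp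
  next
    case (Suc p)
    define c where "c = (- N) ^ m / fact m * mu A (m + j)"
    have w: "pair_weight (m + (i + 2)) (m + j) = - pair_weight p (m + j)"
    proof -
      have "m + (i + 2) = p + 3" using Suc by simp
      then show ?thesis using pair_weight_left[of p "m + j"] by metis
    qed
    have m: "A * mu A (m + (i + 2)) = (real m + real i) * mu A p"
    proof -
      have "m + (i + 2) = p + 3" using Suc by simp
      moreover have "real m + real i = real (p + 1)" using Suc by simp
      ultimately show ?thesis using mu_rec[OF A, of p] by metis
    qed
    have i: "real i * mom_term A N (i - 1) j m = real i * (c * (pair_weight p (m + j) * mu A p))"
    proof (cases i)
      case (Suc i')
      then have "m + (i - 1) = p" using \<open>m + i = Suc p\<close> by simp
      then show ?thesis unfolding mom_term_def c_def by (simp add: mult_ac)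
    qed simp
    have u: "u m = - (real m * (c * (pair_weight p (m + j) * mu A p)))"
      unfolding u_def c_def using Suc by (simp add: mult_ac)
    have "A * mom_term A N (i + 2) j m = - (c * pair_weight p (m + j) * (A * mu A (m + (i + 2))))"
      unfolding mom_term_def w c_def by (simp add: mult_ac)
    then show ?thesis unfolding i u m by (simp add: algebra_simps)
  qed
  ultimately have "(\<lambda>m. A * mom_term A N (i + 2) j m) sums (N * moment A N i (j + 1) - real i * moment A N (i - 1) j)" by simp
  moreover have "(\<lambda>m. A * mom_term A N (i + 2) j m) sums (A * moment A N (i + 2) j)"
    unfolding moment_def by (intro sums_mult summable_sums mom_summable A)
  ultimately show ?thesis using sums_unique2 by blast
qed

section \<open>The bilinear form on polynomials\<close>

definition mom_form :: "real \<Rightarrow> real \<Rightarrow> complex poly \<Rightarrow> complex poly \<Rightarrow> complex" where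
  "mom_form A N f g = (\<Sum>i\<le>degree f. \<Sum>j\<le>degree g. coeff f i * coeff g j * of_real (moment A N i j))"

lemma sum_degree_extend:
  fixes f :: "complex poly"
  assumes "degree f \<le> n" shows "(\<Sum>i\<le>n. coeff f i * c i) = (\<Sum>i\<le>degree f. coeff f i * c i)"
  using assms by (intro sum.mono_neutral_right) (auto simp: coeff_eq_0)

lemma mom_form_bound:
  assumes "degree f \<le> n"
  shows "mom_form A N f g = (\<Sum>i\<le>n. coeff f i * (\<Sum>j\<le>degree g. coeff g j * of_real (moment A N i j)))"
  unfolding sum_degree_extend[OF assms] mom_form_def by (simp add: sum_distrib_left mult.assoc)

lemma mom_form_add: "mom_form A N (f + g) h = mom_form A N f h + mom_form A N g h"
proof -
  define n where "n = max (degree f) (degree g)"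
  have "degree (f + g) \<le> n" "degree f \<le> n" "degree g \<le> n" unfolding n_def by (auto intro: degree_add_le)
  then show ?thesis by (simp add: mom_form_bound[of _ n] algebra_simps sum.distrib)
qed

lemma mom_form_smult: "mom_form A N (smult c f) h = c * mom_form A N f h"
  using degree_smult_le[of c f]
  by (simp add: mom_form_bound[of _ "degree f"] sum_distrib_left mult.assoc)

lemma mom_form_sym: "mom_form A N f g = mom_form A N g f"
  unfolding mom_form_def by (subst sum.swap) (simp add: mult_ac moment_sym)

lemma mom_form_monom: "mom_form A N (monom 1 i) (monom 1 j) = of_real (moment A N i j)"
proof -
  have "(\<Sum>k\<le>n. (if n = k then 1 else 0) * c k) = c n" for n and c :: "nat \<Rightarrow> complex"
  proof -
    have "(\<Sum>k\<le>n. (if n = k then 1 else 0) * c k) = (\<Sum>k\<in>{n}. c k)"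
      by (intro sum.mono_neutral_cong_right) auto
    then show ?thesis by simp
  qed
  from this[of i] this[of j] show ?thesis
    unfolding mom_form_def by (simp add: degree_monom_eq sum_distrib_left[symmetric] mult.assoc)
qed

lemma poly_monom_induct:
  fixes f :: "complex poly"
  assumes "\<And>i. P (monom 1 i)" "\<And>c f. P f \<Longrightarrow> P (smult c f)" "\<And>f g. P f \<Longrightarrow> P g \<Longrightarrow> P (f + g)"
  shows "P f"
proof -
  have "P 0" using assms(2)[OF assms(1), of 0 0] by simp
  have m: "P (monom c i)" for c i using assms(2)[OF assms(1), of c i] by (simp add: smult_monom)
  have "P (\<Sum>i\<le>n. monom (coeff f i) i)" for n
    by (induction n) (use m assms(3) in auto)
  then show ?thesis using poly_as_sum_of_monoms by metis
qed

lemma mom_form_string_form: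
  assumes N: "N > 0" and t: "t > 0"
  shows "string_form (mom_form (N * t) N) N t"
proof
  let ?B = "mom_form (N * t) N"
  have A: "N * t > 0" using assms by simp
  have addr: "?B h (f + g) = ?B h f + ?B h g" for f g h
    using mom_form_add mom_form_sym by metis
  have smultr: "?B h (smult c f) = c * ?B h f" for c f h
    using mom_form_smult mom_form_sym by metis
  show "?B (pderiv f) g = of_real N * (?B f (pCons 0 g) - of_real t * ?B (pCons 0 (pCons 0 f)) g)" for f g
  proof (induction f rule: poly_monom_induct)
    case (1 i)
    show ?case
    proof (induction g rule: poly_monom_induct)
      case (1 j)
      have "?B (pderiv (monom 1 i)) (monom 1 j) = of_nat i * of_real (moment (N * t) N (i - 1) j)"
      proof -
        have "pderiv (monom (1::complex) i) = smult (of_nat i) (monom 1 (i - 1))"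
          by (simp add: pderiv_monom smult_monom)
        then show ?thesis by (simp only: mom_form_smult mom_form_monom)
      qed
      moreover have "N * t * moment (N * t) N (i + 2) j = N * moment (N * t) N i (j + 1) - real i * moment (N * t) N (i - 1) j"
        by (rule moment_string[OF A])
      then have "of_real (real i * moment (N * t) N (i - 1) j)
          = (of_real (N * (moment (N * t) N i (j + 1) - t * moment (N * t) N (i + 2) j)) :: complex)"
        by (subst of_real_eq_iff) (simp add: algebra_simps)
      moreover have "pCons 0 (monom (1::complex) j) = monom 1 (j + 1)" "pCons 0 (pCons 0 (monom (1::complex) i)) = monom 1 (i + 2)"
        by (simp_all add: monom_Suc)
      ultimately show ?case by (simp only: mom_form_monom) simp
    next
      case (2 c g)
      have "pCons 0 (smult c g) = smult c (pCons 0 g)" by simp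
      then show ?case using 2 by (simp only: smultr) (simp add: algebra_simps)
    next
      case (3 g h)
      have "pCons 0 (g + h) = pCons 0 g + pCons 0 h" by simp
      then show ?case using 3 by (simp only: addr) (simp add: algebra_simps)
    qed
  next
    case (2 c f)
    have "pCons 0 (pCons 0 (smult c f)) = smult c (pCons 0 (pCons 0 f))" by simp
    then show ?case using 2 by (simp only: mom_form_smult pderiv_smult) (simp add: algebra_simps)
  next
    case (3 f h)
    have "pCons 0 (pCons 0 (f + h)) = pCons 0 (pCons 0 f) + pCons 0 (pCons 0 h)" by simp
    then show ?case using 3 by (simp only: mom_form_add pderiv_add) (simp add: algebra_simps)
  qed
qed (use assms in \<open>auto simp: mom_form_add mom_form_smult mom_form_monom moment_rot intro: mom_form_sym\<close>)

lemma herm_form_mom_form: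
  assumes "t0 > 0" "t3 > 0" "n > 0" "admissible_contours \<Gamma>"
  defines "N \<equiv> real n / t0"
  shows "herm_form \<Gamma> t0 t3 n f (monom 1 j) = of_real (9 * sqrt 3 / (2 * pi)) * mom_form (N * t3) N f (monom 1 j)"
proof -
  have "mom_form (N * t3) N f (monom 1 j) = (\<Sum>i\<le>degree f. coeff f i * of_real (moment (N * t3) N i j))"
  proof (induction f rule: poly_monom_induct)
    case (1 i)
    show ?case unfolding mom_form_monom
      using sum_degree_extend[of "monom 1 i" i "\<lambda>k. of_real (moment (N * t3) N k j)"]
      by (simp add: degree_monom_eq if_distrib[of "\<lambda>x. x * _"] cong: if_cong)
  next
    case (2 c f)
    then show ?case unfolding mom_form_smult by (simp add: sum_distrib_left mult.assoc)
  next
    case (3 f g)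
    define n where "n = max (degree f) (degree g)"
    have "degree (f + g) \<le> n" "degree f \<le> n" "degree g \<le> n" unfolding n_def by (auto intro: degree_add_le)
    from this[THEN sum_degree_extend, symmetric] show ?case unfolding mom_form_add 3
      by (simp add: distrib_right sum.distrib)
  qed
  then show ?thesis using herm_form_moment[OF assms(1-4)] unfolding N_def by simp
qed

section \<open>The first ratio of norms\<close>

definition s_coeff :: "nat \<Rightarrow> real" where
  "s_coeff m = (- 1) ^ m / fact m * (pair_weight m m * mu 1 m * mu 1 m)"

text \<open>The lowest moment after rescaling to A = 1, as a function of the single remaining
  parameter.\<close>

definition mom_gen :: "real \<Rightarrow> real" where "mom_gen x = (\<Sum>m. s_coeff m * x ^ m)"

definition mom_gen' :: "real \<Rightarrow> real" where "mom_gen' x = (\<Sum>m. diffs s_coeff m * x ^ m)"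

lemma s_coeff_term: "s_coeff m * x ^ m = mom_term 1 x 0 0 m"
  unfolding s_coeff_def mom_term_def by (subst (2) power_minus) (simp add: mult_ac)

lemma s_coeff_summable: "summable (\<lambda>m. s_coeff m * x ^ m)"
  unfolding s_coeff_term by (intro mom_summable) simp

lemma diffs_s_coeff_summable: "summable (\<lambda>m. diffs s_coeff m * x ^ m)"
  using termdiff_converges_all[OF s_coeff_summable] .

lemma mom_gen_moment: "mom_gen x = moment 1 x 0 0"
  unfolding mom_gen_def moment_def s_coeff_term ..

text \<open>Differentiation in the parameter brings down - z w under the double integral.\<close>

lemma mom_gen'_moment: "mom_gen' x = - moment 1 x 1 1"
proof -
  have "diffs s_coeff m * x ^ m = - mom_term 1 x 1 1 m" for m
  proof -
    have "real (Suc m) / fact (Suc m) = 1 / fact m" by (simp add: divide_simps)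
    then have "diffs s_coeff m * x ^ m = 1 / fact m * ((- 1) ^ Suc m * (pair_weight (Suc m) (Suc m) * mu 1 (Suc m) * mu 1 (Suc m)) * x ^ m)"
    proof -
      have "diffs s_coeff m * x ^ m = real (Suc m) / fact (Suc m) * ((- 1) ^ Suc m * (pair_weight (Suc m) (Suc m) * mu 1 (Suc m) * mu 1 (Suc m)) * x ^ m)"
        unfolding s_coeff_def diffs_def by (simp only: divide_inverse mult_ac)
      then show ?thesis unfolding \<open>real (Suc m) / fact (Suc m) = 1 / fact m\<close> .
    qed
    then show ?thesis unfolding mom_term_def power_minus[of x m] by (simp add: mult_ac)
  qed
  then show ?thesis unfolding mom_gen'_def moment_def by (simp add: suminf_minus mom_summable)
qed

lemma s_coeff_rec: "real (m + 3) * real (m + 2) * s_coeff (m + 3) = - (real (m + 1) * s_coeff m)"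
proof -
  have f: "(fact (m + 3) :: real) = real (m + 3) * (real (m + 2) * (real (m + 1) * fact m))"
    by (simp add: numeral_3_eq_3 numeral_2_eq_2 algebra_simps)
  have w: "pair_weight (m + 3) (m + 3) = pair_weight m m"
    using pair_weight_left[of m "m + 3"] pair_weight_left[of m m] pair_weight_sym[of m "m + 3"] by simp
  have mu: "mu 1 (m + 3) = real (m + 1) * mu 1 m" using mu_rec[of 1 m] by simp
  show ?thesis unfolding s_coeff_def f w mu by (simp add: divide_simps power_add del: of_nat_add)
qed

lemma mom_gen_deriv: "(mom_gen has_real_derivative mom_gen' x) (at x)"
  unfolding mom_gen_def mom_gen'_def by (rule termdiffs_strong_converges_everywhere[OF s_coeff_summable])

text \<open>The three-step recursion of the coefficients is equivalent to the linear equation S'' =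
  - x^2 S' - x S.\<close>

lemma mom_gen'_deriv: "(mom_gen' has_real_derivative - (x\<^sup>2 * mom_gen' x) - x * mom_gen x) (at x)"
proof -
  have d: "(mom_gen' has_real_derivative (\<Sum>m. diffs (diffs s_coeff) m * x ^ m)) (at x)"
    unfolding mom_gen'_def by (rule termdiffs_strong_converges_everywhere[OF diffs_s_coeff_summable])
  have dd: "diffs (diffs s_coeff) 0 = 0" "diffs (diffs s_coeff) (Suc m) = - (real (m + 1) * s_coeff m)" for m
  proof -
    show "diffs (diffs s_coeff) 0 = 0"
      unfolding diffs_def s_coeff_def pair_weight_def chi3_def by simp
    show "diffs (diffs s_coeff) (Suc m) = - (real (m + 1) * s_coeff m)"
      unfolding s_coeff_rec[symmetric] diffs_def by (simp add: numeral_3_eq_3 numeral_2_eq_2)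
  qed
  have "(\<lambda>m. diffs (diffs s_coeff) (Suc m) * x ^ Suc m) sums (- (x\<^sup>2 * mom_gen' x) - x * mom_gen x)"
  proof -
    have "(\<lambda>m. s_coeff m * x ^ m) sums mom_gen x" unfolding mom_gen_def by (rule summable_sums[OF s_coeff_summable])
    moreover have "(\<lambda>m. real m * s_coeff m * x ^ m) sums (x * mom_gen' x)"
    proof -
      have "(\<lambda>m. x * (diffs s_coeff m * x ^ m)) sums (x * mom_gen' x)"
        unfolding mom_gen'_def by (intro sums_mult summable_sums diffs_s_coeff_summable)
      moreover have "x * (diffs s_coeff m * x ^ m) = real (Suc m) * s_coeff (Suc m) * x ^ Suc m" for m
        unfolding diffs_def by simp
      ultimately have "(\<lambda>m. real (Suc m) * s_coeff (Suc m) * x ^ Suc m) sums (x * mom_gen' x)" by simp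
      from sums_Suc[OF this] show ?thesis by simp
    qed
    ultimately have "(\<lambda>m. - x * (real m * s_coeff m * x ^ m + s_coeff m * x ^ m)) sums (- x * (x * mom_gen' x + mom_gen x))"
      by (intro sums_mult sums_add)
    moreover have "- x * (x * mom_gen' x + mom_gen x) = - (x\<^sup>2 * mom_gen' x) - x * mom_gen x"
      by (simp add: algebra_simps power2_eq_square)
    moreover have "- x * (real m * s_coeff m * x ^ m + s_coeff m * x ^ m) = - (real (m + 1) * s_coeff m) * x ^ Suc m" for m
      by (simp add: algebra_simps)
    ultimately show ?thesis unfolding dd by (simp only:)
  qed
  from sums_Suc[OF this] have "(\<Sum>m. diffs (diffs s_coeff) m * x ^ m) = - (x\<^sup>2 * mom_gen' x) - x * mom_gen x"
    unfolding dd by (simp add: sums_iff)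
  then show ?thesis using d by simp
qed

lemma mom_gen_at_0: "mom_gen 0 > 0" "mom_gen' 0 > 0"
proof -
  have "mu 1 m > 0" for m by (intro mu_pos) simp
  then have "s_coeff 0 > 0" "s_coeff 1 > 0"
    unfolding s_coeff_def pair_weight_def chi3_def sgn3_def by auto
  then show "mom_gen 0 > 0" "mom_gen' 0 > 0"
    unfolding mom_gen_def mom_gen'_def powser_zero by (auto simp: diffs_def)
qed

text \<open>With K = S' + x^2 S one has K' = x S and (exp (x^3 / 3) S)' = exp (x^3 / 3) K, so
  positivity of S and K at 0 feeds on itself.\<close>

lemma mom_gen_K_deriv: "((\<lambda>x. mom_gen' x + x\<^sup>2 * mom_gen x) has_real_derivative x * mom_gen x) (at x)"
proof -
  have "((\<lambda>x. x\<^sup>2) has_real_derivative 2 * x) (at x)" using DERIV_pow[of 2 x UNIV] by simp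
  from DERIV_add[OF mom_gen'_deriv DERIV_mult[OF this mom_gen_deriv]] show ?thesis
    by (rule DERIV_cong) (simp add: algebra_simps)
qed

text \<open>Up to a first zero c of S, K would be nondecreasing and hence positive, so exp (x^3 / 3)
  S would strictly increase and could not vanish at c.\<close>

lemma mom_gen_pos: assumes b: "0 \<le> b" shows "mom_gen b > 0"
proof (rule ccontr)
  assume "\<not> mom_gen b > 0"
  have cont: "continuous_on I mom_gen" for I
    using mom_gen_deriv by (meson DERIV_continuous_on has_field_derivative_at_within)
  have "continuous_on {0..b} (\<lambda>t. mom_gen (b - t))"
    by (rule continuous_on_compose2[OF cont[of UNIV]]) (auto intro!: continuous_intros)
  then obtain s where s: "0 \<le> s" "s < b" "mom_gen (b - s) = 0" "\<And>t. s < t \<Longrightarrow> t \<le> b \<Longrightarrow> 0 < mom_gen (b - t)"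
    using last_crossing[of 0 b "\<lambda>t. mom_gen (b - t)" 0] b \<open>\<not> mom_gen b > 0\<close> mom_gen_at_0 by auto
  define c where "c = b - s"
  have c: "0 < c" "mom_gen c = 0" using s unfolding c_def by auto
  have Sp: "0 \<le> mom_gen x" if "0 \<le> x" "x \<le> c" for x
    using s(4)[of "b - x"] s(3) that unfolding c_def by (cases "x = b - s") auto
  have K: "mom_gen' x + x\<^sup>2 * mom_gen x > 0" if "0 \<le> x" "x \<le> c" for x
  proof -
    have "mom_gen' 0 + 0\<^sup>2 * mom_gen 0 \<le> mom_gen' x + x\<^sup>2 * mom_gen x"
    proof (rule DERIV_nonneg_imp_nondecreasing[OF that(1)])
      show "\<exists>y. ((\<lambda>x. mom_gen' x + x\<^sup>2 * mom_gen x) has_real_derivative y) (at u) \<and> 0 \<le> y" if "0 \<le> u" "u \<le> x" for u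
        using mom_gen_K_deriv[of u] Sp[of u] that \<open>x \<le> c\<close> by (intro exI[of _ "u * mom_gen u"] conjI mult_nonneg_nonneg) auto
    qed
    then show ?thesis using mom_gen_at_0 by simp
  qed
  have H: "((\<lambda>x. exp (x ^ 3 / 3) * mom_gen x) has_real_derivative exp (x ^ 3 / 3) * (mom_gen' x + x\<^sup>2 * mom_gen x)) (at x)" for x
  proof -
    have "((\<lambda>x. exp (x ^ 3 / 3)) has_real_derivative exp (x ^ 3 / 3) * (3 * x\<^sup>2 / 3)) (at x)"
      by (auto intro!: derivative_eq_intros)
    from DERIV_mult[OF this mom_gen_deriv] show ?thesis by (rule DERIV_cong) (simp add: algebra_simps)
  qed
  have "exp (0 ^ 3 / 3) * mom_gen 0 < exp (c ^ 3 / 3) * mom_gen c"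
  proof (rule DERIV_pos_imp_increasing[OF c(1)])
    show "\<exists>y. ((\<lambda>x. exp (x ^ 3 / 3) * mom_gen x) has_real_derivative y) (at u) \<and> 0 < y" if "0 \<le> u" "u \<le> c" for u
      using H[of u] K[OF that] by (intro exI[of _ "exp (u ^ 3 / 3) * (mom_gen' u + u\<^sup>2 * mom_gen u)"] conjI mult_pos_pos) auto
  qed
  then show False using c mom_gen_at_0 by simp
qed

lemma mom_gen_K_pos: assumes "0 \<le> x" shows "mom_gen' x + x\<^sup>2 * mom_gen x > 0"
proof -
  have "mom_gen' 0 + 0\<^sup>2 * mom_gen 0 \<le> mom_gen' x + x\<^sup>2 * mom_gen x"
  proof (rule DERIV_nonneg_imp_nondecreasing[OF assms])
    show "\<exists>y. ((\<lambda>x. mom_gen' x + x\<^sup>2 * mom_gen x) has_real_derivative y) (at u) \<and> 0 \<le> y" if "0 \<le> u" "u \<le> x" for u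
      using mom_gen_K_deriv[of u] mom_gen_pos[of u] that by (intro exI[of _ "u * mom_gen u"] conjI mult_nonneg_nonneg) auto
  qed
  then show ?thesis using mom_gen_at_0 by simp
qed

text \<open>The scaling that makes A = 1 turns the parameter of \<open>mom_gen\<close> into x with
  x^3 = N / t^2 = T, hence the cube root.\<close>

definition X_init :: "real \<Rightarrow> real" where
  "X_init T = - mom_gen' (root 3 T) / ((root 3 T)\<^sup>2 * mom_gen (root 3 T))"

text \<open>The bound is positivity of K divided by x^2 S.\<close>

lemma X_init_less_1: assumes "T > 0" shows "X_init T < 1"
proof -
  have "0 < root 3 T" using assms by simp
  then have "0 < (root 3 T)\<^sup>2 * mom_gen (root 3 T)" "- mom_gen' (root 3 T) < 1 * ((root 3 T)\<^sup>2 * mom_gen (root 3 T))"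
    using mom_gen_pos[of "root 3 T"] mom_gen_K_pos[of "root 3 T"] by (auto intro: mult_pos_pos)
  then show ?thesis unfolding X_init_def by (simp only: pos_divide_less_eq)
qed

text \<open>A logarithmic derivative of a solution of a second-order linear equation satisfies a
  Riccati equation; the rest is the change of variable T = x^3.\<close>

lemma X_init_deriv:
  assumes T: "T > 0"
  shows "(X_init has_real_derivative ((1 - X_init T) * (1 / T - X_init T) - X_init T / T) / 3) (at T)"
proof -
  define x where "x = root 3 T"
  define Y where "Y y = - mom_gen' y / (y\<^sup>2 * mom_gen y)" for y
  have x: "x > 0" "x ^ 3 = T" unfolding x_def using T by auto
  have Sx: "mom_gen x > 0" using mom_gen_pos x by simp
  have X: "X_init = (\<lambda>T. Y (root 3 T))" unfolding X_init_def Y_def ..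
  have "((\<lambda>y. y\<^sup>2) has_real_derivative 2 * x) (at x)" using DERIV_pow[of 2 x UNIV] by simp
  from DERIV_divide[OF DERIV_minus[OF mom_gen'_deriv] DERIV_mult[OF this mom_gen_deriv]]
  have "(Y has_real_derivative ((- (- (x\<^sup>2 * mom_gen' x) - x * mom_gen x)) * (x\<^sup>2 * mom_gen x) - (- mom_gen' x) * (2 * x * mom_gen x + mom_gen' x * x\<^sup>2)) / ((x\<^sup>2 * mom_gen x) * (x\<^sup>2 * mom_gen x))) (at x)"
    unfolding Y_def using x Sx by simp
  then have "(Y has_real_derivative - x\<^sup>2 * Y x + 1 / x - 2 * Y x / x + x\<^sup>2 * (Y x)\<^sup>2) (at x)"
    by (rule DERIV_cong) (use x(1) Sx in \<open>simp add: Y_def divide_simps, simp add: algebra_simps power2_eq_square power4_eq_xxxx\<close>)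
  moreover have "(root 3 has_real_derivative inverse (3 * x\<^sup>2)) (at T)"
    using DERIV_real_root[of 3 T] T unfolding x_def by (simp add: numeral_2_eq_2)
  ultimately have "((\<lambda>T. Y (root 3 T)) has_real_derivative (- x\<^sup>2 * Y x + 1 / x - 2 * Y x / x + x\<^sup>2 * (Y x)\<^sup>2) * inverse (3 * x\<^sup>2)) (at T)"
    unfolding x_def by (rule DERIV_chain2)
  moreover have "(- x\<^sup>2 * y + 1 / x - 2 * y / x + x\<^sup>2 * y\<^sup>2) * inverse (3 * x\<^sup>2) = ((1 - y) * (1 / x ^ 3 - y) - y / x ^ 3) / 3" for y
    using x(1) by (simp add: field_simps power2_eq_square power3_eq_cube)
  ultimately have "((\<lambda>T. Y (root 3 T)) has_real_derivative ((1 - Y x) * (1 / T - Y x) - Y x / T) / 3) (at T)"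
    unfolding x(2) by simp
  then show ?thesis unfolding X x_def by simp
qed

lemma moment_scale:
  assumes "s > 0"
  shows "moment (s ^ 3) N i j = moment 1 (N / s\<^sup>2) i j / s ^ (i + j + 2)"
proof -
  have "mom_term (s ^ 3) N i j m = mom_term 1 (N / s\<^sup>2) i j m / s ^ (i + j + 2)" for m
  proof -
    have "(- (N / s\<^sup>2)) ^ m = (- N) ^ m / (s ^ m * s ^ m)"
    proof -
      have "- (N / s\<^sup>2) = (- N) / s\<^sup>2" by (rule minus_divide_left)
      moreover have "(s\<^sup>2) ^ m = s ^ m * s ^ m" unfolding power2_eq_square by (rule power_mult_distrib)
      ultimately show ?thesis by (metis power_divide)
    qed
    then show ?thesis
      unfolding mom_term_def mu_scale[OF assms] by (simp add: power_add)
  qed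
  then have "mom_term (s ^ 3) N i j = (\<lambda>m. mom_term 1 (N / s\<^sup>2) i j m / s ^ (i + j + 2))" ..
  then show ?thesis unfolding moment_def by (simp only: suminf_divide[OF mom_summable(2)[OF zero_less_one]])
qed

lemma moment_ratio:
  assumes N: "N > 0" and t: "t > 0"
  shows "moment (N * t) N 0 0 > 0"
    "moment (N * t) N 1 1 = X_init (N / t\<^sup>2) / t\<^sup>2 * moment (N * t) N 0 0"
proof -
  define s where "s = root 3 (N * t)"
  define x where "x = N / s\<^sup>2"
  have s: "s > 0" "s ^ 3 = N * t" unfolding s_def using N t by auto
  have x: "x > 0" unfolding x_def using N s by simp
  have "x ^ 3 = N ^ 3 / (s ^ 3)\<^sup>2" unfolding x_def by (simp add: power_divide flip: power_mult)
  also have "\<dots> = N / t\<^sup>2" unfolding s(2) using N t by (simp add: power2_eq_square power3_eq_cube field_simps)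
  finally have xT: "root 3 (N / t\<^sup>2) = x" 
    using x real_root_power_cancel[of 3 x] by simp
  have Sx: "mom_gen x > 0" using mom_gen_pos x by simp
  show "moment (N * t) N 0 0 > 0"
    unfolding s(2)[symmetric] moment_scale[OF s(1)] x_def[symmetric] mom_gen_moment[symmetric] using Sx s by simp
  have m1: "moment (N * t) N 1 1 = - mom_gen' x / s ^ 4"
    unfolding s(2)[symmetric] moment_scale[OF s(1)] x_def[symmetric] mom_gen'_moment by (simp add: power4_eq_xxxx)
  have m0: "moment (N * t) N 0 0 = mom_gen x / s\<^sup>2"
    unfolding s(2)[symmetric] moment_scale[OF s(1)] x_def[symmetric] mom_gen_moment[symmetric] by (simp add: power2_eq_square)
  have s4: "s ^ 4 = t\<^sup>2 * x\<^sup>2 * s\<^sup>2"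
  proof -
    have "(t * x * s\<^sup>2) = s ^ 3" unfolding s(2) x_def using s(1) by (simp add: field_simps)
    then have "t * x = s" using s(1) by (simp add: power2_eq_square power3_eq_cube)
    then have "t\<^sup>2 * x\<^sup>2 = s\<^sup>2" by (metis power_mult_distrib)
    then show ?thesis by (simp only: power4_eq_xxxx power2_eq_square mult.assoc)
  qed
  show "moment (N * t) N 1 1 = X_init (N / t\<^sup>2) / t\<^sup>2 * moment (N * t) N 0 0"
    unfolding X_init_def xT m1 m0 s4 using s(1) x t Sx by simp
qed

section \<open>Orthogonal polynomials and their zeros\<close>

interpretation start: dPI_flow X_init
  by unfold_locales (fact X_init_deriv X_init_less_1)+

text \<open>Tracking at the top index n and T = n / \<kappa> covers every k \<le> n at this same T,
  and \<open>fstar\<close> is largest at k = n.\<close>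

lemma start_X_bounds:
  assumes "0 < \<kappa>" "\<kappa> < 1 / 8" "0 < \<eta>"
  shows "\<forall>\<^sub>F n in sequentially. \<forall>k. 1 \<le> k \<longrightarrow> k \<le> n \<longrightarrow>
    0 < start.X k (real n / \<kappa>) \<and> start.X k (real n / \<kappa>) \<le> fstar \<kappa> + \<eta>"
proof -
  have "8 < 1 / \<kappa>" using assms by (simp add: field_simps)
  from start.eventually_tracking_all[OF this assms(3)]
  obtain K where K: "\<And>n T. K \<le> n \<Longrightarrow> 1 / \<kappa> * real n \<le> T \<Longrightarrow> start.tracking \<eta> n T"
    unfolding start.eventually_tracking_def by blast
  have "0 < start.X k (real n / \<kappa>) \<and> start.X k (real n / \<kappa>) \<le> fstar \<kappa> + \<eta>" if "K \<le> n" "1 \<le> k" "k \<le> n" for n k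
  proof -
    have "start.tracking \<eta> n (real n / \<kappa>)" by (rule K) (use that in auto)
    then have "0 < start.X k (real n / \<kappa>)" "\<bar>start.E k (real n / \<kappa>)\<bar> \<le> \<eta>"
      using that unfolding start.tracking_def by auto
    moreover have "real k / (real n / \<kappa>) \<le> \<kappa>" using that assms by (simp add: divide_simps)
    then have "fstar (real k / (real n / \<kappa>)) \<le> fstar \<kappa>" by (rule fstar_mono)
    ultimately show ?thesis unfolding start.E_def by linarith
  qed
  then show ?thesis unfolding eventually_sequentially by blast
qed

lemma monic_OP_from_ratios:
  assumes t: "0 < t0" "0 < t3" "0 < n" and \<Gamma>: "admissible_contours \<Gamma>"
    and X: "\<And>k. 1 \<le> k \<Longrightarrow> k \<le> n \<Longrightarrow> 0 < start.X k (real n / (t0 * t3\<^sup>2)) \<and> start.X k (real n / (t0 * t3\<^sup>2)) \<le> b"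
  shows "\<exists>P. is_monic_OP \<Gamma> t0 t3 n P"
    and "is_monic_OP \<Gamma> t0 t3 n P \<Longrightarrow> poly P z = 0 \<Longrightarrow> \<exists>s. 0 \<le> s \<and> s \<le> 27 / 4 * (b\<^sup>2 / t3 ^ 3) \<and> z ^ 3 = of_real s"
proof -
  define N T where "N = real n / t0" and "T = real n / (t0 * t3\<^sup>2)"
  define B where "B = mom_form (N * t3) N"
  define x where "x k = start.X k T" for k
  define h0 where "h0 = complex_of_real (moment (N * t3) N 0 0)"
  have N: "0 < N" unfolding N_def using t by simp
  have NT: "N / t3\<^sup>2 = T" unfolding N_def T_def using t by (simp add: field_simps)
  interpret sf: string_form B N t3 unfolding B_def by (rule mom_form_string_form) (use N t in auto)
  have xp: "0 < x k \<and> x k \<le> b" if "1 \<le> k" "k \<le> n" for k using X[OF that] unfolding x_def T_def .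
  have x0: "x 0 = 0" unfolding x_def by simp
  have xnz: "x k \<noteq> 0" if "1 \<le> k" "k \<le> n" for k using xp[OF that] by simp
  have rec: "x (Suc k) = 1 - (real k * t3\<^sup>2 / N) / x k - x (k - 1)" if "1 \<le> k" "k \<le> n" for k
  proof -
    define j where "j = k - 1"
    have k: "k = Suc j" using that(1) unfolding j_def by simp
    have "real k * t3\<^sup>2 / N = real k / T" using N t unfolding NT[symmetric] by simp
    then show ?thesis unfolding x_def k by simp
  qed
  have m0: "(1::complex poly) = monom 1 0" "[:0, 1::complex:] = monom 1 1" by (simp_all add: monom_Suc)
  have B00: "B 1 1 = h0" unfolding m0 B_def h0_def by (rule mom_form_monom)
  have h0: "h0 \<noteq> 0" unfolding h0_def using moment_ratio(1)[OF N t(2)] by simp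
  have B11: "B [:0, 1:] [:0, 1:] = of_real (x 1 / t3\<^sup>2) * h0"
    unfolding m0 B_def h0_def mom_form_monom moment_ratio(2)[OF N t(2)] NT x_def by simp
  note orth = sf.orthogonal[OF x0 xnz rec B00 h0 B11]
  note uniq = sf.orthogonal_unique[OF x0 xnz rec B00 h0 B11]
  have OP: "is_monic_OP \<Gamma> t0 t3 n P \<longleftrightarrow> degree P = n \<and> lead_coeff P = 1 \<and> (\<forall>j<n. B P (monom 1 j) = 0)" for P
    unfolding is_monic_OP_def herm_form_mom_form[OF t \<Gamma>] B_def N_def by simp
  define P0 where "P0 = star_poly (sf.rec_coeff x) n"
  have "is_monic_OP \<Gamma> t0 t3 n P0"
    unfolding OP P0_def using orth[of n] star_poly_monic[of "sf.rec_coeff x" n] by auto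
  then show "\<exists>P. is_monic_OP \<Gamma> t0 t3 n P" ..
  assume P: "is_monic_OP \<Gamma> t0 t3 n P" "poly P z = 0"
  \<comment> \<open>By uniqueness every monic orthogonal polynomial is the star polynomial, so the
    zero bound holds for all of them.\<close>
  then have "P = P0" unfolding OP P0_def using uniq[where Q = P] by auto
  have "0 < sf.rec_coeff x k \<and> sf.rec_coeff x k \<le> b\<^sup>2 / t3 ^ 3" if "2 \<le> k" "k < n" for k
  proof -
    have 1: "0 < x k" "x k \<le> b" "0 < x (k - 1)" "x (k - 1) \<le> b"
      using xp[of k] xp[of "k - 1"] that by auto
    then have "x k * x (k - 1) \<le> b * b" by (intro mult_mono) auto
    then show ?thesis unfolding sf.rec_coeff_def using 1 t by (simp add: divide_right_mono power2_eq_square)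
  qed
  then show "\<exists>s. 0 \<le> s \<and> s \<le> 27 / 4 * (b\<^sup>2 / t3 ^ 3) \<and> z ^ 3 = of_real s"
    using P(2) t(2) unfolding \<open>P = P0\<close> P0_def by (intro star_poly_zeros) auto
qed

section \<open>The star and its neighbourhoods\<close>

lemma x_star_pos: "0 < t0 \<Longrightarrow> 0 < t3 \<Longrightarrow> 0 < x_star t0 t3"
  unfolding x_star_def by simp

text \<open>The factor 27 / 4 multiplies the limiting bound f^2 / t3^3 of the recurrence
  coefficients, matching \<open>star_poly_zeros\<close>.\<close>

lemma x_star_cube:
  assumes "0 < t0" "0 < t3"
  shows "x_star t0 t3 ^ 3 = 27 / 4 * ((fstar (t0 * t3\<^sup>2))\<^sup>2 / t3 ^ 3)"
proof -
  define y where "y = 1 - sqrt (1 - 8 * t0 * t3\<^sup>2)"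
  have y: "y > 0" unfolding y_def using assms by simp
  have "(y powr (2 / 3)) ^ 3 = (y powr (2 / 3)) powr real 3"
    by (rule powr_realpow[symmetric]) (use y in simp)
  also have "\<dots> = y powr (2 / 3 * real 3)" by (rule powr_powr)
  also have "\<dots> = y\<^sup>2" using y by simp
  finally show ?thesis
    using assms unfolding x_star_def y_def[symmetric] power_mult_distrib
    by (simp add: fstar_def y_def power_divide mult.assoc)
qed

lemma Sigma1_segments:
  assumes "x_star t0 t3 > 0"
  shows "Sigma1 t0 t3 = (\<Union>j<3. closed_segment 0 (exp (2 * of_real pi * \<i> / 3) ^ j * of_real (x_star t0 t3)))"
proof -
  define x w where "x = x_star t0 t3" and "w = exp (2 * of_real pi * \<i> / 3 :: complex)"
  have x: "x > 0" unfolding x_def by (rule assms)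
  have w: "w ^ 3 = 1" 
  proof -
    have "w ^ 3 = exp (of_nat 3 * (2 * of_real pi * \<i> / 3))" unfolding w_def by (rule exp_of_nat_mult[symmetric])
    also have "of_nat 3 * (2 * of_real pi * \<i> / 3) = 2 * of_real pi * \<i>" by simp
    finally show ?thesis by (simp only: exp_two_pi_i)
  qed
  have wj: "(w ^ j) ^ 3 = 1" for j using w by (metis power_mult mult.commute power_one)
  have seg: "closed_segment 0 (w ^ j * of_real x) = (\<lambda>u. w ^ j * of_real u) ` {0..x}" for j
  proof
    show "closed_segment 0 (w ^ j * of_real x) \<subseteq> (\<lambda>u. w ^ j * of_real u) ` {0..x}"
    proof
      fix z assume "z \<in> closed_segment 0 (w ^ j * of_real x)"
      then obtain u where "0 \<le> u" "u \<le> 1" "z = u *\<^sub>R (w ^ j * of_real x)"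
        by (auto simp: closed_segment_def)
      then show "z \<in> (\<lambda>u. w ^ j * of_real u) ` {0..x}"
        using x by (intro image_eqI[of _ _ "u * x"]) (auto simp: scaleR_conv_of_real mult_left_le_one_le)
    qed
    show "(\<lambda>u. w ^ j * of_real u) ` {0..x} \<subseteq> closed_segment 0 (w ^ j * of_real x)"
    proof
      fix z assume "z \<in> (\<lambda>u. w ^ j * of_real u) ` {0..x}"
      then obtain u where u: "0 \<le> u" "u \<le> x" "z = w ^ j * of_real u" by auto
      then have "z = (u / x) *\<^sub>R (w ^ j * of_real x)" using x by (simp add: scaleR_conv_of_real)
      moreover have "0 \<le> u / x" "u / x \<le> 1" using u x by auto
      ultimately show "z \<in> closed_segment 0 (w ^ j * of_real x)" by (auto simp: closed_segment_def)
    qed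
  qed
  have "z ^ 3 \<in> complex_of_real ` {0..x ^ 3} \<longleftrightarrow> (\<exists>j<3. z \<in> (\<lambda>u. w ^ j * of_real u) ` {0..x})" for z
  proof
    assume "z ^ 3 \<in> complex_of_real ` {0..x ^ 3}"
    then obtain r where r: "0 \<le> r" "r \<le> x ^ 3" "z ^ 3 = of_real r" by auto
    define u where "u = root 3 r"
    have u: "0 \<le> u" "u ^ 3 = r" unfolding u_def using r by auto
    have ux: "u \<le> x" using r(2) x u(1) unfolding u(2)[symmetric] by (simp add: power_mono_iff)
    show "\<exists>j<3. z \<in> (\<lambda>u. w ^ j * of_real u) ` {0..x}"
    proof (cases "u = 0")
      case True
      then have "z = 0" using r u by auto
      then show ?thesis using x by (intro exI[of _ 0]) (auto intro!: image_eqI[of _ _ 0])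
    next
      case False
      have "(z / of_real u) ^ 3 = 1" using r(3) False unfolding u(2)[symmetric] by (simp add: power_divide)
      then have "z / of_real u \<in> {exp (2 * of_real pi * \<i> * of_nat j / of_nat 3) | j. j < 3}"
        using complex_roots_unity[of 3] by auto
      then obtain j where j: "j < 3" "z / of_real u = exp (2 * of_real pi * \<i> * of_nat j / of_nat 3)" by auto
      have "exp (2 * of_real pi * \<i> * of_nat j / of_nat 3) = w ^ j"
        unfolding w_def by (simp flip: exp_of_nat_mult) (simp add: mult_ac)
      then have "z = w ^ j * of_real u" using j False by (simp add: field_simps)
      then show ?thesis using j(1) u(1) ux by (intro exI[of _ j]) auto
    qed
  next
    assume "\<exists>j<3. z \<in> (\<lambda>u. w ^ j * of_real u) ` {0..x}"
    then obtain j where "z \<in> (\<lambda>u. w ^ j * of_real u) ` {0..x}" by blast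
    then obtain u where u: "0 \<le> u" "u \<le> x" "z = w ^ j * of_real u" by auto
    then have "z ^ 3 = of_real (u ^ 3)" by (simp add: power_mult_distrib wj)
    moreover have "0 \<le> u ^ 3" "u ^ 3 \<le> x ^ 3" using u by (auto intro: power_mono)
    ultimately show "z ^ 3 \<in> complex_of_real ` {0..x ^ 3}" by (intro image_eqI[of _ _ "u ^ 3"]) auto
  qed
  then show ?thesis unfolding Sigma1_def x_def[symmetric] w_def[symmetric] seg by auto
qed

text \<open>The points outside U whose cube lies in [0, r + 1] form a compact set; on it the cube
  attains a minimum, which exceeds r, and half of the gap serves as \<epsilon>.\<close>

lemma Sigma1_neighbourhood:
  assumes x: "x_star t0 t3 > 0" and U: "open U" "Sigma1 t0 t3 \<subseteq> U"
  obtains \<epsilon> where "\<epsilon> > 0" "\<And>z s. 0 \<le> s \<Longrightarrow> s \<le> x_star t0 t3 ^ 3 + \<epsilon> \<Longrightarrow> z ^ 3 = of_real s \<Longrightarrow> z \<in> U"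
proof -
  define r where "r = x_star t0 t3 ^ 3"
  have r: "r > 0" unfolding r_def using x by simp
  define C where "C = (\<lambda>z::complex. z ^ 3) -` (complex_of_real ` {0..r + 1}) - U"
  have "compact C"
  proof -
    have "closed (complex_of_real ` {0..r + 1})"
      by (intro compact_imp_closed compact_continuous_image continuous_intros compact_Icc)
    then have "closed C" unfolding C_def
      by (intro closed_Diff U closed_vimage continuous_intros)
    moreover have "norm z \<le> r + 1" if z: "z \<in> C" for z
    proof (rule ccontr)
      assume n: "\<not> norm z \<le> r + 1"
      have "norm z ^ 1 < norm z ^ 3" using n r by (intro power_strict_increasing) auto
      moreover have "norm z ^ 3 \<le> r + 1"
      proof -
        obtain s where "0 \<le> s" "s \<le> r + 1" "z ^ 3 = of_real s" using z unfolding C_def by auto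
        then show ?thesis by (metis norm_power norm_of_real abs_of_nonneg)
      qed
      ultimately show False using n by simp
    qed
    then have "bounded C" by (intro boundedI[of _ "r + 1"])
    ultimately show ?thesis by (simp add: compact_eq_bounded_closed)
  qed
  have inU: "z \<in> U" if "0 \<le> s" "s \<le> r" "z ^ 3 = of_real s" for z s
    using that U(2) unfolding Sigma1_def r_def by auto
  show ?thesis
  proof (cases "C = {}")
    case True
    show ?thesis
    proof (rule that[of 1])
      fix z :: complex and s assume "0 \<le> s" "s \<le> x_star t0 t3 ^ 3 + 1" "z ^ 3 = of_real s"
      then show "z \<in> U" using True unfolding C_def r_def by auto
    qed simp
  next
    case False
    have "continuous_on C (\<lambda>z. Re (z ^ 3))" by (intro continuous_intros)
    then obtain m where m: "m \<in> C" "\<And>z. z \<in> C \<Longrightarrow> Re (m ^ 3) \<le> Re (z ^ 3)"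
      using continuous_attains_inf[OF \<open>compact C\<close> False] by blast
    obtain s where s: "0 \<le> s" "s \<le> r + 1" "m ^ 3 = of_real s" "m \<notin> U" using m(1) unfolding C_def by auto
    have rs: "r < s" using inU[OF s(1) _ s(3)] s(4) by (cases "s \<le> r") auto
    show ?thesis
    proof (rule that[of "(s - r) / 2"])
      show "(s - r) / 2 > 0" using rs by simp
      fix z :: complex and u assume u: "0 \<le> u" "u \<le> x_star t0 t3 ^ 3 + (s - r) / 2" "z ^ 3 = of_real u"
      have us: "u < s" using u(2) rs unfolding r_def[symmetric] by (simp add: field_simps)
      show "z \<in> U"
      proof (rule ccontr)
        assume "z \<notin> U"
        then have "z \<in> C" unfolding C_def using u us s by auto
        from m(2)[OF this] show False unfolding u(3) s(3) using us by simp
      qed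
    qed
  qed
qed

theorem theorem2p3:
  fixes t0 t3 :: real
  assumes "t3 > 0" and "0 < t0" and "t0 < t0_crit t3"
  shows "(\<forall>\<^sub>F n in sequentially. \<forall>\<Gamma>. admissible_contours \<Gamma> \<longrightarrow> (\<exists>P. is_monic_OP \<Gamma> t0 t3 n P))
    \<and> Sigma1 t0 t3 =
        (\<Union>j<3. closed_segment 0 (exp (2 * of_real pi * \<i> / 3) ^ j * of_real (x_star t0 t3)))
    \<and> (\<forall>U. open U \<and> Sigma1 t0 t3 \<subseteq> U \<longrightarrow>
          (\<forall>\<^sub>F n in sequentially. \<forall>\<Gamma> P. admissible_contours \<Gamma> \<and> is_monic_OP \<Gamma> t0 t3 n P \<longrightarrow>
             (\<forall>z. poly P z = 0 \<longrightarrow> z \<in> U)))"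
proof (intro conjI allI impI)
  define \<kappa> where "\<kappa> = t0 * t3\<^sup>2"
  have \<kappa>: "0 < \<kappa>" "\<kappa> < 1 / 8"
    using assms unfolding \<kappa>_def t0_crit_def by (simp_all add: field_simps)
  have xs: "x_star t0 t3 > 0" using assms x_star_pos by simp
  \<comment> \<open>The tolerance 1 is arbitrary: existence rests on the positivity of the
    ratios.\<close>
  show "\<forall>\<^sub>F n in sequentially. \<forall>\<Gamma>. admissible_contours \<Gamma> \<longrightarrow> (\<exists>P. is_monic_OP \<Gamma> t0 t3 n P)"
    using start_X_bounds[OF \<kappa> zero_less_one] eventually_gt_at_top[of 0]
  proof eventually_elim
    case (elim n)
    then show ?case using assms unfolding \<kappa>_def by (intro allI impI monic_OP_from_ratios(1)) auto
  qed
  show "Sigma1 t0 t3 = (\<Union>j<3. closed_segment 0 (exp (2 * of_real pi * \<i> / 3) ^ j * of_real (x_star t0 t3)))"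
    by (rule Sigma1_segments[OF xs])
  fix U :: "complex set" assume U: "open U \<and> Sigma1 t0 t3 \<subseteq> U"
  obtain \<epsilon> where \<epsilon>: "\<epsilon> > 0" "\<And>z s. 0 \<le> s \<Longrightarrow> s \<le> x_star t0 t3 ^ 3 + \<epsilon> \<Longrightarrow> z ^ 3 = of_real s \<Longrightarrow> z \<in> U"
    using Sigma1_neighbourhood[OF xs] U by blast
  \<comment> \<open>At \<eta> = 0 the expression is the cube of \<open>x_star\<close>, so by
    continuity a small positive tolerance keeps it below that cube plus \<epsilon>.\<close>
  have "((\<lambda>\<eta>. 27 / 4 * ((fstar \<kappa> + \<eta>)\<^sup>2 / t3 ^ 3)) \<longlongrightarrow> 27 / 4 * ((fstar \<kappa> + 0)\<^sup>2 / t3 ^ 3)) (at_right 0)"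
    using assms by (intro tendsto_intros) auto
  then have "\<forall>\<^sub>F \<eta> in at_right 0. 27 / 4 * ((fstar \<kappa> + \<eta>)\<^sup>2 / t3 ^ 3) < x_star t0 t3 ^ 3 + \<epsilon>"
    by (rule order_tendstoD) (use \<epsilon>(1) x_star_cube assms in \<open>simp add: \<kappa>_def\<close>)
  then have "\<forall>\<^sub>F \<eta> in at_right 0. 0 < \<eta> \<and> 27 / 4 * ((fstar \<kappa> + \<eta>)\<^sup>2 / t3 ^ 3) < x_star t0 t3 ^ 3 + \<epsilon>"
    by (intro eventually_conj eventually_at_right_less)
  then obtain \<eta> where \<eta>: "0 < \<eta>" "27 / 4 * ((fstar \<kappa> + \<eta>)\<^sup>2 / t3 ^ 3) < x_star t0 t3 ^ 3 + \<epsilon>"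
    using eventually_happens'[OF trivial_limit_at_right_real] by blast
  show "\<forall>\<^sub>F n in sequentially. \<forall>\<Gamma> P. admissible_contours \<Gamma> \<and> is_monic_OP \<Gamma> t0 t3 n P \<longrightarrow>
             (\<forall>z. poly P z = 0 \<longrightarrow> z \<in> U)"
    using start_X_bounds[OF \<kappa> \<eta>(1)] eventually_gt_at_top[of 0]
  proof eventually_elim
    case (elim n)
    show ?case
    proof (intro allI impI)
      fix \<Gamma> P z assume a: "admissible_contours \<Gamma> \<and> is_monic_OP \<Gamma> t0 t3 n P" "poly P z = 0"
      then obtain s where "0 \<le> s" "s \<le> 27 / 4 * ((fstar \<kappa> + \<eta>)\<^sup>2 / t3 ^ 3)" "z ^ 3 = of_real s"
        using monic_OP_from_ratios(2)[of t0 t3 n \<Gamma> "fstar \<kappa> + \<eta>" P z] assms elim unfolding \<kappa>_def by auto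
      then show "z \<in> U" using \<eta>(2) by (intro \<epsilon>(2)) auto
    qed
  qed
qed

end
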